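(* Let $0 \le q \le 1$. Let $\mathcal{M} = ([n], \mathcal{I})$ be a matroid with rank function $\mathrm{rk}(\cdot)$, accessible through a rank oracle $\mathcal{O}_r$ (which, given $S\subseteq[n]$, returns $\mathrm{rk}(S)$) that answers each query in time $t_{\mathcal{O}_r}$. There exists an algorithm that takes as input external fields $\boldsymbol{\lambda} \in \mathbb{R}_{>0}^n$ and $\epsilon \in (0,1)$, and outputs a random set $S \subseteq [n]$ whose distribution is within total variation distance at most $\epsilon$ of $\pi_{RC,q}$, in expected time $O\big((1+\lambda_{\min}^{-1})\, n \log(n/\epsilon)\, (\log n + t_{\mathcal{O}_r})\big)$, where $\lambda_{\min} := \min_{i\in[n]} \lambda_i$.
   Context: The random cluster model $\pi_{RC,q}$ on subsets of $[n]$ is defined by $\pi_{RC,q}(S) \propto q^{-\mathrm{rk}(S)} \prod_{i \in S} \lambda_i$ for $S \subseteq [n]$; for $q=0$ it is understood as the distribution supported on the subsets $S$ of maximum rank $\mathrm{rk}(S)=\mathrm{rk}([n])$, with $\pi_{RC,0}(S)\propto\prod_{i\in S}\lambda_i$ on that support. The rank $\mathrm{rk}(S)$ of $S$ is the maximum size of an independent set contained in $S$. Total variation distance between distributions $\mu,\nu$ on a finite set $\Omega$ is $\frac12\sum_{X\in\Omega}|\mu(X)-\nu(X)|$. *)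

theory Defs
  imports "HOL-Probability.Probability"
begin

section \<open>Matroids and the random cluster model\<close>

locale matroid =
  fixes E :: "'a set" and I :: "'a set set"
  assumes finite_ground: "finite E"
    and indep_subset_ground: "X \<in> I \<Longrightarrow> X \<subseteq> E"
    and indep_empty: "{} \<in> I"
    and indep_hereditary: "X \<in> I \<Longrightarrow> Y \<subseteq> X \<Longrightarrow> Y \<in> I"
    and indep_exchange: "X \<in> I \<Longrightarrow> Y \<in> I \<Longrightarrow> card Y < card X \<Longrightarrow> \<exists>x\<in>X - Y. insert x Y \<in> I"

definition rank_of :: "'a set set \<Rightarrow> 'a set \<Rightarrow> nat" where
  "rank_of I S = Max {card T | T. T \<in> I \<and> T \<subseteq> S}"

definition rc_weight ::
  "'a set \<Rightarrow> ('a set \<Rightarrow> nat) \<Rightarrow> real \<Rightarrow> ('a \<Rightarrow> real) \<Rightarrow> 'a set \<Rightarrow> real" where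
  "rc_weight E rk q lam S =
     (if q = 0 then (if rk S = rk E then \<Prod>i\<in>S. lam i else 0)
      else q powi (- int (rk S)) * (\<Prod>i\<in>S. lam i))"

definition random_cluster ::
  "'a set \<Rightarrow> ('a set \<Rightarrow> nat) \<Rightarrow> real \<Rightarrow> ('a \<Rightarrow> real) \<Rightarrow> 'a set \<Rightarrow> real" where
  "random_cluster E rk q lam S =
     rc_weight E rk q lam S / (\<Sum>X\<in>Pow E. rc_weight E rk q lam X)"

definition tv_distance :: "'b set \<Rightarrow> ('b \<Rightarrow> real) \<Rightarrow> ('b \<Rightarrow> real) \<Rightarrow> real" where
  "tv_distance \<Omega> \<mu> \<nu> = (1 / 2) * (\<Sum>X\<in>\<Omega>. \<bar>\<mu> X - \<nu> X\<bar>)"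


section \<open>Randomized real RAM programs with a rank oracle\<close>

text \<open>
  The machine has natural-number arrays and real arrays, each named by a natural number and
  indexed by natural numbers, so that a scalar register is a cell with a constant index.
  Natural numbers support addition, truncated subtraction and halving; reals support exact field
  arithmetic and comparison. There is no conversion from reals to natural numbers, and the only
  source of randomness is a fair coin.
\<close>

record store =
  nats :: "nat \<Rightarrow> nat \<Rightarrow> nat"
  reals :: "nat \<Rightarrow> nat \<Rightarrow> real"

datatype nexp =
    NConst nat
  | NRead nat nexp
  | NAdd nexp nexp
  | NSub nexp nexp
  | NHalf nexp

datatype rexp =
    ROfNat nexp
  | RRead nat nexp
  | RAdd rexp rexp
  | RSub rexp rexp
  | RMul rexp rexp
  | RDiv rexp rexp

datatype bexp =
    NLess nexp nexp
  | RLess rexp rexp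
  | BNot bexp

fun nval :: "store \<Rightarrow> nexp \<Rightarrow> nat" where
  "nval s (NConst k) = k"
| "nval s (NRead a e) = nats s a (nval s e)"
| "nval s (NAdd e f) = nval s e + nval s f"
| "nval s (NSub e f) = nval s e - nval s f"
| "nval s (NHalf e) = nval s e div 2"

fun rval :: "store \<Rightarrow> rexp \<Rightarrow> real" where
  "rval s (ROfNat e) = real (nval s e)"
| "rval s (RRead a e) = reals s a (nval s e)"
| "rval s (RAdd e f) = rval s e + rval s f"
| "rval s (RSub e f) = rval s e - rval s f"
| "rval s (RMul e f) = rval s e * rval s f"
| "rval s (RDiv e f) = rval s e / rval s f"

fun bval :: "store \<Rightarrow> bexp \<Rightarrow> bool" where
  "bval s (NLess e f) = (nval s e < nval s f)"
| "bval s (RLess e f) = (rval s e < rval s f)"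
| "bval s (BNot b) = (\<not> bval s b)"

text \<open>
  In \<open>NAssign a e f\<close>, \<open>RAssign a e f\<close>, \<open>Flip a e\<close> and \<open>QueryRank a e b\<close> the target is the cell with
  index \<open>e\<close> of array \<open>a\<close>. A flip stores 0 or 1. A rank query passes its argument by
  reference, as the characteristic vector held in the natural-number array \<open>b\<close>.
\<close>

datatype com =
    Skip
  | NAssign nat nexp nexp
  | RAssign nat nexp rexp
  | Flip nat nexp
  | QueryRank nat nexp nat
  | Seq com com
  | Cond bexp com com
  | While bexp com

definition write_nat :: "nat \<Rightarrow> nat \<Rightarrow> nat \<Rightarrow> store \<Rightarrow> store" where
  "write_nat a i v s = s\<lparr>nats := (nats s)(a := (nats s a)(i := v))\<rparr>"

definition write_real :: "nat \<Rightarrow> nat \<Rightarrow> real \<Rightarrow> store \<Rightarrow> store" where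
  "write_real a i v s = s\<lparr>reals := (reals s)(a := (reals s a)(i := v))\<rparr>"

definition read_set :: "nat \<Rightarrow> nat \<Rightarrow> store \<Rightarrow> nat set" where
  "read_set n a s = {i \<in> {1..n}. nats s a i \<noteq> 0}"

text \<open>
  A configuration is the list of commands still to be executed together with the store; the empty
  list means that the program has halted. The matroid enters only through the oracle \<open>rk\<close>, which is
  only ever applied to subsets of \<open>{1..n}\<close>.
\<close>

type_synonym config = "com list \<times> store"

fun step :: "nat \<Rightarrow> (nat set \<Rightarrow> nat) \<Rightarrow> config \<Rightarrow> config pmf" where
  "step n rk ([], s) = return_pmf ([], s)"
| "step n rk (Skip # cs, s) = return_pmf (cs, s)"
| "step n rk (NAssign a e f # cs, s) = return_pmf (cs, write_nat a (nval s e) (nval s f) s)"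
| "step n rk (RAssign a e f # cs, s) = return_pmf (cs, write_real a (nval s e) (rval s f) s)"
| "step n rk (Flip a e # cs, s) =
     map_pmf (\<lambda>b. (cs, write_nat a (nval s e) (if b then 1 else 0) s)) (bernoulli_pmf (1 / 2))"
| "step n rk (QueryRank a e b # cs, s) =
     return_pmf (cs, write_nat a (nval s e) (rk (read_set n b s)) s)"
| "step n rk (Seq c d # cs, s) = return_pmf (c # d # cs, s)"
| "step n rk (Cond b c d # cs, s) = return_pmf ((if bval s b then c else d) # cs, s)"
| "step n rk (While b c # cs, s) = return_pmf (if bval s b then c # While b c # cs else cs, s)"

text \<open>
  Each step costs one time unit, plus \<open>t\<close> for an oracle query. Expressions are not charged by size:
  in a fixed program their size is bounded, so this changes running times by a constant factor only.
\<close>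

fun step_cost :: "real \<Rightarrow> config \<Rightarrow> real" where
  "step_cost t ([], s) = 0"
| "step_cost t (QueryRank a e b # cs, s) = 1 + t"
| "step_cost t (c # cs, s) = 1"

fun run :: "nat \<Rightarrow> (nat set \<Rightarrow> nat) \<Rightarrow> nat \<Rightarrow> config \<Rightarrow> config pmf" where
  "run n rk 0 c = return_pmf c"
| "run n rk (Suc k) c = bind_pmf (run n rk k c) (step n rk)"

text \<open>The total time is the sum over \<open>k\<close> of the cost incurred by the configuration after \<open>k\<close> steps.\<close>

definition expected_time :: "nat \<Rightarrow> (nat set \<Rightarrow> nat) \<Rightarrow> real \<Rightarrow> com \<Rightarrow> store \<Rightarrow> ennreal" where
  "expected_time n rk t p s =
     (\<Sum>k. \<integral>\<^sup>+ c. ennreal (step_cost t c) \<partial>measure_pmf (run n rk k ([p], s)))"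

text \<open>
  The output is the set held in natural-number array 1 on halting. Halted configurations are
  stationary, so the probabilities below are nondecreasing in \<open>k\<close>. As \<open>\<mu>\<close> has total mass 1, having
  output distribution \<open>\<mu>\<close> entails almost sure termination.
\<close>

definition output_distribution ::
  "nat \<Rightarrow> (nat set \<Rightarrow> nat) \<Rightarrow> com \<Rightarrow> store \<Rightarrow> nat set pmf \<Rightarrow> bool" where
  "output_distribution n rk p s \<mu> \<longleftrightarrow>
     (\<forall>X. pmf \<mu> X =
        (SUP k. measure_pmf.prob (run n rk k ([p], s)) {c. fst c = [] \<and> read_set n 1 (snd c) = X}))"

text \<open>
  Initially \<open>n\<close> is in natural-number cell (0, 0), \<open>q\<close> and \<open>\<epsilon>\<close> are in real cells (0, 0) and (0, 1),
  the external fields are in cells 1 to \<open>n\<close> of real array 1, and all other cells are 0.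
\<close>

definition input_store :: "nat \<Rightarrow> real \<Rightarrow> (nat \<Rightarrow> real) \<Rightarrow> real \<Rightarrow> store" where
  "input_store n q lam \<epsilon> =
     \<lparr>nats = (\<lambda>a i. if a = 0 \<and> i = 0 then n else 0),
      reals = (\<lambda>a i. if a = 0 \<and> i = 0 then q
                     else if a = 0 \<and> i = 1 then \<epsilon>
                     else if a = 1 \<and> i \<in> {1..n} then lam i
                     else 0)\<rparr>"

end

theory Submission
  imports Defs
begin

text \<open>
  A set \<open>S\<close> is encoded by the sequences of length \<open>n\<close> that consist of the elements outside \<open>S\<close> and
  of \<open>card S\<close> dummies. The chain resamples one uniformly chosen entry: it adds a uniform element \<open>u\<close>
  to \<open>S\<close>, and then either keeps the new set \<open>A\<close>, with weight \<open>card A\<close>, or removes some \<open>j \<in> A\<close>, with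
  weight \<open>wt (A - {j}) / wt A \<le> 1 / lam j\<close>. Rejection sampling realises the second
  half of a step with \<open>O(1 + 1 / \<lambda>\<^sub>m\<^sub>i\<^sub>n)\<close> expected trials of a fair coin and a uniform element of \<open>A\<close>.

  Given all but two entries of the random sequence, the covariance form of the remaining two is
  negative, because being in series is an equivalence relation; this is where \<open>q \<le> 1\<close> enters. Negative
  covariance trickles down to all shorter partial sequences. It makes the relative entropy of
  the first \<open>j\<close> entries a convex function of \<open>j\<close>, so that forgetting one of the \<open>n\<close> entries contracts
  the relative entropy by \<open>1 - 1 / n\<close>.

  The chain starts at the full set if \<open>1 / \<lambda>\<^sub>m\<^sub>i\<^sub>n \<le> 2 ^ n\<close>; otherwise the time bound allows
  an exhaustive search for the heaviest set. Either way the relative entropy of the start is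
  at most \<open>2 * n\<^sup>2\<close>, and \<open>O(n log (n / \<epsilon>))\<close> steps suffice. The running time is bounded by a weakest
  preexpectation calculus. With all costs zero the same calculus bounds the output
  probabilities from above; since the program terminates almost surely, these bounds are attained.
\<close>

section \<open>Negative covariance\<close>

text \<open>Entropy, not variance, is contracted because the probability of the start is only
  bounded below by \<open>1 / 2 ^ (n + n * n)\<close>. The step count then depends on the logarithm
  of the initial entropy, whereas a spectral gap of order \<open>1 / n\<close> would charge for that
  entropy itself, a factor \<open>n\<^sup>2\<close>. The search removes another obstacle: the
  initial entropy of the full set grows with
  \<open>n * ln (1 / \<lambda>\<^sub>m\<^sub>i\<^sub>n)\<close>, and for tiny fields even the
  logarithm of this exceeds any multiple of \<open>ln (n / \<epsilon>)\<close>. Dummies have two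
  purposes. They give all sets codes of the same length, hence an exchangeable sequence. They also
  form a hub: a dummy can follow every partial sequence that has positive probability and room for
  one more entry, which keeps the graphs of pairs connected even at \<open>q = 0\<close>. Weights
  are measured relative to the full set, through the complement. Powers of \<open>q\<close> then
  have natural exponents, and \<open>q = 0\<close> needs no case of its own until the weights are
  compared with \<open>random_cluster\<close>.\<close>

lemma injective_imp_solvable:
  fixes A :: "'a \<Rightarrow> 'b \<Rightarrow> real"
  assumes "finite R" "finite C" "card R = card C"
    and "\<And>h. (\<forall>b\<in>R. (\<Sum>c\<in>C. A b c * h c) = 0) \<Longrightarrow> \<forall>c\<in>C. h c = 0"
  shows "\<exists>h. \<forall>b\<in>R. (\<Sum>c\<in>C. A b c * h c) = f b"
  using assms(2,1,3,4)
proof (induction C arbitrary: R A f rule: finite_induct)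
  case empty
  then show ?case by simp
next
  case (insert k C)
  \<comment> \<open>A zero column would put the unit vector at \<open>k\<close> into the kernel. The
    entry found is the pivot of one step of Gaussian elimination.\<close>
  have "\<exists>r\<in>R. A r k \<noteq> 0"
  proof (rule ccontr)
    assume "\<not> ?thesis"
    then have "\<forall>b\<in>R. (\<Sum>c\<in>insert k C. A b c * (if c = k then 1 else 0)) = 0"
      using insert.hyps by (auto intro!: sum.neutral)
    from insert.prems(3)[OF this] show False by auto
  qed
  then obtain r where r: "r \<in> R" "A r k \<noteq> 0" by blast
  define A' where "A' b c = A b c - A b k * A r c / A r k" for b c
  \<comment> \<open>Back substitution: giving unknown \<open>k\<close> the value that makes row
    \<open>r\<close> equal to \<open>y\<close> turns a vector for the reduced matrix
    \<open>A'\<close> into one for \<open>A\<close>.\<close>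
  have lift: "(\<Sum>c\<in>insert k C. A b c * (if c = k then (y - (\<Sum>c\<in>C. A r c * h c)) / A r k else h c))
     = (\<Sum>c\<in>C. A' b c * h c) + A b k * y / A r k" for b h y
  proof -
    have "(\<Sum>c\<in>insert k C. A b c * (if c = k then (y - (\<Sum>c\<in>C. A r c * h c)) / A r k else h c))
      = A b k * ((y - (\<Sum>c\<in>C. A r c * h c)) / A r k) + (\<Sum>c\<in>C. A b c * h c)"
      using insert.hyps by (auto intro!: sum.cong)
    also have "(\<Sum>c\<in>C. A b c * h c) = (\<Sum>c\<in>C. A' b c * h c) + A b k / A r k * (\<Sum>c\<in>C. A r c * h c)"
      unfolding A'_def sum_distrib_left sum.distrib[symmetric]
      by (intro sum.cong) (auto simp: algebra_simps)
    finally show ?thesis by (simp add: algebra_simps diff_divide_distrib)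
  qed
  have A'r: "(\<Sum>c\<in>C. A' r c * h c) = 0" for h
    using r by (simp add: A'_def)
  have "\<exists>h. \<forall>b\<in>R - {r}. (\<Sum>c\<in>C. A' b c * h c) = f b - A b k * f r / A r k"
  proof (rule insert.IH)
    show "finite (R - {r})" "card (R - {r}) = card C"
      using insert.prems insert.hyps r by auto
    fix h assume h: "\<forall>b\<in>R - {r}. (\<Sum>c\<in>C. A' b c * h c) = 0"
    let ?h = "\<lambda>c. if c = k then (0 - (\<Sum>c\<in>C. A r c * h c)) / A r k else h c"
    have "\<forall>b\<in>R. (\<Sum>c\<in>insert k C. A b c * ?h c) = 0"
      using lift[of _ 0 h] h A'r by (metis (no_types, lifting) Diff_iff add_0 div_0 insertE mult_zero_right singletonD)
    from insert.prems(3)[OF this] have "\<forall>c\<in>insert k C. ?h c = 0" .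
    then show "\<forall>c\<in>C. h c = 0"
      using insert.hyps by (metis insertCI)
  qed
  then obtain h where h: "\<forall>b\<in>R - {r}. (\<Sum>c\<in>C. A' b c * h c) = f b - A b k * f r / A r k" by blast
  show ?case
  proof (intro exI ballI)
    fix b assume "b \<in> R"
    then show "(\<Sum>c\<in>insert k C. A b c * (if c = k then (f r - (\<Sum>c\<in>C. A r c * h c)) / A r k else h c)) = f b"
      unfolding lift using h A'r r by (cases "b = r") auto
  qed
qed

section \<open>Quadratic forms of weighted graphs\<close>

lemma quadratic_form_swap:
  fixes M :: "'a \<Rightarrow> 'a \<Rightarrow> real"
  assumes "\<And>b c. b \<in> V \<Longrightarrow> c \<in> V \<Longrightarrow> M b c = M c b"
  shows "(\<Sum>b\<in>V. \<Sum>c\<in>V. u b * w c * M b c) = (\<Sum>b\<in>V. \<Sum>c\<in>V. w b * u c * M b c)"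
  by (subst sum.swap, intro sum.cong refl) (auto simp: assms)

text \<open>Summation by parts. With the row sums \<open>d\<close> on the diagonal the form is the
  Laplacian of the weighted graph \<open>M\<close>; the right-hand side is its polarised Dirichlet
  form, on which nonnegativity is visible.\<close>

lemma dirichlet_form_eq:
  fixes M :: "'a \<Rightarrow> 'a \<Rightarrow> real"
  assumes sym: "\<And>b c. b \<in> V \<Longrightarrow> c \<in> V \<Longrightarrow> M b c = M c b"
    and d: "\<And>b. b \<in> V \<Longrightarrow> d b = (\<Sum>c\<in>V. M b c)"
  shows "(\<Sum>b\<in>V. d b * u b * w b) - (\<Sum>b\<in>V. \<Sum>c\<in>V. u b * w c * M b c)
    = (\<Sum>b\<in>V. \<Sum>c\<in>V. M b c * ((u b - u c) * (w b - w c))) / 2"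
proof -
  have 1: "(\<Sum>b\<in>V. \<Sum>c\<in>V. M b c * (u b * w b)) = (\<Sum>b\<in>V. d b * u b * w b)"
    by (intro sum.cong refl) (simp add: d sum_distrib_right mult.assoc)
  have 2: "(\<Sum>b\<in>V. \<Sum>c\<in>V. M b c * (u c * w c)) = (\<Sum>b\<in>V. d b * u b * w b)"
    unfolding 1[symmetric] by (subst sum.swap, intro sum.cong refl) (auto simp: sym)
  have "(\<Sum>b\<in>V. \<Sum>c\<in>V. M b c * ((u b - u c) * (w b - w c)))
     = (\<Sum>b\<in>V. \<Sum>c\<in>V. M b c * (u b * w b)) + (\<Sum>b\<in>V. \<Sum>c\<in>V. M b c * (u c * w c))
       - (\<Sum>b\<in>V. \<Sum>c\<in>V. u b * w c * M b c) - (\<Sum>b\<in>V. \<Sum>c\<in>V. w b * u c * M b c)"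
    unfolding sum.distrib[symmetric] sum_subtractf[symmetric]
    by (intro sum.cong refl) (simp add: algebra_simps)
  moreover have "(\<Sum>b\<in>V. \<Sum>c\<in>V. w b * u c * M b c) = (\<Sum>b\<in>V. \<Sum>c\<in>V. u b * w c * M b c)"
    by (rule quadratic_form_swap[OF sym])
  ultimately show ?thesis unfolding 1 2 by simp
qed

text \<open>On the hyperplane \<open>\<Sum>b\<in>V. d b * f b = 0\<close> write \<open>f = (1 - P) h\<close> for the random walk
  operator \<open>P = M / d\<close>. The hypothesis says that \<open>P \<le> P\<^sup>2\<close>, hence \<open>1 - P \<le> (1 - P)\<^sup>2\<close>, and the
  Cauchy--Schwarz inequality for the Dirichlet form gives \<open>1 \<le> 1 - P\<close>.\<close>

lemma quadratic_form_nonpos: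
  fixes M :: "'a \<Rightarrow> 'a \<Rightarrow> real"
  assumes V: "finite V" "z \<in> V"
    and nonneg: "\<And>b c. b \<in> V \<Longrightarrow> c \<in> V \<Longrightarrow> M b c \<ge> 0"
    and sym: "\<And>b c. b \<in> V \<Longrightarrow> c \<in> V \<Longrightarrow> M b c = M c b"
    and d: "\<And>b. b \<in> V \<Longrightarrow> d b = (\<Sum>c\<in>V. M b c)"
    and star: "\<And>b. b \<in> V \<Longrightarrow> d b > 0 \<Longrightarrow> M z b > 0"
    and square: "\<And>v. (\<Sum>b\<in>V. \<Sum>c\<in>V. v b * v c * M b c) \<le> (\<Sum>a\<in>V. (\<Sum>b\<in>V. v b * M a b)\<^sup>2 / d a)"
    and f: "(\<Sum>b\<in>V. d b * f b) = 0"
  shows "(\<Sum>b\<in>V. \<Sum>c\<in>V. f b * f c * M b c) \<le> 0"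
proof -
  \<comment> \<open>Grounding the Laplacian at the hub \<open>z\<close> and dropping the isolated
    vertices makes it invertible on \<open>W\<close>.\<close>
  define W where "W = {b\<in>V. b \<noteq> z \<and> d b > 0}"
  have W: "finite W" "W \<subseteq> V" using V by (auto simp: W_def)
  have d0: "d b \<ge> 0" if "b \<in> V" for b using that d nonneg by (simp add: sum_nonneg)
  have M0: "M b c = 0" "M c b = 0" if "b \<in> V" "c \<in> V" "\<not> d b > 0" for b c
  proof -
    have "d b = 0" using d0[OF that(1)] that by simp
    then have "\<forall>c\<in>V. M b c = 0"
      using d[OF that(1)] nonneg that V by (simp add: sum_nonneg_eq_0_iff)
    then show "M b c = 0" "M c b = 0" using sym that by auto
  qed
  have W_sum: "(\<Sum>c\<in>V. M b c * g c) = (\<Sum>c\<in>W. M b c * g c)" if "b \<in> V" "g z = 0" for b g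
    by (rule sum.mono_neutral_right) (use V W M0 that in \<open>auto simp: W_def\<close>)
  define Q where "Q u w = (\<Sum>b\<in>V. \<Sum>c\<in>V. u b * w c * M b c)" for u w
  define F where "F u w = (\<Sum>b\<in>V. d b * u b * w b) - Q u w" for u w
  have F: "F u w = (\<Sum>b\<in>V. \<Sum>c\<in>V. M b c * ((u b - u c) * (w b - w c))) / 2" for u w
    unfolding F_def Q_def by (rule dirichlet_form_eq[OF sym d])
  have F0: "F u u \<ge> 0" for u
    unfolding F by (intro divide_nonneg_pos sum_nonneg mult_nonneg_nonneg[OF nonneg zero_le_square]) auto
  \<comment> \<open>The kernel is trivial: a kernel vector, extended by 0, has zero Dirichlet energy
    and is constant along edges. Every vertex of \<open>W\<close> is joined to \<open>z\<close>,
    where the extension vanishes.\<close>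
  have "\<exists>h. \<forall>b\<in>W. (\<Sum>c\<in>W. ((if b = c then d b else 0) - M b c) * h c) = d b * f b"
  proof (rule injective_imp_solvable)
    fix h assume h: "\<forall>b\<in>W. (\<Sum>c\<in>W. ((if b = c then d b else 0) - M b c) * h c) = 0"
    define g where "g c = (if c \<in> W then h c else 0)" for c
    have gz: "g z = 0" by (simp add: g_def W_def)
    have "d b * g b - (\<Sum>c\<in>V. M b c * g c) = 0" if "b \<in> W" for b
    proof -
      have "(\<Sum>c\<in>W. ((if b = c then d b else 0) - M b c) * h c)
         = (\<Sum>c\<in>W. (if b = c then d b * h c else 0)) - (\<Sum>c\<in>W. M b c * h c)"
        unfolding sum_subtractf[symmetric] by (intro sum.cong) (auto simp: algebra_simps)
      also have "(\<Sum>c\<in>W. (if b = c then d b * h c else 0)) = d b * g b"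
        using that W by (simp add: g_def)
      also have "(\<Sum>c\<in>W. M b c * h c) = (\<Sum>c\<in>V. M b c * g c)"
        using that W gz by (subst W_sum) (auto simp: g_def)
      finally show ?thesis using h that by simp
    qed
    then have "(\<Sum>b\<in>V. g b * (d b * g b - (\<Sum>c\<in>V. M b c * g c))) = 0"
      by (intro sum.neutral) (auto simp: g_def)
    then have "F g g = 0"
      unfolding F_def Q_def by (simp add: algebra_simps sum_subtractf sum_distrib_left)
    then have "(\<Sum>b\<in>V. \<Sum>c\<in>V. M b c * ((g b - g c) * (g b - g c))) = 0"
      unfolding F by simp
    then have "\<forall>b\<in>V. \<forall>c\<in>V. M b c * ((g b - g c) * (g b - g c)) = 0"
      using V nonneg by (simp add: sum_nonneg_eq_0_iff sum_nonneg)
    then have "\<forall>c\<in>V. M z c * ((g z - g c) * (g z - g c)) = 0" using V by blast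
    then have zero: "M z c * ((g z - g c) * (g z - g c)) = 0" if "c \<in> V" for c using that by blast
    show "\<forall>c\<in>W. h c = 0"
    proof
      fix c assume c: "c \<in> W"
      then have "M z c > 0" using star by (simp add: W_def)
      with zero[of c] c gz W have "g c = 0" by auto
      with c show "h c = 0" by (simp add: g_def)
    qed
  qed (use W in auto)
  then obtain h where h: "\<forall>b\<in>W. (\<Sum>c\<in>W. ((if b = c then d b else 0) - M b c) * h c) = d b * f b"
    by blast
  define g where "g c = (if c \<in> W then h c else 0)" for c
  have gz: "g z = 0" by (simp add: g_def W_def)
  have gW: "d b * g b - (\<Sum>c\<in>V. M b c * g c) = d b * f b" if "b \<in> W" for b
  proof -
    have "(\<Sum>c\<in>W. ((if b = c then d b else 0) - M b c) * h c)
       = (\<Sum>c\<in>W. (if b = c then d b * h c else 0)) - (\<Sum>c\<in>W. M b c * h c)"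
      unfolding sum_subtractf[symmetric] by (intro sum.cong) (auto simp: algebra_simps)
    also have "(\<Sum>c\<in>W. (if b = c then d b * h c else 0)) = d b * g b"
      using that W by (simp add: g_def)
    also have "(\<Sum>c\<in>W. M b c * h c) = (\<Sum>c\<in>V. M b c * g c)"
      using that W gz by (subst W_sum) (auto simp: g_def)
    finally show ?thesis using h that by simp
  qed
  have gV': "d b * g b - (\<Sum>c\<in>V. M b c * g c) = d b * f b" if "b \<in> V" "b \<noteq> z" for b
  proof (cases "d b > 0")
    case True
    then show ?thesis using that gW by (simp add: W_def)
  next
    case False
    moreover from False have "d b = 0" using d0 that by force
    ultimately show ?thesis using M0 that by simp
  qed
  \<comment> \<open>The Laplacian of \<open>g\<close> sums to 0 over \<open>V\<close>, and so does
    \<open>d b * f b\<close>; hence the equation at \<open>z\<close> follows from the equations at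
    the other vertices.\<close>
  have "(\<Sum>b\<in>V. \<Sum>c\<in>V. M b c * g c) = (\<Sum>c\<in>V. d c * g c)"
    by (subst sum.swap, intro sum.cong refl) (auto simp: sum_distrib_right[symmetric] d sym intro!: sum.cong)
  then have "(\<Sum>b\<in>V. d b * g b - (\<Sum>c\<in>V. M b c * g c)) = 0"
    unfolding sum_subtractf by simp
  then have gVz: "d z * g z - (\<Sum>c\<in>V. M z c * g c) = d z * f z"
    using f gV' V by (simp add: sum.remove[of V z])
  have gV: "d b * g b - (\<Sum>c\<in>V. M b c * g c) = d b * f b" if "b \<in> V" for b
    using gV' gVz that by (cases "b = z") auto
  have MgV: "(\<Sum>c\<in>V. g c * M b c) = d b * g b - d b * f b" if "b \<in> V" for b
    using gV[OF that] by (simp add: mult.commute)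
  define N where "N = (\<Sum>b\<in>V. d b * f b * f b)"
  have Ffg: "F f g = N"
  proof -
    have "F f g = (\<Sum>b\<in>V. f b * (d b * g b - (\<Sum>c\<in>V. M b c * g c)))"
      unfolding F_def Q_def by (simp add: algebra_simps sum_subtractf sum_distrib_left)
    also have "\<dots> = N" unfolding N_def using gV by (simp add: algebra_simps)
    finally show ?thesis .
  qed
  \<comment> \<open>Since \<open>P g = g - f\<close>, the hypothesis \<open>square\<close> for
    \<open>g\<close> reads
    \<open>Q g g \<le> 2 * Q g g - (\<Sum>b\<in>V. d b * g b * g b) + N\<close>, which is the
    claim.\<close>
  have "F g g \<le> N"
  proof -
    have "(\<Sum>a\<in>V. (\<Sum>b\<in>V. g b * M a b)\<^sup>2 / d a) = (\<Sum>a\<in>V. d a * (g a - f a)\<^sup>2)"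
    proof (intro sum.cong refl)
      fix a assume "a \<in> V"
      then show "(\<Sum>b\<in>V. g b * M a b)\<^sup>2 / d a = d a * (g a - f a)\<^sup>2"
        by (simp add: MgV right_diff_distrib[symmetric] power_mult_distrib) (simp add: power2_eq_square)
    qed
    also have "\<dots> = (\<Sum>a\<in>V. d a * g a * g a) - 2 * (\<Sum>a\<in>V. d a * f a * g a) + N"
      unfolding N_def sum_distrib_left sum.distrib[symmetric] sum_subtractf[symmetric]
      by (intro sum.cong) (auto simp: power2_eq_square algebra_simps)
    also have "(\<Sum>a\<in>V. d a * f a * g a) = (\<Sum>a\<in>V. d a * g a * g a) - Q g g"
    proof -
      have "(\<Sum>a\<in>V. d a * f a * g a) = (\<Sum>a\<in>V. g a * (d a * g a - (\<Sum>c\<in>V. M a c * g c)))"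
        using gV by (simp add: algebra_simps)
      also have "\<dots> = (\<Sum>a\<in>V. d a * g a * g a) - Q g g"
        unfolding Q_def by (simp add: algebra_simps sum_subtractf sum_distrib_left)
      finally show ?thesis .
    qed
    finally show ?thesis using square[of g] unfolding F_def Q_def by simp
  qed
  moreover have "F f g ^ 2 \<le> F f f * F g g"
  proof -
    \<comment> \<open>The argument is the component of \<open>f\<close> orthogonal to
      \<open>g\<close> with respect to \<open>F\<close>, multiplied by \<open>F g g\<close> to avoid
      a division.\<close>
    have "0 \<le> F (\<lambda>b. F g g * f b - F f g * g b) (\<lambda>b. F g g * f b - F f g * g b)"
      by (rule F0)
    also have "\<dots> = F g g * (F g g * F f f - F f g ^ 2)"
    proof -
      have "F (\<lambda>b. x * f b - y * g b) (\<lambda>b. x * f b - y * g b)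
        = x\<^sup>2 * F f f - 2 * x * y * F f g + y\<^sup>2 * F g g" for x y
        unfolding F sum_distrib_left times_divide_eq_right sum_divide_distrib
          sum.distrib[symmetric] sum_subtractf[symmetric]
        by (intro sum.cong refl) (simp add: power2_eq_square field_simps)
      from this[of "F g g" "F f g"] show ?thesis by (simp add: power2_eq_square algebra_simps)
    qed
    finally have *: "0 \<le> F g g * (F g g * F f f - F f g ^ 2)" .
    show ?thesis
    proof (cases "F g g > 0")
      case True
      with * show ?thesis by (simp add: zero_le_mult_iff mult.commute)
    next
      case False
      then have "F g g = 0" using F0[of g] by simp
      moreover have "F f f * 0 \<ge> F f g ^ 2"
      proof -
        have "(\<Sum>b\<in>V. \<Sum>c\<in>V. M b c * ((g b - g c) * (g b - g c))) = 0"
          using \<open>F g g = 0\<close> unfolding F by simp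
        then have "\<forall>b\<in>V. \<forall>c\<in>V. M b c * ((g b - g c) * (g b - g c)) = 0"
          using V nonneg by (simp add: sum_nonneg_eq_0_iff sum_nonneg)
        then have "(\<Sum>b\<in>V. \<Sum>c\<in>V. M b c * ((f b - f c) * (g b - g c))) = 0"
          by (intro sum.neutral ballI) (auto simp: mult.left_commute)
        then have "F f g = 0" unfolding F by simp
        then show ?thesis by simp
      qed
      ultimately show ?thesis by simp
    qed
  qed
  moreover have N0: "N \<ge> 0" unfolding N_def using d0 by (auto intro!: sum_nonneg simp: mult.assoc)
  \<comment> \<open>Cauchy-Schwarz with \<open>F f g = N\<close> and \<open>F g g \<le> N\<close>.
    Cancelling \<open>N\<close> requires \<open>N > 0\<close>; if \<open>N = 0\<close>, then
    \<open>f\<close> vanishes wherever \<open>d\<close> does not, and the form is 0.\<close>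
  ultimately have "N * N \<le> F f f * N"
    using F0[of f] Ffg by (metis mult_left_mono order_trans power2_eq_square)
  moreover have "F f f = N - Q f f" unfolding F_def N_def ..
  ultimately have NQ: "N * Q f f \<le> 0" by (simp add: algebra_simps)
  have "Q f f \<le> 0"
  proof (cases "N = 0")
    case True
    then have "\<forall>b\<in>V. d b * f b * f b = 0"
      using V d0 unfolding N_def by (subst (asm) sum_nonneg_eq_0_iff) (auto simp: mult.assoc)
    then have "f b * f c * M b c = 0" if "b \<in> V" "c \<in> V" for b c
      using M0[OF that] that by (cases "d b > 0") auto
    then show ?thesis unfolding Q_def by (intro eq_refl sum.neutral ballI) blast
  next
    case False
    then show ?thesis using N0 NQ by (simp add: mult_le_0_iff)
  qed
  then show ?thesis unfolding Q_def .
qed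

text \<open>Subtracting from \<open>v\<close> its \<open>d\<close>-weighted mean \<open>m\<close>
  lands in the hyperplane of \<open>quadratic_form_nonpos\<close>. Expanding the form there leaves
  the form of \<open>v\<close> minus \<open>m * m * D\<close>, because \<open>d\<close> consists of
  the row sums of \<open>M\<close>.\<close>

lemma quadratic_form_le_square:
  fixes M :: "'a \<Rightarrow> 'a \<Rightarrow> real"
  assumes V: "finite V" "z \<in> V"
    and nonneg: "\<And>b c. b \<in> V \<Longrightarrow> c \<in> V \<Longrightarrow> M b c \<ge> 0"
    and sym: "\<And>b c. b \<in> V \<Longrightarrow> c \<in> V \<Longrightarrow> M b c = M c b"
    and d: "\<And>b. b \<in> V \<Longrightarrow> d b = (\<Sum>c\<in>V. M b c)"
    and star: "\<And>b. b \<in> V \<Longrightarrow> d b > 0 \<Longrightarrow> M z b > 0"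
    and square: "\<And>v. (\<Sum>b\<in>V. \<Sum>c\<in>V. v b * v c * M b c) \<le> (\<Sum>a\<in>V. (\<Sum>b\<in>V. v b * M a b)\<^sup>2 / d a)"
  shows "(\<Sum>b\<in>V. \<Sum>c\<in>V. v b * v c * M b c) * (\<Sum>b\<in>V. d b) \<le> (\<Sum>b\<in>V. v b * d b)\<^sup>2"
proof -
  define D where "D = (\<Sum>b\<in>V. d b)"
  have d0: "d b \<ge> 0" if "b \<in> V" for b using that d nonneg by (simp add: sum_nonneg)
  show ?thesis
  proof (cases "D = 0")
    case True
    then show ?thesis by (simp add: D_def)
  next
    case False
    moreover have "D \<ge> 0" unfolding D_def by (intro sum_nonneg d0)
    ultimately have D: "D > 0" by simp
    define m where "m = (\<Sum>b\<in>V. v b * d b) / D"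
    have m: "(\<Sum>b\<in>V. v b * d b) = m * D" using D by (simp add: m_def)
    have "(\<Sum>b\<in>V. d b * (v b - m)) = 0"
      using m unfolding D_def by (simp add: algebra_simps sum_subtractf sum_distrib_left)
    from quadratic_form_nonpos[OF V nonneg sym d star square this]
    have "(\<Sum>b\<in>V. \<Sum>c\<in>V. (v b - m) * (v c - m) * M b c) \<le> 0" by blast
    also have "(\<Sum>b\<in>V. \<Sum>c\<in>V. (v b - m) * (v c - m) * M b c)
      = (\<Sum>b\<in>V. \<Sum>c\<in>V. v b * v c * M b c) - m * (\<Sum>b\<in>V. \<Sum>c\<in>V. v b * 1 * M b c)
        - m * (\<Sum>b\<in>V. \<Sum>c\<in>V. 1 * v c * M b c) + m * m * (\<Sum>b\<in>V. \<Sum>c\<in>V. M b c)"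
      unfolding sum_distrib_left sum.distrib[symmetric] sum_subtractf[symmetric]
      by (intro sum.cong refl) (simp add: algebra_simps)
    also have "(\<Sum>b\<in>V. \<Sum>c\<in>V. 1 * v c * M b c) = (\<Sum>b\<in>V. \<Sum>c\<in>V. v b * 1 * M b c)"
      by (rule quadratic_form_swap[OF sym])
    also have "(\<Sum>b\<in>V. \<Sum>c\<in>V. v b * 1 * M b c) = m * D"
      unfolding m[symmetric] by (simp add: d sum_distrib_left)
    also have "(\<Sum>b\<in>V. \<Sum>c\<in>V. M b c) = D" unfolding D_def by (simp add: d)
    finally have "(\<Sum>b\<in>V. \<Sum>c\<in>V. v b * v c * M b c) \<le> m * m * D" by (simp add: algebra_simps)
    then have "(\<Sum>b\<in>V. \<Sum>c\<in>V. v b * v c * M b c) * D \<le> m * m * D * D" using D by simp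
    then show ?thesis unfolding m D_def[symmetric] by (simp add: power2_eq_square algebra_simps)
  qed
qed

text \<open>\<open>G x\<close> models the unnormalised probability that the first
  \<open>size x\<close> entries of an exchangeable sequence of length \<open>n\<close> spell a fixed
  ordering of \<open>x\<close>; summing over the next entry gives \<open>G_rec\<close>.
  \<open>G_base\<close> is negative covariance when two entries are left. \<open>G_star\<close>
  makes \<open>z\<close> a hub in the graph of the next two entries, which supplies the connectivity
  for the trickling down.\<close>

locale symmetric_weight =
  fixes V :: "'a set" and z :: 'a and n :: nat and G :: "'a multiset \<Rightarrow> real"
  assumes finite_V: "finite V" and z: "z \<in> V"
    and G_nonneg: "G x \<ge> 0"
    and G_rec: "size x < n \<Longrightarrow> G x = (\<Sum>b\<in>V. G (add_mset b x))"
    and G_base: "size x + 2 = n \<Longrightarrow>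
      (\<Sum>b\<in>V. \<Sum>c\<in>V. v b * v c * G (add_mset b (add_mset c x))) * G x
      \<le> (\<Sum>b\<in>V. v b * G (add_mset b x))\<^sup>2"
    and G_star: "size x + 2 \<le> n \<Longrightarrow> b \<in> V \<Longrightarrow> G (add_mset b x) > 0 \<Longrightarrow>
      G (add_mset z (add_mset b x)) > 0"
begin

text \<open>The law of two further entries after \<open>x\<close> is a mixture, over a third entry
  \<open>a\<close>, of their laws after \<open>x\<close> and \<open>a\<close>. The induction
  hypotheses for all \<open>a\<close>, divided by \<open>G (add_mset a x)\<close> and added up, are
  exactly the premise \<open>square\<close> of \<open>quadratic_form_le_square\<close>.\<close>

lemma negative_covariance:
  assumes "size x + 2 \<le> n"
  shows "(\<Sum>b\<in>V. \<Sum>c\<in>V. v b * v c * G (add_mset b (add_mset c x))) * G x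
      \<le> (\<Sum>b\<in>V. v b * G (add_mset b x))\<^sup>2"
  using assms
proof (induction "n - size x" arbitrary: x v rule: less_induct)
  case less
  show ?case
  proof (cases "size x + 2 = n")
    case True
    then show ?thesis by (rule G_base)
  next
    case False
    with less.prems have x: "size x + 3 \<le> n" by simp
    have zero: "G (add_mset b y) = 0" if "G y = 0" "b \<in> V" "size y < n" for b y
      using G_rec[OF that(3)] that finite_V G_nonneg by (simp add: sum_nonneg_eq_0_iff)
    have "(\<Sum>b\<in>V. \<Sum>c\<in>V. v b * v c * G (add_mset b (add_mset c x)))
        * (\<Sum>b\<in>V. G (add_mset b x)) \<le> (\<Sum>b\<in>V. v b * G (add_mset b x))\<^sup>2"
    proof (rule quadratic_form_le_square[OF finite_V z])
      show "G (add_mset b (add_mset c x)) \<ge> 0" for b c by (rule G_nonneg)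
      show "G (add_mset b (add_mset c x)) = G (add_mset c (add_mset b x))" for b c
        by (simp add: add_mset_commute)
      show "G (add_mset b x) = (\<Sum>c\<in>V. G (add_mset b (add_mset c x)))" for b
        using G_rec[of "add_mset b x"] x by (simp add: add_mset_commute)
      show "G (add_mset z (add_mset b x)) > 0" if "b \<in> V" "G (add_mset b x) > 0" for b
        using G_star that less.prems by simp
      fix v
      have "(\<Sum>b\<in>V. \<Sum>c\<in>V. v b * v c * G (add_mset b (add_mset c x)))
        = (\<Sum>b\<in>V. \<Sum>c\<in>V. \<Sum>a\<in>V. v b * v c * G (add_mset a (add_mset b (add_mset c x))))"
        using x by (simp add: G_rec sum_distrib_left)
      also have "\<dots> = (\<Sum>b\<in>V. \<Sum>a\<in>V. \<Sum>c\<in>V. v b * v c * G (add_mset a (add_mset b (add_mset c x))))"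
        by (intro sum.cong refl sum.swap)
      also have "\<dots> = (\<Sum>a\<in>V. \<Sum>b\<in>V. \<Sum>c\<in>V. v b * v c * G (add_mset a (add_mset b (add_mset c x))))"
        by (rule sum.swap)
      also have "\<dots> \<le> (\<Sum>a\<in>V. (\<Sum>b\<in>V. v b * G (add_mset a (add_mset b x)))\<^sup>2 / G (add_mset a x))"
      proof (rule sum_mono)
        fix a assume a: "a \<in> V"
        have IH: "(\<Sum>b\<in>V. \<Sum>c\<in>V. v b * v c * G (add_mset a (add_mset b (add_mset c x)))) * G (add_mset a x)
            \<le> (\<Sum>b\<in>V. v b * G (add_mset a (add_mset b x)))\<^sup>2"
          using less.hyps[of "add_mset a x" v] x by (simp add: add_mset_commute)
        show "(\<Sum>b\<in>V. \<Sum>c\<in>V. v b * v c * G (add_mset a (add_mset b (add_mset c x))))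
          \<le> (\<Sum>b\<in>V. v b * G (add_mset a (add_mset b x)))\<^sup>2 / G (add_mset a x)"
        \<comment> \<open>An impossible \<open>a\<close> contributes 0 on both sides: all its
          extensions have weight 0, and the quotient is 0 by the convention for division by
          zero.\<close>
        proof (cases "G (add_mset a x) = 0")
          case True
          have "G (add_mset a (add_mset b (add_mset c x))) = 0" if "b \<in> V" "c \<in> V" for b c
          proof -
            have "G (add_mset c (add_mset a x)) = 0" using zero True that x by simp
            then have "G (add_mset b (add_mset c (add_mset a x))) = 0" using zero that x by simp
            then show ?thesis by (simp add: add_mset_commute)
          qed
          then show ?thesis using True by simp
        next
          case False
          then have "G (add_mset a x) > 0" using G_nonneg[of "add_mset a x"] by simp
          then show ?thesis using IH by (simp add: pos_le_divide_eq)
        qed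
      qed
      finally show "(\<Sum>b\<in>V. \<Sum>c\<in>V. v b * v c * G (add_mset b (add_mset c x)))
        \<le> (\<Sum>a\<in>V. (\<Sum>b\<in>V. v b * G (add_mset a (add_mset b x)))\<^sup>2 / G (add_mset a x))" .
    qed
    then show ?thesis using G_rec[of x] x by simp
  qed
qed

end

section \<open>Entropy contraction for symmetric weights\<close>

definition expand :: "'a set \<Rightarrow> ('a multiset \<Rightarrow> real) \<Rightarrow> 'a multiset \<Rightarrow> real" where
  "expand V \<phi> x = (\<Sum>b\<in>V. \<phi> (add_mset b x))"

lemma expand_funpow_nonneg:
  assumes "\<And>x. size x = size y + j \<Longrightarrow> \<phi> x \<ge> 0"
  shows "(expand V ^^ j) \<phi> y \<ge> 0"
  using assms
proof (induction j arbitrary: y)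
  case (Suc j)
  have "(expand V ^^ j) \<phi> (add_mset b y) \<ge> 0" for b
    by (rule Suc.IH) (simp add: Suc.prems)
  then have "expand V ((expand V ^^ j) \<phi>) y \<ge> 0"
    unfolding expand_def by (rule sum_nonneg)
  then show ?case by simp
qed simp

lemma expand_funpow_linear:
  "(expand V ^^ j) (\<lambda>x. \<phi> x - 2 * \<psi> x + \<eta> x) y
    = (expand V ^^ j) \<phi> y - 2 * (expand V ^^ j) \<psi> y + (expand V ^^ j) \<eta> y"
  by (induction j arbitrary: y)
    (simp_all add: expand_def sum.distrib sum_subtractf sum_distrib_left)

text \<open>The chords from the origin of a convex sequence have increasing slopes. Denominators are
  cleared so that \<open>j = 0\<close> is included.\<close>

lemma convex_sequence_le:
  fixes \<tau> :: "nat \<Rightarrow> real"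
  assumes "\<tau> 0 = 0" and convex: "\<And>j. j + 2 \<le> n \<Longrightarrow> \<tau> (j + 2) - 2 * \<tau> (j + 1) + \<tau> j \<ge> 0"
    and "j < n"
  shows "real (Suc j) * \<tau> j \<le> real j * \<tau> (Suc j)"
  using \<open>j < n\<close>
proof (induction j)
  case 0
  then show ?case using assms(1) by simp
next
  case (Suc j)
  then have IH: "real (Suc j) * \<tau> j \<le> real j * \<tau> (Suc j)" by simp
  have "\<tau> (j + 2) - 2 * \<tau> (j + 1) + \<tau> j \<ge> 0" using convex Suc.prems by simp
  then have "real (Suc j) * (2 * \<tau> (Suc j)) \<le> real (Suc j) * (\<tau> (Suc (Suc j)) + \<tau> j)"
    by (intro mult_left_mono) auto
  with IH show ?case by (simp add: algebra_simps)
qed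

context symmetric_weight
begin

text \<open>By Donsker--Varadhan with the test function \<open>ln (f b) + ln (f c)\<close>, where \<open>f b\<close> is the
  relative density \<open>(H b / H x) / (G b / G x)\<close> of one further element, negative covariance makes
  the entropy of two further elements at least twice the entropy of one.\<close>

lemma entropy_convex_step:
  assumes H_nonneg: "\<And>x. H x \<ge> 0"
    and H_rec: "\<And>x. size x < n \<Longrightarrow> H x = (\<Sum>b\<in>V. H (add_mset b x))"
    and ac: "\<And>x. G x = 0 \<Longrightarrow> H x = 0"
    and e: "\<And>x. e x = H x * ln (H x / G x)"
    and x: "size x + 2 \<le> n"
  shows "expand V (expand V e) x - 2 * expand V e x + e x \<ge> 0"
proof -
  have zero: "H (add_mset b y) = 0" if "H y = 0" "b \<in> V" "size y < n" for b y
    using H_rec[OF that(3)] that finite_V H_nonneg by (simp add: sum_nonneg_eq_0_iff)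
  have zero2: "H (add_mset b (add_mset c x)) = 0" if "H (add_mset b x) = 0" "b \<in> V" "c \<in> V" for b c
    using zero[of "add_mset b x" c] that x by (simp add: add_mset_commute)
  define h1 where "h1 b = H (add_mset b x)" for b
  define h2 where "h2 b c = H (add_mset b (add_mset c x))" for b c
  define g1 where "g1 b = G (add_mset b x)" for b
  define g2 where "g2 b c = G (add_mset b (add_mset c x))" for b c
  have h2_sym: "h2 b c = h2 c b" for b c by (simp add: h2_def add_mset_commute)
  have h2_sum: "(\<Sum>c\<in>V. h2 b c) = h1 b" for b
    using H_rec[of "add_mset b x"] x by (simp add: h1_def h2_def add_mset_commute)
  have h1_sum: "(\<Sum>b\<in>V. h1 b) = H x" using H_rec[of x] x by (simp add: h1_def)
  have e_x: "e x = H x * ln (H x / G x)"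
    and e1: "expand V e x = (\<Sum>b\<in>V. h1 b * ln (h1 b / g1 b))"
    and e2: "expand V (expand V e) x = (\<Sum>b\<in>V. \<Sum>c\<in>V. h2 b c * ln (h2 b c / g2 b c))"
    unfolding expand_def e h1_def h2_def g1_def g2_def by (simp_all add: add_mset_commute)
  show ?thesis
  proof (cases "H x = 0")
    case True
    then have "h1 b = 0" "h2 b c = 0" if "b \<in> V" "c \<in> V" for b c
      using zero[of x] zero2 that x by (auto simp: h1_def h2_def)
    then show ?thesis unfolding e_x e1 e2 using True by simp
  next
    case False
    then have Hx: "H x > 0" using H_nonneg[of x] by simp
    have Gx: "G x > 0" using ac[of x] G_nonneg[of x] False by force
    define f where "f b = h1 b / g1 b" for b
    \<comment> \<open>\<open>T\<close> is the two-entry entropy density with the test function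
      subtracted. As \<open>h2\<close> has both marginals \<open>h1\<close>, the subtracted parts
      sum to \<open>expand V e x\<close> twice, and the sum of \<open>T\<close> is the second
      difference.\<close>
    define T where "T b c = h2 b c * (ln (h2 b c / g2 b c) - ln (f b) - ln (f c) + ln (H x / G x))" for b c
    have "(\<Sum>b\<in>V. \<Sum>c\<in>V. T b c) = (\<Sum>b\<in>V. \<Sum>c\<in>V. h2 b c * ln (h2 b c / g2 b c))
      - (\<Sum>b\<in>V. \<Sum>c\<in>V. h2 b c * ln (f b)) - (\<Sum>b\<in>V. \<Sum>c\<in>V. h2 b c * ln (f c))
      + (\<Sum>b\<in>V. \<Sum>c\<in>V. h2 b c * ln (H x / G x))"
      unfolding T_def sum.distrib[symmetric] sum_subtractf[symmetric]
      by (intro sum.cong refl) (simp add: algebra_simps)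
    moreover have "(\<Sum>b\<in>V. \<Sum>c\<in>V. h2 b c * ln (f b)) = expand V e x"
      unfolding e1 f_def by (simp add: sum_distrib_right[symmetric] h2_sum)
    moreover have "(\<Sum>b\<in>V. \<Sum>c\<in>V. h2 b c * ln (f c)) = expand V e x"
    proof -
      have "(\<Sum>b\<in>V. \<Sum>c\<in>V. h2 b c * ln (f c)) = (\<Sum>c\<in>V. \<Sum>b\<in>V. h2 c b * ln (f c))"
        by (subst sum.swap) (simp add: h2_sym)
      also have "\<dots> = expand V e x"
        unfolding e1 f_def by (simp add: sum_distrib_right[symmetric] h2_sum)
      finally show ?thesis .
    qed
    moreover have "(\<Sum>b\<in>V. \<Sum>c\<in>V. h2 b c * ln (H x / G x)) = e x"
      by (simp add: e_x sum_distrib_right[symmetric] h2_sum h1_sum)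
    ultimately have eq: "expand V (expand V e) x - 2 * expand V e x + e x = (\<Sum>b\<in>V. \<Sum>c\<in>V. T b c)"
      unfolding e2 by simp
    have T: "T b c \<ge> h2 b c - f b * f c * g2 b c * (G x / H x)" if bc: "b \<in> V" "c \<in> V" for b c
    proof (cases "h2 b c = 0")
      case True
      then show ?thesis
        using Hx Gx H_nonneg G_nonneg by (simp add: T_def f_def h1_def g1_def g2_def)
    next
      case False
      then have h2: "h2 b c > 0" using H_nonneg by (simp add: h2_def order_less_le)
      have "h1 b \<noteq> 0" "h1 c \<noteq> 0"
        using zero2 bc False h2_sym[of b c] unfolding h1_def h2_def by metis+
      then have h1: "h1 b > 0" "h1 c > 0"
        using H_nonneg by (simp_all add: h1_def order_less_le)
      have g: "g1 b > 0" "g1 c > 0" "g2 b c > 0"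
        using h1 h2 ac G_nonneg unfolding h1_def h2_def g1_def g2_def
        by (metis less_irrefl order_less_le)+
      \<comment> \<open>The ratio of the tilted reference weight to \<open>h2 b c\<close>, so that
        \<open>T b c = - h2 b c * ln y\<close>; the bound \<open>ln y \<le> y - 1\<close> turns this
        into an expression that negative covariance controls.\<close>
      define y where "y = f b * f c * g2 b c * (G x / H x) / h2 b c"
      have f: "f b > 0" "f c > 0" using h1 g by (auto simp: f_def)
      have y: "y > 0" using f g Hx Gx h2 by (simp add: y_def)
      have "ln y = ln (f b) + ln (f c) + ln (g2 b c) + ln (G x) - ln (H x) - ln (h2 b c)"
        unfolding y_def using f g Hx Gx h2 by (simp add: ln_mult ln_div)
      then have "T b c = h2 b c * (- ln y)"
        unfolding T_def using f g Hx Gx h2 by (simp add: ln_div)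
      also have "\<dots> \<ge> h2 b c * (1 - y)"
        using h2 ln_le_minus_one[OF y] by (intro mult_left_mono) auto
      also have "h2 b c * (1 - y) = h2 b c - f b * f c * g2 b c * (G x / H x)"
        using h2 by (simp add: y_def algebra_simps)
      finally show ?thesis .
    qed
    have "0 \<le> H x - (\<Sum>b\<in>V. \<Sum>c\<in>V. f b * f c * g2 b c) * (G x / H x)"
    proof -
      have "(\<Sum>b\<in>V. \<Sum>c\<in>V. f b * f c * g2 b c) * G x \<le> (\<Sum>b\<in>V. f b * g1 b)\<^sup>2"
        unfolding g2_def g1_def by (rule negative_covariance[OF x])
      also have "(\<Sum>b\<in>V. f b * g1 b) = H x"
        unfolding h1_sum[symmetric] f_def
        using ac by (intro sum.cong) (auto simp: h1_def g1_def)
      finally show ?thesis using Hx by (simp add: field_simps power2_eq_square)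
    qed
    also have "\<dots> = (\<Sum>b\<in>V. \<Sum>c\<in>V. h2 b c - f b * f c * g2 b c * (G x / H x))"
      by (simp add: sum_subtractf h2_sum h1_sum sum_distrib_right sum_divide_distrib)
    also have "\<dots> \<le> (\<Sum>b\<in>V. \<Sum>c\<in>V. T b c)"
      by (intro sum_mono T)
    finally show ?thesis unfolding eq .
  qed
qed

text \<open>Iterated \<open>expand\<close> sums over ordered sequences, so \<open>\<tau> j\<close>
  is the relative entropy of the first \<open>j\<close> entries. Its second differences are sums of
  those in \<open>entropy_convex_step\<close>, and comparing the chord slopes at
  \<open>n - 1\<close> and \<open>n\<close> gives the factor \<open>1 - 1 / n\<close>.\<close>

lemma entropy_contraction:
  assumes H_nonneg: "\<And>x. H x \<ge> 0"
    and H_rec: "\<And>x. size x < n \<Longrightarrow> H x = (\<Sum>b\<in>V. H (add_mset b x))"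
    and ac: "\<And>x. G x = 0 \<Longrightarrow> H x = 0"
    and e: "\<And>x. e x = H x * ln (H x / G x)"
    and start: "H {#} = G {#}" and n: "n \<ge> 1"
  shows "real n * (expand V ^^ (n - 1)) e {#} \<le> (real n - 1) * (expand V ^^ n) e {#}"
proof -
  define \<tau> where "\<tau> j = (expand V ^^ j) e {#}" for j
  have "real (Suc (n - 1)) * \<tau> (n - 1) \<le> real (n - 1) * \<tau> (Suc (n - 1))"
  proof (rule convex_sequence_le[where n = n])
    show "\<tau> 0 = 0" using start by (simp add: \<tau>_def e)
    show "\<tau> (j + 2) - 2 * \<tau> (j + 1) + \<tau> j \<ge> 0" if "j + 2 \<le> n" for j
    proof -
      have "\<tau> (j + 2) - 2 * \<tau> (j + 1) + \<tau> j
        = (expand V ^^ j) (\<lambda>x. expand V (expand V e) x - 2 * expand V e x + e x) {#}"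
        by (simp add: expand_funpow_linear \<tau>_def funpow_swap1)
      also have "\<dots> \<ge> 0"
        using that by (intro expand_funpow_nonneg entropy_convex_step[OF H_nonneg H_rec ac e]) auto
      finally show ?thesis .
    qed
  qed (use n in simp)
  then show ?thesis using n by (simp add: \<tau>_def of_nat_diff)
qed

end

text \<open>A form that is nonpositive on a hyperplane has at most one positive direction, so
  Cauchy-Schwarz is reversed against a vector on which the form is positive, here the constant 1.
  The combination \<open>x * v b - y\<close> of \<open>v\<close> and 1 lies in the
  hyperplane.\<close>

lemma reverse_Cauchy_Schwarz:
  fixes F :: "'a \<Rightarrow> 'a \<Rightarrow> real"
  assumes sym: "\<And>b c. b \<in> V \<Longrightarrow> c \<in> V \<Longrightarrow> F b c = F c b"
    and neg: "\<And>v. (\<Sum>b\<in>V. l b * v b) = 0 \<Longrightarrow> (\<Sum>b\<in>V. \<Sum>c\<in>V. v b * v c * F b c) \<le> 0"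
    and pos: "(\<Sum>b\<in>V. \<Sum>c\<in>V. F b c) \<ge> 0"
  shows "(\<Sum>b\<in>V. \<Sum>c\<in>V. v b * v c * F b c) * (\<Sum>b\<in>V. \<Sum>c\<in>V. F b c)
    \<le> (\<Sum>b\<in>V. v b * (\<Sum>c\<in>V. F b c))\<^sup>2"
proof -
  define Q where "Q u w = (\<Sum>b\<in>V. \<Sum>c\<in>V. u b * w c * F b c)" for u w
  define one where "one = (\<lambda>b::'a. 1::real)"
  have Q1: "Q one one = (\<Sum>b\<in>V. \<Sum>c\<in>V. F b c)" by (simp add: Q_def one_def)
  have Qv1: "Q v one = (\<Sum>b\<in>V. v b * (\<Sum>c\<in>V. F b c))" by (simp add: Q_def one_def sum_distrib_left)
  have comm: "Q one v = Q v one" unfolding Q_def by (rule quadratic_form_swap[OF sym])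
  have "Q v v * Q one one \<le> (Q v one)\<^sup>2"
  proof (cases "Q one one = 0")
    case True
    then show ?thesis by simp
  next
    case False
    with pos Q1 have Q1': "Q one one > 0" by simp
    define x where "x = (\<Sum>b\<in>V. l b)"
    define y where "y = (\<Sum>b\<in>V. l b * v b)"
    have x: "x \<noteq> 0"
    proof
      assume "x = 0"
      then have "Q one one \<le> 0" unfolding Q_def by (intro neg) (simp add: x_def one_def)
      with Q1' show False by simp
    qed
    have "(\<Sum>b\<in>V. l b * (x * v b - y)) = 0"
    proof -
      have "(\<Sum>b\<in>V. l b * (x * v b - y)) = x * (\<Sum>b\<in>V. l b * v b) - (\<Sum>b\<in>V. l b) * y"
        unfolding sum_distrib_left sum_distrib_right sum_subtractf[symmetric]
        by (intro sum.cong refl) (simp add: algebra_simps)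
      then show ?thesis by (simp add: x_def y_def)
    qed
    from neg[OF this] have "Q (\<lambda>b. x * v b - y) (\<lambda>b. x * v b - y) \<le> 0" unfolding Q_def .
    also have "Q (\<lambda>b. x * v b - y) (\<lambda>b. x * v b - y)
       = x * x * Q v v - x * y * Q v one - x * y * Q one v + y * y * Q one one"
      unfolding Q_def one_def sum_distrib_left sum.distrib[symmetric] sum_subtractf[symmetric]
      by (intro sum.cong refl) (simp add: algebra_simps)
    finally have "x * x * Q v v - 2 * (x * y) * Q v one + y * y * Q one one \<le> 0"
      by (simp add: comm)
    then have "Q one one * (x * x * Q v v - 2 * (x * y) * Q v one + y * y * Q one one) \<le> 0"
      using Q1' by (simp add: mult_le_0_iff)
    \<comment> \<open>Completing the square. The factor \<open>x\<^sup>2\<close> can be cancelled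
      because \<open>x = 0\<close> would put the constants, on which the form is positive, into the
      hyperplane.\<close>
    moreover have "Q one one * (x * x * Q v v - 2 * (x * y) * Q v one + y * y * Q one one)
      = (y * Q one one - x * Q v one)\<^sup>2 + x\<^sup>2 * (Q v v * Q one one - (Q v one)\<^sup>2)"
      by (simp add: power2_eq_square algebra_simps)
    ultimately have "x\<^sup>2 * (Q v v * Q one one - (Q v one)\<^sup>2) \<le> 0"
      by (smt (verit) zero_le_power2)
    then show ?thesis using x by (simp add: mult_le_0_iff)
  qed
  then show ?thesis unfolding Q1 Qv1 unfolding Q_def .
qed

text \<open>The double sum is the sum of squares of the class sums, for the classes on which
  \<open>f\<close> is constant. Cauchy-Schwarz over the at most \<open>card S\<close> classes gives
  the bound.\<close>

lemma partition_square_sum: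
  fixes \<alpha> :: "'a \<Rightarrow> real"
  assumes "finite S"
  shows "(\<Sum>i\<in>S. \<alpha> i)\<^sup>2 \<le> card S * (\<Sum>i\<in>S. \<Sum>j\<in>S. if f i = f j then \<alpha> i * \<alpha> j else 0)"
proof -
  have "(\<Sum>i\<in>S. \<Sum>j\<in>S. if f i = f j then \<alpha> i * \<alpha> j else 0)
    = (\<Sum>k\<in>f ` S. \<Sum>i\<in>{i\<in>S. f i = k}. \<Sum>j\<in>S. if f i = f j then \<alpha> i * \<alpha> j else 0)"
    using assms by (rule sum.image_gen)
  also have "\<dots> = (\<Sum>k\<in>f ` S. (\<Sum>i\<in>{i\<in>S. f i = k}. \<alpha> i)\<^sup>2)"
  proof (intro sum.cong refl)
    fix k
    have "(\<Sum>j\<in>S. if f i = f j then \<alpha> i * \<alpha> j else 0) = \<alpha> i * (\<Sum>j\<in>{j\<in>S. f j = k}. \<alpha> j)"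
      if "f i = k" for i
      unfolding sum.inter_filter[OF assms] sum_distrib_left using that by (intro sum.cong) auto
    then have "(\<Sum>i\<in>{i\<in>S. f i = k}. \<Sum>j\<in>S. if f i = f j then \<alpha> i * \<alpha> j else 0)
      = (\<Sum>i\<in>{i\<in>S. f i = k}. \<alpha> i * (\<Sum>j\<in>{j\<in>S. f j = k}. \<alpha> j))"
      by (intro sum.cong refl) blast
    then show "(\<Sum>i\<in>{i\<in>S. f i = k}. \<Sum>j\<in>S. if f i = f j then \<alpha> i * \<alpha> j else 0)
      = (\<Sum>i\<in>{i\<in>S. f i = k}. \<alpha> i)\<^sup>2"
      by (simp only: power2_eq_square sum_distrib_right)
  qed
  finally have eq: "(\<Sum>i\<in>S. \<Sum>j\<in>S. if f i = f j then \<alpha> i * \<alpha> j else 0)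
    = (\<Sum>k\<in>f ` S. (\<Sum>i\<in>{i\<in>S. f i = k}. \<alpha> i)\<^sup>2)" .
  have "(\<Sum>i\<in>S. \<alpha> i) = (\<Sum>k\<in>f ` S. \<Sum>i\<in>{i\<in>S. f i = k}. \<alpha> i)"
    using assms by (rule sum.image_gen)
  then have "(\<Sum>i\<in>S. \<alpha> i)\<^sup>2 \<le> (\<Sum>k\<in>f ` S. (\<Sum>i\<in>{i\<in>S. f i = k}. \<alpha> i)\<^sup>2) * card (f ` S)"
    using sum_squared_le_sum_of_squares[of "\<lambda>k. \<Sum>i\<in>{i\<in>S. f i = k}. \<alpha> i" "f ` S"] by simp
  also have "\<dots> \<le> (\<Sum>k\<in>f ` S. (\<Sum>i\<in>{i\<in>S. f i = k}. \<alpha> i)\<^sup>2) * card S"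
    using card_image_le[OF assms] by (intro mult_left_mono sum_nonneg) auto
  finally show ?thesis unfolding eq by (simp add: mult.commute)
qed

section \<open>Random cluster weights of a matroid\<close>

context matroid
begin

lemma rank_set_finite: "finite {card T | T. T \<in> I \<and> T \<subseteq> S}"
proof -
  have "{card T | T. T \<in> I \<and> T \<subseteq> S} \<subseteq> card ` Pow E"
    using indep_subset_ground by auto
  then show ?thesis using finite_ground by (simp add: finite_subset)
qed

lemma card_le_rank: "T \<in> I \<Longrightarrow> T \<subseteq> S \<Longrightarrow> card T \<le> rank_of I S"
  unfolding rank_of_def by (rule Max_ge[OF rank_set_finite]) auto

lemma rank_attained: "\<exists>T\<in>I. T \<subseteq> S \<and> card T = rank_of I S"
proof -
  have "rank_of I S \<in> {card T | T. T \<in> I \<and> T \<subseteq> S}"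
    unfolding rank_of_def by (rule Max_in[OF rank_set_finite]) (use indep_empty in auto)
  then show ?thesis by auto
qed

lemma rank_mono: "S \<subseteq> S' \<Longrightarrow> rank_of I S \<le> rank_of I S'"
  by (metis rank_attained card_le_rank order_trans)

lemma rank_insert_le: "rank_of I (insert i S) \<le> Suc (rank_of I S)"
proof -
  obtain T where T: "T \<in> I" "T \<subseteq> insert i S" "card T = rank_of I (insert i S)"
    using rank_attained[of "insert i S"] by auto
  have "card (T - {i}) \<le> rank_of I S"
    using T indep_hereditary[of T "T - {i}"] by (intro card_le_rank) auto
  moreover have "card T \<le> Suc (card (T - {i}))"
    using T finite_subset[OF indep_subset_ground finite_ground] by (cases "i \<in> T") (auto simp: card_Diff_singleton)
  ultimately show ?thesis using T by simp
qed

text \<open>If \<open>i\<close> or \<open>j\<close> alone raises the rank, unit increase and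
  monotonicity suffice. If neither does but both together do, exchange extends a maximal independent
  subset of \<open>S\<close> by one element, and the result lies in \<open>S\<close>, in
  \<open>insert i S\<close> or in \<open>insert j S\<close>, all of which have the rank of
  \<open>S\<close>.\<close>

lemma rank_submodular:
  "rank_of I (insert i (insert j S)) + rank_of I S \<le> rank_of I (insert i S) + rank_of I (insert j S)"
proof (cases "rank_of I (insert i S) = rank_of I S \<and> rank_of I (insert j S) = rank_of I S")
  case True
  have "rank_of I (insert i (insert j S)) \<le> rank_of I S"
  proof (rule ccontr)
    assume "\<not> ?thesis"
    obtain B where B: "B \<in> I" "B \<subseteq> S" "card B = rank_of I S" using rank_attained by blast
    obtain X where X: "X \<in> I" "X \<subseteq> insert i (insert j S)" "card X = rank_of I (insert i (insert j S))"
      using rank_attained[of "insert i (insert j S)"] by auto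
    with B \<open>\<not> _\<close> have "card B < card X" by simp
    from indep_exchange[OF X(1) B(1) this] obtain x where x: "x \<in> X - B" "insert x B \<in> I"
      by blast
    have "finite B" using B finite_subset[OF indep_subset_ground finite_ground] by auto
    then have card: "card (insert x B) = Suc (rank_of I S)" using x B by simp
    have "insert x B \<subseteq> S \<or> insert x B \<subseteq> insert i S \<or> insert x B \<subseteq> insert j S"
      using x X B by auto
    then show False
      using card_le_rank[OF x(2), of S] card_le_rank[OF x(2), of "insert i S"]
        card_le_rank[OF x(2), of "insert j S"] card True by linarith
  qed
  then show ?thesis using True by simp
next
  case False
  have "rank_of I (insert i (insert j S)) \<le> Suc (rank_of I (insert j S))"
       "rank_of I (insert i (insert j S)) \<le> Suc (rank_of I (insert i S))"
    using rank_insert_le[of i "insert j S"] rank_insert_le[of j "insert i S"] by (simp_all add: insert_commute)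
  moreover have "rank_of I S \<le> rank_of I (insert i S)" "rank_of I S \<le> rank_of I (insert j S)"
    by (auto intro: rank_mono)
  ultimately show ?thesis using False by linarith
qed

end

text \<open>From here on the matroid is represented by three local inequalities of its rank
  function, stated for all sets of naturals.\<close>

locale cluster_model =
  fixes n :: nat and rk :: "nat set \<Rightarrow> nat" and q :: real and lam :: "nat \<Rightarrow> real"
  assumes rk_insert_ge: "rk S \<le> rk (insert i S)"
    and rk_insert_le: "rk (insert i S) \<le> Suc (rk S)"
    and rk_submodular: "rk (insert i (insert j S)) + rk S \<le> rk (insert i S) + rk (insert j S)"
    and q: "0 \<le> q" "q \<le> 1"
    and lam: "i \<in> {1..n} \<Longrightarrow> lam i > 0"
    and n: "n \<ge> 1"
begin

abbreviation ground :: "nat set" where "ground \<equiv> {1..n}"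

text \<open>The random cluster weight divided by that of the full set. For \<open>q = 0\<close> the
  convention \<open>0 ^ 0 = 1\<close> selects the sets of full rank.\<close>

definition wt :: "nat set \<Rightarrow> real" where
  "wt S = q ^ (rk ground - rk S) * (\<Prod>i\<in>ground - S. 1 / lam i)"

text \<open>The quotient of \<open>wt (S - {j})\<close> by \<open>wt S\<close>, written so that it
  also makes sense when both weights are 0.\<close>

definition ratio :: "nat set \<Rightarrow> nat \<Rightarrow> real" where
  "ratio S j = q ^ (rk S - rk (S - {j})) / lam j"

lemma rk_mono:
  assumes "finite S'" "S \<subseteq> S'"
  shows "rk S \<le> rk S'"
proof -
  have "rk S \<le> rk (S \<union> T)" if "finite T" for T
    using that
  proof (induction T rule: finite_induct)
    case (insert x T)
    then show ?case using rk_insert_ge[of "S \<union> T" x] by simp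
  qed simp
  from this[of S'] show ?thesis using assms by (simp add: Un_absorb1)
qed

lemma rk_remove: "rk S \<le> Suc (rk (S - {i}))" "rk (S - {i}) \<le> rk S"
  using rk_insert_le[of i "S - {i}"] rk_insert_ge[of "S - {i}" i]
  by (cases "i \<in> S"; simp add: insert_absorb)+

lemma ratio_nonneg: "S \<subseteq> ground \<Longrightarrow> j \<in> S \<Longrightarrow> ratio S j \<ge> 0"
  using q lam[of j] by (auto simp: ratio_def intro!: divide_nonneg_pos)

lemma wt_remove:
  assumes "S \<subseteq> ground" "j \<in> S"
  shows "wt (S - {j}) = wt S * ratio S j"
proof -
  have "ground - (S - {j}) = insert j (ground - S)" using assms by auto
  then have "(\<Prod>i\<in>ground - (S - {j}). 1 / lam i) = 1 / lam j * (\<Prod>i\<in>ground - S. 1 / lam i)"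
    using assms by simp
  moreover have "rk ground - rk (S - {j}) = (rk ground - rk S) + (rk S - rk (S - {j}))"
    using rk_mono[of ground S] rk_remove[of S j] assms by simp
  ultimately show ?thesis by (simp add: wt_def ratio_def power_add)
qed

lemma wt_nonneg: "wt S \<ge> 0"
  unfolding wt_def using q lam by (intro mult_nonneg_nonneg prod_nonneg zero_le_power) (auto intro: less_imp_le)

lemma wt_ground: "wt ground = 1"
  by (simp add: wt_def)

text \<open>Series elements of the restriction to \<open>S\<close>, that is, parallel elements of
  its dual: neither removal lowers the rank, but both together do. Equal elements are included to
  obtain an equivalence relation.\<close>

definition series :: "nat set \<Rightarrow> nat \<Rightarrow> nat \<Rightarrow> bool" where
  "series S i j \<longleftrightarrow> i = j \<or>
    (rk (S - {i}) = rk S \<and> rk (S - {j}) = rk S \<and> rk (S - {i} - {j}) < rk S)"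

lemma submodular_remove:
  assumes "i \<in> S" "j \<in> S" "i \<noteq> j"
  shows "rk S + rk (S - {i} - {j}) \<le> rk (S - {i}) + rk (S - {j})"
proof -
  let ?T = "S - {i} - {j}"
  have "insert i (insert j ?T) = S" "insert i ?T = S - {j}" "insert j ?T = S - {i}"
    using assms by auto
  then show ?thesis using rk_submodular[of i j ?T] by simp
qed

lemma Diff_singleton_commute: "S - {i} - {j} = S - {j} - {i}"
  by auto

lemma series_sym: "series S i j \<Longrightarrow> series S j i"
  unfolding series_def using Diff_singleton_commute[of S i j] by auto

text \<open>Submodularity below \<open>S - {j}\<close> shows that removing all three elements costs
  rank 2. Putting \<open>j\<close> back recovers at most 1, so removing \<open>i\<close> and
  \<open>k\<close> already lowers the rank.\<close>

lemma series_trans: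
  assumes "i \<in> S" "j \<in> S" "k \<in> S" "series S i j" "series S j k"
  shows "series S i k"
proof (cases "i = j \<or> j = k \<or> i = k")
  case True
  then show ?thesis using assms by (auto simp: series_def)
next
  case False
  then have *: "rk (S - {i}) = rk S" "rk (S - {j}) = rk S" "rk (S - {k}) = rk S"
     "rk (S - {i} - {j}) < rk S" "rk (S - {j} - {k}) < rk S"
    using assms(4,5) by (auto simp: series_def)
  have "rk (S - {j}) + rk (S - {j} - {i} - {k}) \<le> rk (S - {j} - {i}) + rk (S - {j} - {k})"
    using False assms by (intro submodular_remove) auto
  moreover have "S - {j} - {i} - {k} = S - {i} - {k} - {j}" "S - {j} - {i} = S - {i} - {j}" by auto
  ultimately have "rk (S - {i} - {k} - {j}) + 2 \<le> rk S" using * by simp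
  then have "rk (S - {i} - {k}) < rk S" using rk_remove(1)[of "S - {i} - {k}" j] by simp
  then show ?thesis using * by (auto simp: series_def)
qed

text \<open>The matrix is \<open>q\<close> times the identity plus \<open>1 - q\<close> times the
  block matrix of the series classes. Each part satisfies the bound by
  \<open>partition_square_sum\<close>, with singletons and with series classes as the partition; the
  convex combination needs \<open>0 \<le> q\<close> and \<open>q \<le> 1\<close>.\<close>

lemma series_form_bound:
  assumes "S \<subseteq> ground"
  shows "(\<Sum>i\<in>S. \<alpha> i)\<^sup>2 \<le> card S *
    (\<Sum>i\<in>S. \<Sum>j\<in>S. (if i = j then 1 else if series S i j then 1 - q else 0) * (\<alpha> i * \<alpha> j))"
proof -
  have fin: "finite S" using assms finite_subset by blast
  define f where "f i = {j\<in>S. series S i j}" for i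
  have f: "f i = f j \<longleftrightarrow> series S i j" if ij: "i \<in> S" "j \<in> S" for i j
  proof
    assume "f i = f j"
    moreover have "j \<in> f j" using ij by (simp add: f_def series_def)
    ultimately show "series S i j" by (auto simp: f_def)
  next
    assume "series S i j"
    then show "f i = f j"
      using ij series_trans series_sym unfolding f_def by blast
  qed
  have 1: "(\<Sum>i\<in>S. \<alpha> i)\<^sup>2 \<le> card S * (\<Sum>i\<in>S. \<Sum>j\<in>S. if i = j then \<alpha> i * \<alpha> j else 0)"
    using partition_square_sum[OF fin, of \<alpha> "\<lambda>i. i"] by simp
  have 2: "(\<Sum>i\<in>S. \<alpha> i)\<^sup>2 \<le> card S * (\<Sum>i\<in>S. \<Sum>j\<in>S. if f i = f j then \<alpha> i * \<alpha> j else 0)"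
    by (rule partition_square_sum[OF fin])
  have "(\<Sum>i\<in>S. \<alpha> i)\<^sup>2 = q * (\<Sum>i\<in>S. \<alpha> i)\<^sup>2 + (1 - q) * (\<Sum>i\<in>S. \<alpha> i)\<^sup>2"
    by (simp add: algebra_simps)
  also have "\<dots> \<le> q * (card S * (\<Sum>i\<in>S. \<Sum>j\<in>S. if i = j then \<alpha> i * \<alpha> j else 0))
      + (1 - q) * (card S * (\<Sum>i\<in>S. \<Sum>j\<in>S. if f i = f j then \<alpha> i * \<alpha> j else 0))"
    using q by (intro add_mono mult_left_mono 1 2) auto
  also have "\<dots> = card S * (q * (\<Sum>i\<in>S. \<Sum>j\<in>S. if i = j then \<alpha> i * \<alpha> j else 0)
      + (1 - q) * (\<Sum>i\<in>S. \<Sum>j\<in>S. if f i = f j then \<alpha> i * \<alpha> j else 0))"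
    by (simp add: algebra_simps)
  also have "q * (\<Sum>i\<in>S. \<Sum>j\<in>S. if i = j then \<alpha> i * \<alpha> j else 0)
      + (1 - q) * (\<Sum>i\<in>S. \<Sum>j\<in>S. if f i = f j then \<alpha> i * \<alpha> j else 0)
      = (\<Sum>i\<in>S. \<Sum>j\<in>S. (if i = j then 1 else if series S i j then 1 - q else 0) * (\<alpha> i * \<alpha> j))"
    unfolding sum_distrib_left sum.distrib[symmetric]
    by (intro sum.cong refl) (auto simp: f series_def algebra_simps)
  finally show ?thesis .
qed

text \<open>By submodularity, removing \<open>i\<close> can change the rank drop caused by
  \<open>j\<close> only from 0 to 1. This happens exactly for series pairs and costs one factor
  \<open>q\<close>.\<close>

lemma ratio_ratio:
  assumes S: "S \<subseteq> ground" and ij: "i \<in> S" "j \<in> S" "i \<noteq> j"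
  shows "ratio S i * ratio (S - {i}) j = (if series S i j then q else 1) * (ratio S i * ratio S j)"
proof -
  have sub: "rk S + rk (S - {i} - {j}) \<le> rk (S - {i}) + rk (S - {j})"
    by (rule submodular_remove[OF ij])
  have bounds: "rk S \<le> Suc (rk (S - {i}))" "rk (S - {i}) \<le> rk S"
    "rk S \<le> Suc (rk (S - {j}))" "rk (S - {j}) \<le> rk S"
    "rk (S - {i}) \<le> Suc (rk (S - {i} - {j}))" "rk (S - {i} - {j}) \<le> rk (S - {i})"
    "rk (S - {j}) \<le> Suc (rk (S - {i} - {j}))" "rk (S - {i} - {j}) \<le> rk (S - {j})"
    using rk_remove[of S i] rk_remove[of S j] rk_remove[of "S - {i}" j] rk_remove[of "S - {j}" i]
    by (auto simp: Diff_singleton_commute[of S j i])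
  show ?thesis
  proof (cases "series S i j")
    case True
    then have "rk (S - {i}) = rk S" "rk (S - {j}) = rk S" "rk (S - {i}) - rk (S - {i} - {j}) = 1"
      using bounds ij(3) by (auto simp: series_def)
    then show ?thesis using True by (simp add: ratio_def)
  next
    case False
    then have "rk (S - {i}) - rk (S - {i} - {j}) = rk S - rk (S - {j})"
      using bounds sub ij(3) unfolding series_def by linarith
    then show ?thesis using False by (simp add: ratio_def)
  qed
qed

end

section \<open>Encoding sets as sequences\<close>

lemma expand_funpow_Suc:
  "(expand V ^^ Suc j) \<phi> y = (\<Sum>b\<in>V. (expand V ^^ j) \<phi> (add_mset b y))"
  by (simp only: funpow.simps comp_apply expand_def[of V "(expand V ^^ j) \<phi>"])

lemma expand_funpow_absolutely_continuous:
  assumes "finite V" "\<And>x. \<phi> x \<ge> 0" "\<And>x. \<phi> x = 0 \<Longrightarrow> \<psi> x = 0"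
    and "(expand V ^^ j) \<phi> y = 0"
  shows "(expand V ^^ j) \<psi> y = 0"
  using assms(4)
proof (induction j arbitrary: y)
  case (Suc j)
  have "(\<Sum>b\<in>V. (expand V ^^ j) \<phi> (add_mset b y)) = 0"
    using Suc.prems unfolding expand_funpow_Suc .
  then have "\<forall>b\<in>V. (expand V ^^ j) \<phi> (add_mset b y) = 0"
    using assms(1,2) by (subst (asm) sum_nonneg_eq_0_iff) (auto intro: expand_funpow_nonneg)
  then show ?case using Suc.IH unfolding expand_funpow_Suc by simp
qed (use assms(3) in auto)

text \<open>Exchanging \<open>b\<close> for \<open>z\<close> in a completion of positive weight
  gives a completion of positive weight. This transfers the hub property from full sequences to
  partial ones.\<close>

lemma expand_funpow_replace_pos:
  assumes "\<And>x. \<phi> x \<ge> 0" "\<And>x. \<phi> (add_mset b x) > 0 \<Longrightarrow> \<phi> (add_mset z x) > (0::real)" "finite V"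
    and "(expand V ^^ j) \<phi> (add_mset b y) > 0"
  shows "(expand V ^^ j) \<phi> (add_mset z y) > 0"
  using assms(4)
proof (induction j arbitrary: y)
  case (Suc j)
  have "(\<Sum>c\<in>V. (expand V ^^ j) \<phi> (add_mset c (add_mset b y))) > 0"
    using Suc.prems unfolding expand_funpow_Suc .
  then obtain c where c: "c \<in> V" "(expand V ^^ j) \<phi> (add_mset c (add_mset b y)) > 0"
    using sum_nonpos[of V "\<lambda>c. (expand V ^^ j) \<phi> (add_mset c (add_mset b y))"] by (meson not_less)
  then have "(expand V ^^ j) \<phi> (add_mset b (add_mset c y)) > 0"
    by (subst add_mset_commute)
  then have "0 < (expand V ^^ j) \<phi> (add_mset z (add_mset c y))" using Suc.IH by simp
  also have "\<dots> = (expand V ^^ j) \<phi> (add_mset c (add_mset z y))" by (simp add: add_mset_commute)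
  also have "\<dots> \<le> (\<Sum>c\<in>V. (expand V ^^ j) \<phi> (add_mset c (add_mset z y)))"
    using c assms(1,3) by (intro member_le_sum) (auto intro: expand_funpow_nonneg)
  finally show ?case unfolding expand_funpow_Suc .
qed (use assms(2) in simp)

lemma expand_funpow_zero:
  assumes "\<And>x b. \<not> P x \<Longrightarrow> \<not> P (add_mset b x)" "\<And>x. \<not> P x \<Longrightarrow> \<phi> x = 0" "\<not> P y"
  shows "(expand V ^^ j) \<phi> y = 0"
  using assms(3)
proof (induction j arbitrary: y)
  case (Suc j)
  then show ?case unfolding expand_funpow_Suc by (intro sum.neutral ballI) (auto dest: assms(1))
qed (simp add: assms)

text \<open>A set \<open>S\<close> is represented by sequences of length \<open>n\<close> that contain each element of the
  complement of \<open>S\<close> once and are filled up with the dummy \<open>0\<close>; only the multiset of the entries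
  matters, as the sequences with a given multiset are equally likely.\<close>

definition simple :: "nat \<Rightarrow> nat multiset \<Rightarrow> bool" where
  "simple n x \<longleftrightarrow> set_mset x \<subseteq> {0..n} \<and> (\<forall>i. i \<noteq> 0 \<longrightarrow> count x i \<le> 1)"

text \<open>\<open>T\<close> contains the elements that occur as entries, so at \<open>j = n\<close>
  it is the complement of the represented set.\<close>

definition encode :: "nat set \<Rightarrow> nat \<Rightarrow> nat multiset" where
  "encode T j = mset_set T + replicate_mset (j - card T) 0"

text \<open>Meant for multisets of size \<open>n\<close>. With \<open>m\<close> dummies there are
  \<open>fact n / fact m\<close> orderings, all equally likely, and the value is the probability of
  one of them.\<close>

definition multiset_law :: "nat \<Rightarrow> (nat set \<Rightarrow> real) \<Rightarrow> nat multiset \<Rightarrow> real" where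
  "multiset_law n \<mu> x = (if simple n x then \<mu> ({1..n} - set_mset x) * fact (count x 0) / fact n else 0)"

definition marginal :: "nat \<Rightarrow> (nat set \<Rightarrow> real) \<Rightarrow> nat multiset \<Rightarrow> real" where
  "marginal n \<mu> x = (expand {0..n} ^^ (n - size x)) (multiset_law n \<mu>) x"

lemma simple_add_iff: "simple n (add_mset b x) \<longleftrightarrow> simple n x \<and> b \<le> n \<and> (b = 0 \<or> b \<notin># x)"
proof -
  have 1: "(\<forall>i. i \<noteq> 0 \<longrightarrow> count (add_mset b x) i \<le> 1)
    \<longleftrightarrow> (\<forall>i. i \<noteq> 0 \<longrightarrow> count x i \<le> 1) \<and> (b = 0 \<or> b \<notin># x)"
  proof (intro iffI conjI allI impI)
    assume L: "\<forall>i. i \<noteq> 0 \<longrightarrow> count (add_mset b x) i \<le> 1"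
    show "count x i \<le> 1" if "i \<noteq> 0" for i
      using L[rule_format, OF that] by (simp split: if_splits)
    show "b = 0 \<or> b \<notin># x"
    proof (rule ccontr)
      assume "\<not> ?thesis"
      then have b: "b \<noteq> 0" "count x b > 0" by simp_all
      from L b(1) have "count (add_mset b x) b \<le> 1" by blast
      then have "Suc (count x b) \<le> 1" by (simp only: count_add_mset if_True simp_thms)
      with b(2) show False by linarith
    qed
  next
    fix i :: nat
    assume "(\<forall>i. i \<noteq> 0 \<longrightarrow> count x i \<le> 1) \<and> (b = 0 \<or> b \<notin># x)" "i \<noteq> 0"
    then show "count (add_mset b x) i \<le> 1"
      by (cases "i = b") (simp_all add: not_in_iff)
  qed
  have 2: "set_mset (add_mset b x) \<subseteq> {0..n} \<longleftrightarrow> set_mset x \<subseteq> {0..n} \<and> b \<le> n" by auto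
  show ?thesis unfolding simple_def by (simp only: 1 2 conj_ac)
qed

lemma simple_add: "simple n (add_mset b x) \<Longrightarrow> simple n x"
  by (simp add: simple_add_iff)

lemma size_simple:
  assumes "simple n x"
  shows "size x = count x 0 + card (set_mset x - {0})"
proof -
  have "size x = (\<Sum>i\<in>set_mset x. count x i)" by (simp add: size_multiset_overloaded_eq)
  also have "\<dots> = count x 0 + (\<Sum>i\<in>set_mset x - {0}. count x i)"
    by (cases "0 \<in># x") (auto simp: sum.remove not_in_iff)
  also have "(\<Sum>i\<in>set_mset x - {0}. count x i) = (\<Sum>i\<in>set_mset x - {0}. 1)"
  proof (intro sum.cong refl)
    fix i assume "i \<in> set_mset x - {0}"
    then have "count x i \<le> 1" "count x i \<noteq> 0" using assms by (auto simp: simple_def)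
    then show "count x i = 1" by linarith
  qed
  finally show ?thesis by simp
qed

lemma multiset_law_nonneg: "(\<And>S. \<mu> S \<ge> 0) \<Longrightarrow> multiset_law n \<mu> x \<ge> 0"
  by (simp add: multiset_law_def)

lemma marginal_nonneg: "(\<And>S. \<mu> S \<ge> 0) \<Longrightarrow> marginal n \<mu> x \<ge> 0"
  unfolding marginal_def by (intro expand_funpow_nonneg multiset_law_nonneg)

lemma marginal_rec: "size x < n \<Longrightarrow> marginal n \<mu> x = (\<Sum>b\<in>{0..n}. marginal n \<mu> (add_mset b x))"
proof -
  assume "size x < n"
  then have "n - size x = Suc (n - Suc (size x))" by simp
  then show ?thesis unfolding marginal_def by (simp only: expand_funpow_Suc size_add_mset)
qed

lemma marginal_top: "size x = n \<Longrightarrow> marginal n \<mu> x = multiset_law n \<mu> x"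
  by (simp add: marginal_def)

lemma marginal_not_simple: "\<not> simple n x \<Longrightarrow> marginal n \<mu> x = 0"
  unfolding marginal_def
  by (rule expand_funpow_zero[where P = "simple n"]) (auto simp: multiset_law_def dest: simple_add)

lemma marginal_zero:
  assumes "\<And>S. \<pi> S \<ge> 0" "\<And>S. S \<subseteq> {1..n} \<Longrightarrow> \<pi> S = 0 \<Longrightarrow> \<mu> S = 0" "marginal n \<pi> x = 0"
  shows "marginal n \<mu> x = 0"
  using assms unfolding marginal_def
  by (intro expand_funpow_absolutely_continuous[where \<phi> = "multiset_law n \<pi>" and \<psi> = "multiset_law n \<mu>"]
      multiset_law_nonneg) (auto simp: multiset_law_def split: if_splits)

lemma simple_encode: "T \<subseteq> {1..n} \<Longrightarrow> simple n (encode T j)"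
  by (auto simp: simple_def encode_def count_mset_set' finite_subset split: if_splits)

lemma count_encode_0: "0 \<notin> T \<Longrightarrow> count (encode T j) 0 = j - card T"
  by (simp add: encode_def)

lemma size_encode: "finite T \<Longrightarrow> card T \<le> j \<Longrightarrow> size (encode T j) = j"
  by (simp add: encode_def)

lemma set_encode_minus: "finite T \<Longrightarrow> set_mset (encode T j) - {0} = T - {0}"
  by (auto simp: encode_def)

lemma encode_add_0: "card T \<le> j \<Longrightarrow> add_mset 0 (encode T j) = encode T (Suc j)"
  by (simp add: encode_def Suc_diff_le)

lemma encode_add: "finite T \<Longrightarrow> i \<notin> T \<Longrightarrow> add_mset i (encode T j) = encode (insert i T) (Suc j)"
  by (simp add: encode_def)

lemma expand_encode:
  assumes "T \<subseteq> {1..n}" "card T \<le> j" and zero: "\<And>x. \<not> simple n x \<Longrightarrow> \<phi> x = 0"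
  shows "expand {0..n} \<phi> (encode T j)
    = \<phi> (encode T (Suc j)) + (\<Sum>i\<in>{1..n} - T. \<phi> (encode (insert i T) (Suc j)))"
proof -
  have fin: "finite T" using assms finite_subset by blast
  have V: "{0..n} = insert 0 {1..n}" by auto
  have "expand {0..n} \<phi> (encode T j)
    = \<phi> (add_mset 0 (encode T j)) + (\<Sum>i\<in>{1..n}. \<phi> (add_mset i (encode T j)))"
    unfolding expand_def V by simp
  also have "(\<Sum>i\<in>{1..n}. \<phi> (add_mset i (encode T j)))
    = (\<Sum>i\<in>{1..n} - T. \<phi> (add_mset i (encode T j)))"
  proof (rule sum.mono_neutral_right)
    show "\<forall>i\<in>{1..n} - ({1..n} - T). \<phi> (add_mset i (encode T j)) = 0"
      using fin assms(1) by (auto intro!: zero simp: simple_add_iff encode_def)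
  qed auto
  finally show ?thesis using assms(2) fin by (simp add: encode_add_0 encode_add)
qed

text \<open>Counts orderings: \<open>fact j / fact (j - card T)\<close> sequences of length
  \<open>j\<close> have \<open>T\<close> as the set of their nonzero entries. The induction
  distinguishes whether the additional entry is a dummy or an element \<open>i\<close>.\<close>

lemma expand_funpow_empty:
  assumes "\<And>x. \<not> simple n x \<Longrightarrow> \<phi> x = (0::real)"
  shows "(expand {0..n} ^^ j) \<phi> {#}
    = (\<Sum>T\<in>{T. T \<subseteq> {1..n} \<and> card T \<le> j}. fact j / fact (j - card T) * \<phi> (encode T j))"
  using assms
proof (induction j arbitrary: \<phi>)
  case 0
  have "{T. T \<subseteq> {1..n} \<and> card T = 0} = {{}}" by (auto simp: finite_subset)
  then show ?case by (simp add: encode_def)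
next
  case (Suc j)
  have fin: "finite {T. T \<subseteq> {1..n} \<and> card T \<le> k}" for k
    by (rule finite_subset[of _ "Pow {1..n}"]) auto
  have "(expand {0..n} ^^ Suc j) \<phi> {#} = (expand {0..n} ^^ j) (expand {0..n} \<phi>) {#}"
    by (simp add: funpow_swap1)
  also have "\<dots> = (\<Sum>T\<in>{T. T \<subseteq> {1..n} \<and> card T \<le> j}.
      fact j / fact (j - card T) * expand {0..n} \<phi> (encode T j))"
    by (rule Suc.IH) (auto simp: expand_def simple_add_iff intro!: sum.neutral Suc.prems)
  also have "\<dots> = (\<Sum>T\<in>{T. T \<subseteq> {1..n} \<and> card T \<le> j}. fact j / fact (j - card T) * \<phi> (encode T (Suc j)))
    + (\<Sum>T\<in>{T. T \<subseteq> {1..n} \<and> card T \<le> j}. \<Sum>i\<in>{1..n} - T.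
        fact j / fact (j - card T) * \<phi> (encode (insert i T) (Suc j)))"
    unfolding sum.distrib[symmetric]
    by (intro sum.cong refl) (auto simp: expand_encode Suc.prems algebra_simps sum_distrib_left)
  also have "(\<Sum>T\<in>{T. T \<subseteq> {1..n} \<and> card T \<le> j}. \<Sum>i\<in>{1..n} - T.
        fact j / fact (j - card T) * \<phi> (encode (insert i T) (Suc j)))
      = (\<Sum>(T, i)\<in>(SIGMA T:{T. T \<subseteq> {1..n} \<and> card T \<le> j}. {1..n} - T).
        fact j / fact (j - card T) * \<phi> (encode (insert i T) (Suc j)))"
    by (subst sum.Sigma) (auto simp: fin)
  also have "\<dots> = (\<Sum>(T, i)\<in>(SIGMA T:{T. T \<subseteq> {1..n} \<and> card T \<le> Suc j}. T).
        fact j / fact (Suc j - card T) * \<phi> (encode T (Suc j)))"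
  \<comment> \<open>A set with an element \<open>i\<close> outside corresponds to the enlarged set
    with \<open>i\<close> marked; the number of possible marks yields the factor
    \<open>card T\<close>.\<close>
  proof (rule sum.reindex_bij_witness[where i = "\<lambda>(T, i). (T - {i}, i)" and j = "\<lambda>(T, i). (insert i T, i)"])
    fix a assume "a \<in> (SIGMA T:{T. T \<subseteq> {1..n} \<and> card T \<le> Suc j}. T)"
    then obtain T i where a: "a = (T, i)" "T \<subseteq> {1..n}" "card T \<le> Suc j" "i \<in> T" by auto
    then have "finite T" using finite_subset by blast
    with a show "(case a of (T, i) \<Rightarrow> (T - {i}, i)) \<in> (SIGMA T:{T. T \<subseteq> {1..n} \<and> card T \<le> j}. {1..n} - T)"
      by auto
  next
    fix a assume "a \<in> (SIGMA T:{T. T \<subseteq> {1..n} \<and> card T \<le> j}. {1..n} - T)"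
    then obtain T i where a: "a = (T, i)" "T \<subseteq> {1..n}" "card T \<le> j" "i \<in> {1..n} - T" by auto
    then have "finite T" using finite_subset by blast
    with a show "(case a of (T, i) \<Rightarrow> (insert i T, i)) \<in> (SIGMA T:{T. T \<subseteq> {1..n} \<and> card T \<le> Suc j}. T)"
      "(case case a of (T, i) \<Rightarrow> (insert i T, i) of (T, i) \<Rightarrow>
          fact j / fact (Suc j - card T) * \<phi> (encode T (Suc j)))
        = (case a of (T, i) \<Rightarrow> fact j / fact (j - card T) * \<phi> (encode (insert i T) (Suc j)))"
      by auto
  qed auto
  also have "\<dots> = (\<Sum>T\<in>{T. T \<subseteq> {1..n} \<and> card T \<le> Suc j}. \<Sum>i\<in>T.
        fact j / fact (Suc j - card T) * \<phi> (encode T (Suc j)))"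
    by (subst sum.Sigma) (auto simp: fin finite_subset)
  also have "\<dots> = (\<Sum>T\<in>{T. T \<subseteq> {1..n} \<and> card T \<le> Suc j}.
        card T * (fact j / fact (Suc j - card T) * \<phi> (encode T (Suc j))))"
    by simp
  also have "(\<Sum>T\<in>{T. T \<subseteq> {1..n} \<and> card T \<le> j}. fact j / fact (j - card T) * \<phi> (encode T (Suc j)))
     = (\<Sum>T\<in>{T. T \<subseteq> {1..n} \<and> card T \<le> Suc j}.
        (if card T \<le> j then fact j / fact (j - card T) * \<phi> (encode T (Suc j)) else 0))"
    by (rule sum.mono_neutral_cong_left) (auto simp: fin)
  also have "\<dots> + (\<Sum>T\<in>{T. T \<subseteq> {1..n} \<and> card T \<le> Suc j}.
        card T * (fact j / fact (Suc j - card T) * \<phi> (encode T (Suc j))))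
    = (\<Sum>T\<in>{T. T \<subseteq> {1..n} \<and> card T \<le> Suc j}. fact (Suc j) / fact (Suc j - card T) * \<phi> (encode T (Suc j)))"
    unfolding sum.distrib[symmetric]
  proof (intro sum.cong refl)
    fix T assume "T \<in> {T. T \<subseteq> {1..n} \<and> card T \<le> Suc j}"
    then have c: "card T \<le> Suc j" by simp
    show "(if card T \<le> j then fact j / fact (j - card T) * \<phi> (encode T (Suc j)) else 0)
      + card T * (fact j / fact (Suc j - card T) * \<phi> (encode T (Suc j)))
      = fact (Suc j) / fact (Suc j - card T) * \<phi> (encode T (Suc j))"
    proof (cases "card T \<le> j")
      case True
      \<comment> \<open>Replaces the truncated subtraction \<open>j - card T\<close> by
        \<open>d\<close>. The identity behind the step is \<open>Suc j = Suc d + card T\<close>: an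
        ordering of length \<open>Suc j\<close> ends in a dummy or in an element.\<close>
      then obtain d where d: "j = card T + d" by (metis le_iff_add)
      have "F / D * p + c * (F / ((1 + e) * D) * p) = (1 + (c + e)) * F / ((1 + e) * D) * p"
        if "D > 0" "e \<ge> 0" for F D c e p :: real
        using that by (simp add: divide_simps) (simp add: algebra_simps)
      from this[of "fact d" "real d" "fact j" "\<phi> (encode T (Suc j))" "card T"] show ?thesis
        by (simp add: d Suc_diff_le)
    next
      case False
      then have "card T = Suc j" using c by simp
      then show ?thesis by simp
    qed
  qed
  finally show ?case .
qed

section \<open>The Gibbs law and negative covariance of the last two entries\<close>

context cluster_model
begin

definition partition_function :: real where
  "partition_function = (\<Sum>S\<in>Pow ground. wt S)"

definition gibbs :: "nat set \<Rightarrow> real" where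
  "gibbs S = wt S / partition_function"

lemma partition_function_pos: "partition_function > 0"
proof -
  have "wt ground \<le> partition_function"
    unfolding partition_function_def by (intro member_le_sum) (auto simp: wt_nonneg)
  then show ?thesis unfolding wt_ground by linarith
qed

lemma gibbs_nonneg: "gibbs S \<ge> 0"
  using partition_function_pos by (simp add: gibbs_def wt_nonneg)

lemma gibbs_remove: "S \<subseteq> ground \<Longrightarrow> j \<in> S \<Longrightarrow> gibbs (S - {j}) = gibbs S * ratio S j"
  by (simp add: gibbs_def wt_remove)

text \<open>\<open>\<kappa>\<close> collects what does not depend on the two entries. A further
  dummy contributes through the factorial of the dummy count, an element through a ratio, and two
  elements through \<open>ratio_ratio\<close>; a repeated element is not a simple multiset and gets
  weight 0.\<close>

lemma multiset_law_two:
  assumes x: "simple n x" "size x + 2 = n" "count x 0 = m" "ground - set_mset x = S"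
    and \<kappa>: "\<kappa> = gibbs S * fact m / fact n"
    and bc: "b \<in> insert 0 S" "c \<in> insert 0 S"
  shows "multiset_law n gibbs (add_mset b (add_mset c x)) = \<kappa> *
    (if b = 0 then if c = 0 then (real m + 2) * (real m + 1) else (real m + 1) * ratio S c
     else if c = 0 then (real m + 1) * ratio S b
     else (1 - (if b = c then 1 else if series S b c then 1 - q else 0)) * (ratio S b * ratio S c))"
proof -
  have S: "S \<subseteq> ground" "0 \<notin> S" "\<And>i. i \<in> S \<Longrightarrow> i \<notin># x" "\<And>i. i \<in> S \<Longrightarrow> i \<le> n"
    using x by auto
  have pos: "i \<in> S \<Longrightarrow> i \<noteq> 0" for i using S by auto
  have rm: "ground - insert i (set_mset x) = S - {i}" for i using x by auto
  consider "b = 0" "c = 0" | "b = 0" "c \<in> S" | "b \<in> S" "c = 0" | "b \<in> S" "c \<in> S" "b = c" | "b \<in> S" "c \<in> S" "b \<noteq> c"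
    using bc by blast
  then show ?thesis
  proof cases
    case 1
    have "ground - insert 0 (set_mset x) = S" using x by auto
    moreover have "(fact (Suc (Suc m)) :: real) = (real m + 2) * (real m + 1) * fact m" by (simp add: algebra_simps)
    ultimately show ?thesis using 1 x by (simp add: multiset_law_def simple_add_iff \<kappa> del: fact_Suc)
  next
    case 2
    have "ground - insert 0 (insert c (set_mset x)) = S - {c}" using x by auto
    moreover have "gibbs (S - {c}) = gibbs S * ratio S c" using 2 S by (intro gibbs_remove)
    ultimately show ?thesis using 2 x S pos[of c]
      by (simp add: multiset_law_def simple_add_iff \<kappa> add_divide_distrib algebra_simps)
  next
    case 3
    have "ground - insert b (insert 0 (set_mset x)) = S - {b}" using x by auto
    moreover have "gibbs (S - {b}) = gibbs S * ratio S b" using 3 S by (intro gibbs_remove)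
    ultimately show ?thesis using 3 x S pos[of b]
      by (simp add: multiset_law_def simple_add_iff \<kappa> add_divide_distrib algebra_simps)
  next
    case 4
    then show ?thesis using pos[of b] by (simp add: multiset_law_def simple_add_iff)
  next
    case 5
    have "ground - insert b (insert c (set_mset x)) = S - {b} - {c}" using x by auto
    moreover have "gibbs (S - {b} - {c}) = gibbs S * (ratio S b * ratio (S - {b}) c)"
      using 5 S by (subst gibbs_remove) (auto simp: gibbs_remove)
    moreover have "ratio S b * ratio (S - {b}) c = (if series S b c then q else 1) * (ratio S b * ratio S c)"
      using 5 S by (intro ratio_ratio)
    ultimately show ?thesis using 5 x S pos[of b] pos[of c]
      by (simp add: multiset_law_def simple_add_iff \<kappa>)
  qed
qed

text \<open>Completing a partial sequence of length \<open>n - 2\<close> by two entries: after rescaling by the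
  ratios the covariance form is \<open>(m + 1) / (m + 2)\<close> times a square minus a form that is positive
  semidefinite because \<open>S\<close> has \<open>m + 2\<close> elements and the series classes partition it.\<close>

lemma gibbs_covariance_base:
  assumes x: "size x + 2 = n"
  shows "(\<Sum>b\<in>{0..n}. \<Sum>c\<in>{0..n}. v b * v c * marginal n gibbs (add_mset b (add_mset c x))) * marginal n gibbs x
      \<le> (\<Sum>b\<in>{0..n}. v b * marginal n gibbs (add_mset b x))\<^sup>2"
proof (cases "simple n x")
  case False
  then show ?thesis by (simp add: marginal_not_simple)
next
  case True
  define S where "S = ground - set_mset x"
  define m where "m = count x 0"
  define \<kappa> where "\<kappa> = gibbs S * fact m / fact n"
  define d where "d i j = (if i = j then 1 else if series S i j then 1 - q else 0)" for i j
  define F where "F b c = multiset_law n gibbs (add_mset b (add_mset c x))" for b c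
  have S: "finite S" "S \<subseteq> ground" "0 \<notin> S" by (auto simp: S_def)
  have card_S: "card S = m + 2"
  proof -
    have "set_mset x - {0} \<subseteq> ground" using True by (auto simp: simple_def Suc_le_eq)
    moreover have "S = ground - (set_mset x - {0})" by (auto simp: S_def)
    ultimately have "card S = n - card (set_mset x - {0})" by (simp add: card_Diff_subset)
    then show ?thesis using size_simple[OF True] x by (simp add: m_def)
  qed
  have \<kappa>0: "\<kappa> \<ge> 0" by (simp add: \<kappa>_def gibbs_nonneg)
  have F_zero: "F b c = 0" if "b \<in> {0..n} - insert 0 S \<or> c \<in> {0..n} - insert 0 S" for b c
    using that by (auto simp: F_def multiset_law_def simple_add_iff S_def)
  have F_eq: "F b c = \<kappa> *
    (if b = 0 then if c = 0 then (real m + 2) * (real m + 1) else (real m + 1) * ratio S c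
     else if c = 0 then (real m + 1) * ratio S b else (1 - d b c) * (ratio S b * ratio S c))"
    if "b \<in> insert 0 S" "c \<in> insert 0 S" for b c
    unfolding F_def d_def using True x that
    by (intro multiset_law_two) (auto simp: S_def m_def \<kappa>_def)
  have top: "marginal n gibbs (add_mset b (add_mset c x)) = F b c" for b c
    using x by (simp add: marginal_top F_def)
  have G1: "marginal n gibbs (add_mset b x) = (\<Sum>c\<in>{0..n}. F b c)" for b
    using x marginal_rec[of "add_mset b x" n gibbs] by (simp add: top[symmetric] add_mset_commute)
  have G0: "marginal n gibbs x = (\<Sum>b\<in>{0..n}. \<Sum>c\<in>{0..n}. F b c)"
    using x marginal_rec[of x n gibbs] by (simp add: G1)
  have restrict: "(\<Sum>b\<in>{0..n}. \<Sum>c\<in>{0..n}. v b * v c * F b c)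
     = (\<Sum>b\<in>insert 0 S. \<Sum>c\<in>insert 0 S. v b * v c * F b c)" for v
  proof -
    have "insert 0 S \<subseteq> {0..n}" using S by auto
    then have "(\<Sum>b\<in>{0..n}. \<Sum>c\<in>{0..n}. v b * v c * F b c)
        = (\<Sum>b\<in>insert 0 S. \<Sum>c\<in>{0..n}. v b * v c * F b c)"
      by (intro sum.mono_neutral_right) (auto intro!: sum.neutral simp: F_zero)
    also have "\<dots> = (\<Sum>b\<in>insert 0 S. \<Sum>c\<in>insert 0 S. v b * v c * F b c)"
      using \<open>insert 0 S \<subseteq> {0..n}\<close> by (intro sum.cong refl sum.mono_neutral_right) (auto simp: F_zero)
    finally show ?thesis .
  qed
  define D where "D v = (\<Sum>i\<in>S. \<Sum>j\<in>S. d i j * ((v i * ratio S i) * (v j * ratio S j)))" for v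
  have form_eq: "(\<Sum>b\<in>{0..n}. \<Sum>c\<in>{0..n}. v b * v c * F b c) = \<kappa> * ((real m + 2) * (real m + 1) * (v 0)\<^sup>2
      + 2 * (real m + 1) * v 0 * s + s\<^sup>2
      - D v)"
    if s: "s = (\<Sum>i\<in>S. v i * ratio S i)" for v s
  proof -
    have "(\<Sum>b\<in>insert 0 S. \<Sum>c\<in>insert 0 S. v b * v c * F b c)
      = v 0 * v 0 * F 0 0 + (\<Sum>c\<in>S. v 0 * v c * F 0 c) + (\<Sum>b\<in>S. v b * v 0 * F b 0)
        + (\<Sum>b\<in>S. \<Sum>c\<in>S. v b * v c * F b c)"
      using S by (simp add: sum.distrib)
    also have "v 0 * v 0 * F 0 0 = \<kappa> * ((real m + 2) * (real m + 1) * (v 0)\<^sup>2)"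
      by (simp add: F_eq power2_eq_square)
    also have "(\<Sum>c\<in>S. v 0 * v c * F 0 c) = \<kappa> * ((real m + 1) * v 0 * s)"
      unfolding s sum_distrib_left using S by (intro sum.cong refl) (auto simp: F_eq)
    also have "(\<Sum>b\<in>S. v b * v 0 * F b 0) = \<kappa> * ((real m + 1) * v 0 * s)"
      unfolding s sum_distrib_left using S by (intro sum.cong refl) (auto simp: F_eq)
    also have "(\<Sum>b\<in>S. \<Sum>c\<in>S. v b * v c * F b c)
       = \<kappa> * (s\<^sup>2 - D v)"
    proof -
      have "v i * v j * F i j = \<kappa> * (v i * ratio S i * (v j * ratio S j)
         - d i j * (v i * ratio S i * (v j * ratio S j)))" if ij: "i \<in> S" "j \<in> S" for i j
      proof -
        have "i \<noteq> 0" "j \<noteq> 0" using ij S by auto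
        then show ?thesis using ij by (simp add: F_eq) (simp add: algebra_simps)
      qed
      then have "(\<Sum>b\<in>S. \<Sum>c\<in>S. v b * v c * F b c) = (\<Sum>i\<in>S. \<Sum>j\<in>S. \<kappa> * (v i * ratio S i * (v j * ratio S j)
         - d i j * (v i * ratio S i * (v j * ratio S j))))"
        by (intro sum.cong refl)
      then show ?thesis
        unfolding s power2_eq_square sum_product D_def by (simp only: sum_subtractf sum_distrib_left right_diff_distrib)
    qed
    finally show ?thesis unfolding restrict by (simp add: algebra_simps)
  qed
  \<comment> \<open>The linear form under the square: up to \<open>\<kappa>\<close>, the quadratic
    form is \<open>(m + 1) / (m + 2) * ((m + 2) * v 0 + s)\<^sup>2 + s\<^sup>2 / (m + 2) - D
    v\<close>. On the kernel of \<open>l\<close> only the last two terms remain.\<close>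
  define l where "l b = (if b = 0 then real m + 2 else if b \<in> S then ratio S b else 0)" for b
  have neg: "(\<Sum>b\<in>{0..n}. \<Sum>c\<in>{0..n}. v b * v c * F b c) \<le> 0"
    if v: "(\<Sum>b\<in>{0..n}. l b * v b) = 0" for v
  proof -
    define s where "s = (\<Sum>i\<in>S. v i * ratio S i)"
    have "insert 0 S \<subseteq> {0..n}" using S by auto
    then have "(\<Sum>b\<in>{0..n}. l b * v b) = (\<Sum>b\<in>insert 0 S. l b * v b)"
      by (intro sum.mono_neutral_right) (auto simp: l_def)
    also have "\<dots> = (real m + 2) * v 0 + (\<Sum>b\<in>S. l b * v b)"
      using S by (simp add: l_def)
    also have "(\<Sum>b\<in>S. l b * v b) = s"
      unfolding s_def using S by (intro sum.cong) (auto simp: l_def)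
    finally have s: "s = - ((real m + 2) * v 0)" using v by simp
    have "s\<^sup>2 \<le> card S * D v"
      unfolding s_def D_def d_def by (rule series_form_bound[OF S(2)])
    moreover have "s\<^sup>2 = (real m + 2) * ((real m + 2) * (v 0)\<^sup>2)"
      by (simp add: s power2_eq_square algebra_simps)
    ultimately have "(real m + 2) * ((real m + 2) * (v 0)\<^sup>2) \<le> (real m + 2) * D v"
      by (simp add: card_S add.commute)
    then have "(real m + 2) * (v 0)\<^sup>2 \<le> D v"
      by (subst (asm) mult_le_cancel_left_pos) auto
    moreover have "(real m + 2) * (real m + 1) * (v 0)\<^sup>2 + 2 * (real m + 1) * v 0 * s + s\<^sup>2 = (real m + 2) * (v 0)\<^sup>2"
      by (simp add: s power2_eq_square algebra_simps)
    ultimately show ?thesis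
      unfolding form_eq[OF s_def] using \<kappa>0 by (simp add: mult_le_0_iff)
  qed
  have F_sum: "(\<Sum>b\<in>{0..n}. \<Sum>c\<in>{0..n}. F b c) \<ge> 0"
    by (intro sum_nonneg) (auto simp: F_def multiset_law_nonneg gibbs_nonneg)
  have F_sym: "F b c = F c b" for b c by (simp add: F_def add_mset_commute)
  show ?thesis unfolding top G1 G0
    by (rule reverse_Cauchy_Schwarz[where l = l, OF F_sym neg F_sum])
qed

end

sublocale cluster_model \<subseteq> symmetric_weight "{0..n}" 0 n "marginal n gibbs"
proof
  show "marginal n gibbs x \<ge> 0" for x by (rule marginal_nonneg[OF gibbs_nonneg])
  show "size x < n \<Longrightarrow> marginal n gibbs x = (\<Sum>b\<in>{0..n}. marginal n gibbs (add_mset b x))" for x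
    by (rule marginal_rec)
  show "size x + 2 = n \<Longrightarrow>
      (\<Sum>b\<in>{0..n}. \<Sum>c\<in>{0..n}. v b * v c * marginal n gibbs (add_mset b (add_mset c x))) * marginal n gibbs x
      \<le> (\<Sum>b\<in>{0..n}. v b * marginal n gibbs (add_mset b x))\<^sup>2" for x v
    by (rule gibbs_covariance_base)
  fix x b assume x: "size x + 2 \<le> n" and b: "b \<in> {0..n}" and pos: "marginal n gibbs (add_mset b x) > 0"
  \<comment> \<open>Turning an entry \<open>c\<close> into a dummy returns \<open>c\<close> to the
    set. The Gibbs weight stays positive, since the weight without \<open>c\<close> is the weight
    with \<open>c\<close> times a ratio.\<close>
  have law: "multiset_law n gibbs (add_mset 0 y) > 0" if y: "multiset_law n gibbs (add_mset c y) > 0" for c y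
  proof -
    have simple: "simple n (add_mset c y)" "gibbs (ground - set_mset (add_mset c y)) > 0"
      using y by (auto simp: multiset_law_def zero_less_divide_iff zero_less_mult_iff split: if_splits)
    have "gibbs (ground - set_mset (add_mset 0 y)) > 0"
    proof (cases "c = 0")
      case False
      then have "c \<notin># y" "c \<in> ground" using simple by (auto simp: simple_add_iff)
      then have "gibbs (ground - set_mset (add_mset c y)) = gibbs (ground - set_mset y) * ratio (ground - set_mset y) c"
        by (subst gibbs_remove[symmetric]) (auto intro!: arg_cong[where f = gibbs])
      then have "gibbs (ground - set_mset y) > 0"
        using simple gibbs_nonneg[of "ground - set_mset y"] by (auto simp: order_less_le)
      moreover have "ground - set_mset (add_mset 0 y) = ground - set_mset y" by auto
      ultimately show ?thesis by simp
    qed (use simple in simp)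
    then show ?thesis using simple by (auto simp: multiset_law_def simple_add_iff)
  qed
  have "(\<Sum>c\<in>{0..n}. marginal n gibbs (add_mset c (add_mset b x))) > 0"
    using pos x marginal_rec[of "add_mset b x" n gibbs] by simp
  then obtain c where "marginal n gibbs (add_mset c (add_mset b x)) > 0"
    using sum_nonpos[of "{0..n}" "\<lambda>c. marginal n gibbs (add_mset c (add_mset b x))"] by (meson not_less)
  then show "marginal n gibbs (add_mset 0 (add_mset b x)) > 0"
    unfolding marginal_def
    using expand_funpow_replace_pos[where \<phi> = "multiset_law n gibbs" and z = 0 and b = c and V = "{0..n}"
        and y = "add_mset b x" and j = "n - size (add_mset b (add_mset c x))"]
      law multiset_law_nonneg[OF gibbs_nonneg] by simp
qed auto

section \<open>Entropy decay of the chain\<close>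

definition relative_entropy :: "'a set \<Rightarrow> ('a \<Rightarrow> real) \<Rightarrow> ('a \<Rightarrow> real) \<Rightarrow> real" where
  "relative_entropy \<Omega> \<mu> \<nu> = (\<Sum>x\<in>\<Omega>. \<mu> x * ln (\<mu> x / \<nu> x))"

lemma log_sum_inequality:
  fixes a b :: "'a \<Rightarrow> real"
  assumes "finite A" "\<And>x. x \<in> A \<Longrightarrow> a x \<ge> 0" "\<And>x. x \<in> A \<Longrightarrow> b x \<ge> 0"
    and ac: "\<And>x. x \<in> A \<Longrightarrow> b x = 0 \<Longrightarrow> a x = 0"
  shows "(\<Sum>x\<in>A. a x) * ln ((\<Sum>x\<in>A. a x) / (\<Sum>x\<in>A. b x)) \<le> (\<Sum>x\<in>A. a x * ln (a x / b x))"
proof (cases "(\<Sum>x\<in>A. a x) = 0")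
  case True
  then have "\<forall>x\<in>A. a x = 0" using assms by (simp add: sum_nonneg_eq_0_iff)
  then show ?thesis using True by simp
next
  case False
  define s where "s = (\<Sum>x\<in>A. a x)"
  define t where "t = (\<Sum>x\<in>A. b x)"
  have s: "s > 0" using False assms by (simp add: s_def order_less_le sum_nonneg)
  have "t \<noteq> 0"
  proof
    assume "t = 0"
    then have "\<forall>x\<in>A. a x = 0" using assms by (simp add: t_def sum_nonneg_eq_0_iff)
    then show False using False by simp
  qed
  then have t: "t > 0" using assms by (simp add: t_def order_less_le sum_nonneg)
  have "a x * ln (s / t) + (a x - b x * (s / t)) \<le> a x * ln (a x / b x)" if x: "x \<in> A" for x
  proof (cases "a x = 0")
    case True
    then show ?thesis using assms(3)[OF x] s t by simp
  next
    case False
    then have a: "a x > 0" and b: "b x > 0"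
      using assms(2,3)[OF x] ac[OF x] by (auto simp: order_less_le)
    define y where "y = b x * (s / t) / a x"
    have y: "y > 0" using a b s t by (simp add: y_def)
    have "ln y = ln (s / t) - ln (a x / b x)"
      using a b s t by (simp add: y_def ln_mult ln_div)
    then have "ln (s / t) + (1 - y) \<le> ln (a x / b x)" using ln_le_minus_one[OF y] by simp
    then have "a x * (ln (s / t) + (1 - y)) \<le> a x * ln (a x / b x)"
      using a by (intro mult_left_mono) auto
    moreover have "a x * (ln (s / t) + (1 - y)) = a x * ln (s / t) + (a x - b x * (s / t))"
      using a by (simp add: y_def algebra_simps)
    ultimately show ?thesis by simp
  qed
  then have "(\<Sum>x\<in>A. a x * ln (s / t) + (a x - b x * (s / t))) \<le> (\<Sum>x\<in>A. a x * ln (a x / b x))"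
    by (rule sum_mono)
  moreover have "(\<Sum>x\<in>A. a x * ln (s / t) + (a x - b x * (s / t))) = s * ln (s / t)"
  proof -
    have "(\<Sum>x\<in>A. a x * ln (s / t) + (a x - b x * (s / t))) = s * ln (s / t) + (s - t * (s / t))"
      unfolding sum.distrib sum_subtractf sum_distrib_right[symmetric] s_def t_def ..
    then show ?thesis using t by simp
  qed
  ultimately show ?thesis by (simp add: s_def t_def)
qed

text \<open>The log-sum inequality for each output \<open>y\<close>, then summation over
  \<open>y\<close>. Row sums are prescribed only where \<open>\<mu>\<close> is nonzero, since the
  kernel to which this is applied has a zero row at the empty set.\<close>

lemma relative_entropy_data_processing:
  fixes K :: "'a \<Rightarrow> 'b \<Rightarrow> real"
  assumes fin: "finite A" "finite B"
    and K: "\<And>x y. x \<in> A \<Longrightarrow> y \<in> B \<Longrightarrow> K x y \<ge> 0" "\<And>x. x \<in> A \<Longrightarrow> \<mu> x \<noteq> 0 \<Longrightarrow> (\<Sum>y\<in>B. K x y) = 1"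
    and nonneg: "\<And>x. x \<in> A \<Longrightarrow> \<mu> x \<ge> 0" "\<And>x. x \<in> A \<Longrightarrow> \<nu> x \<ge> 0"
    and ac: "\<And>x. x \<in> A \<Longrightarrow> \<nu> x = 0 \<Longrightarrow> \<mu> x = 0"
  shows "relative_entropy B (\<lambda>y. \<Sum>x\<in>A. \<mu> x * K x y) (\<lambda>y. \<Sum>x\<in>A. \<nu> x * K x y) \<le> relative_entropy A \<mu> \<nu>"
proof -
  have "relative_entropy B (\<lambda>y. \<Sum>x\<in>A. \<mu> x * K x y) (\<lambda>y. \<Sum>x\<in>A. \<nu> x * K x y)
    \<le> (\<Sum>y\<in>B. \<Sum>x\<in>A. (\<mu> x * K x y) * ln ((\<mu> x * K x y) / (\<nu> x * K x y)))"
    unfolding relative_entropy_def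
    using assms by (intro sum_mono log_sum_inequality) auto
  also have "\<dots> = (\<Sum>y\<in>B. \<Sum>x\<in>A. \<mu> x * ln (\<mu> x / \<nu> x) * K x y)"
    by (intro sum.cong refl) auto
  also have "\<dots> = (\<Sum>x\<in>A. \<mu> x * ln (\<mu> x / \<nu> x) * (\<Sum>y\<in>B. K x y))"
    by (subst sum.swap) (simp add: sum_distrib_left)
  also have "\<dots> = relative_entropy A \<mu> \<nu>"
    unfolding relative_entropy_def by (intro sum.cong refl) (use K(2) in force)
  finally show ?thesis .
qed

text \<open>A weak form of Pinsker's inequality, through the Hellinger distance.\<close>

lemma total_variation_le_entropy:
  assumes fin: "finite \<Omega>" and nonneg: "\<And>x. \<mu> x \<ge> 0" "\<And>x. \<nu> x \<ge> 0"
    and sum1: "(\<Sum>x\<in>\<Omega>. \<mu> x) = 1" "(\<Sum>x\<in>\<Omega>. \<nu> x) = 1"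
    and ac: "\<And>x. x \<in> \<Omega> \<Longrightarrow> \<nu> x = 0 \<Longrightarrow> \<mu> x = 0"
  shows "(tv_distance \<Omega> \<mu> \<nu>)\<^sup>2 \<le> relative_entropy \<Omega> \<mu> \<nu>"
proof -
  define a where "a x = sqrt (\<mu> x)" for x
  define b where "b x = sqrt (\<nu> x)" for x
  have sq: "\<mu> x = a x * a x" "\<nu> x = b x * b x" and ab: "a x \<ge> 0" "b x \<ge> 0" for x
    using nonneg by (simp_all add: a_def b_def)
  have "(a x - b x)\<^sup>2 + (\<mu> x - \<nu> x) \<le> \<mu> x * ln (\<mu> x / \<nu> x)" if x: "x \<in> \<Omega>" for x
  proof (cases "\<mu> x = 0")
    case True
    then show ?thesis by (simp add: a_def b_def nonneg)
  next
    case False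
    then have pos: "\<mu> x > 0" "\<nu> x > 0" using ac[OF x] nonneg by (auto simp: order_less_le)
    then have pos': "a x > 0" "b x > 0" by (auto simp: a_def b_def)
    \<comment> \<open>Passing to square roots and using \<open>ln z \<le> z - 1\<close> produces the
      squared Hellinger term \<open>(a x - b x)\<^sup>2\<close>; the linear remainder sums to
      0.\<close>
    have "ln (\<mu> x / \<nu> x) = - 2 * ln (b x / a x)"
      using pos' by (simp add: sq ln_div ln_mult)
    moreover have "ln (b x / a x) \<le> b x / a x - 1"
      using pos' by (intro ln_le_minus_one) auto
    ultimately have "\<mu> x * (2 - 2 * (b x / a x)) \<le> \<mu> x * ln (\<mu> x / \<nu> x)"
      using pos by (intro mult_left_mono) auto
    moreover have "\<mu> x * (2 - 2 * (b x / a x)) = (a x - b x)\<^sup>2 + (\<mu> x - \<nu> x)"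
      using pos' by (simp add: sq power2_eq_square algebra_simps)
    ultimately show ?thesis by simp
  qed
  then have "(\<Sum>x\<in>\<Omega>. (a x - b x)\<^sup>2 + (\<mu> x - \<nu> x)) \<le> relative_entropy \<Omega> \<mu> \<nu>"
    unfolding relative_entropy_def by (rule sum_mono)
  then have H: "(\<Sum>x\<in>\<Omega>. (a x - b x)\<^sup>2) \<le> relative_entropy \<Omega> \<mu> \<nu>"
    by (simp add: sum.distrib sum_subtractf sum1)
  have "(\<Sum>x\<in>\<Omega>. \<bar>\<mu> x - \<nu> x\<bar>) = (\<Sum>x\<in>\<Omega>. \<bar>a x - b x\<bar> * (a x + b x))"
  proof (intro sum.cong refl)
    fix x
    have "\<mu> x - \<nu> x = (a x - b x) * (a x + b x)" by (simp add: sq algebra_simps)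
    then show "\<bar>\<mu> x - \<nu> x\<bar> = \<bar>a x - b x\<bar> * (a x + b x)"
      using ab[of x] by (simp add: abs_mult)
  qed
  then have "(\<Sum>x\<in>\<Omega>. \<bar>\<mu> x - \<nu> x\<bar>)\<^sup>2 \<le> (\<Sum>x\<in>\<Omega>. \<bar>a x - b x\<bar>\<^sup>2) * (\<Sum>x\<in>\<Omega>. (a x + b x)\<^sup>2)"
    using Cauchy_Schwarz_ineq_sum[of "\<lambda>x. \<bar>a x - b x\<bar>" "\<lambda>x. a x + b x" \<Omega>] by simp
  also have "\<dots> \<le> (\<Sum>x\<in>\<Omega>. \<bar>a x - b x\<bar>\<^sup>2) * 4"
  proof (rule mult_left_mono)
    have "(a x + b x)\<^sup>2 \<le> 2 * \<mu> x + 2 * \<nu> x" for x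
      using zero_le_power2[of "a x - b x"] by (simp add: sq power2_eq_square algebra_simps)
    then have "(\<Sum>x\<in>\<Omega>. (a x + b x)\<^sup>2) \<le> (\<Sum>x\<in>\<Omega>. 2 * \<mu> x + 2 * \<nu> x)" by (rule sum_mono)
    also have "\<dots> = 4" by (simp add: sum.distrib sum_distrib_left[symmetric] sum1)
    finally show "(\<Sum>x\<in>\<Omega>. (a x + b x)\<^sup>2) \<le> 4" .
  qed (simp add: sum_nonneg)
  finally have "(\<Sum>x\<in>\<Omega>. \<bar>\<mu> x - \<nu> x\<bar>)\<^sup>2 \<le> 4 * relative_entropy \<Omega> \<mu> \<nu>" using H by simp
  then show ?thesis by (simp add: tv_distance_def power_mult_distrib power2_eq_square)
qed

lemma sum_remove_insert:
  assumes "finite E"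
  shows "(\<Sum>A\<in>Pow E. \<Sum>j\<in>A. f A (A - {j})) = (\<Sum>S\<in>Pow E. \<Sum>i\<in>E - S. f (insert i S) (S :: 'a set) :: real)"
proof -
  have fin: "finite A" if "A \<subseteq> E" for A using that assms finite_subset by blast
  have "(\<Sum>A\<in>Pow E. \<Sum>j\<in>A. f A (A - {j})) = (\<Sum>(A, j)\<in>(SIGMA A:Pow E. A). f A (A - {j}))"
    using assms fin by (subst sum.Sigma) auto
  also have "\<dots> = (\<Sum>(S, i)\<in>(SIGMA S:Pow E. E - S). f (insert i S) S)"
    by (rule sum.reindex_bij_witness[where i = "\<lambda>(S, i). (insert i S, i)" and j = "\<lambda>(A, j). (A - {j}, j)"])
      (auto simp: insert_absorb)
  also have "\<dots> = (\<Sum>S\<in>Pow E. \<Sum>i\<in>E - S. f (insert i S) S)"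
    using assms by (subst sum.Sigma) auto
  finally show ?thesis .
qed

section \<open>The chain: transition operators, stationarity and duality\<close>

context cluster_model
begin

declare One_nat_def [simp del]

text \<open>The law of the set after adding a uniform element of the ground set. In terms of
  sequences it forgets a uniform entry: a dummy leaves the set as it is, an element returns to
  it.\<close>

definition down :: "(nat set \<Rightarrow> real) \<Rightarrow> nat set \<Rightarrow> real" where
  "down \<mu> A = (real (card A) * \<mu> A + (\<Sum>i\<in>A. \<mu> (A - {i}))) / n"

definition total :: "nat set \<Rightarrow> real" where
  "total A = real (card A) + (\<Sum>j\<in>A. ratio A j)"

text \<open>The conditional expectation of \<open>g\<close> under the Gibbs law, given the set
  \<open>A\<close> that remains after forgetting an entry. At \<open>A = {}\<close> the normaliser
  is 0 and so is the value; \<open>down\<close> gives this set no mass.\<close>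

definition up_mean :: "(nat set \<Rightarrow> real) \<Rightarrow> nat set \<Rightarrow> real" where
  "up_mean g A = (real (card A) * g A + (\<Sum>j\<in>A. ratio A j * g (A - {j}))) / total A"

definition step_mean :: "(nat set \<Rightarrow> real) \<Rightarrow> nat set \<Rightarrow> real" where
  "step_mean g S = (\<Sum>u\<in>ground. up_mean g (insert u S)) / n"

definition up :: "(nat set \<Rightarrow> real) \<Rightarrow> nat set \<Rightarrow> real" where
  "up \<rho> X = (\<Sum>A\<in>Pow ground. \<rho> A * up_mean (indicator {X}) A)"

definition chain_step :: "(nat set \<Rightarrow> real) \<Rightarrow> nat set \<Rightarrow> real" where
  "chain_step \<mu> = up (down \<mu>)"

lemma finite_subset_ground: "A \<subseteq> ground \<Longrightarrow> finite A"
  using finite_subset by blast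

lemma total_pos: "A \<subseteq> ground \<Longrightarrow> A \<noteq> {} \<Longrightarrow> total A > 0"
  unfolding total_def
  by (intro add_pos_nonneg sum_nonneg) (auto simp: ratio_nonneg card_gt_0_iff finite_subset_ground)

lemma total_nonneg: "A \<subseteq> ground \<Longrightarrow> total A \<ge> 0"
  unfolding total_def by (intro add_nonneg_nonneg sum_nonneg) (auto simp: ratio_nonneg)

lemma up_mean_nonneg:
  assumes "A \<subseteq> ground" "\<And>S. S \<subseteq> ground \<Longrightarrow> g S \<ge> 0"
  shows "up_mean g A \<ge> 0"
  unfolding up_mean_def
  using assms(1) by (intro divide_nonneg_nonneg add_nonneg_nonneg mult_nonneg_nonneg sum_nonneg)
    (auto simp: ratio_nonneg total_nonneg intro!: assms(2))

lemma step_mean_nonneg: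
  assumes "S \<subseteq> ground" "\<And>S. S \<subseteq> ground \<Longrightarrow> g S \<ge> 0"
  shows "step_mean g S \<ge> 0"
  unfolding step_mean_def using assms by (intro divide_nonneg_nonneg sum_nonneg up_mean_nonneg) auto

lemma up_mean_indicator_sum:
  assumes "A \<subseteq> ground"
  shows "(\<Sum>X\<in>Pow ground. up_mean (indicator {X}) A * g X) = up_mean g A"
proof -
  have *: "(\<Sum>X\<in>Pow ground. indicator {X} S * g X) = g S" if "S \<subseteq> ground" for S
  proof -
    have "(\<Sum>X\<in>Pow ground. indicator {X} S * g X) = (\<Sum>X\<in>Pow ground. if S = X then g X else 0)"
      by (intro sum.cong refl) (auto simp: indicator_def)
    then show ?thesis using that by simp
  qed
  have "up_mean (indicator {X}) A * g X = (real (card A) * (indicator {X} A * g X)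
      + (\<Sum>j\<in>A. ratio A j * (indicator {X} (A - {j}) * g X))) / total A" for X
    unfolding up_mean_def
    by (simp only: sum_distrib_right distrib_right times_divide_eq_left mult.assoc)
  then have "(\<Sum>X\<in>Pow ground. up_mean (indicator {X}) A * g X)
    = (real (card A) * (\<Sum>X\<in>Pow ground. indicator {X} A * g X)
      + (\<Sum>X\<in>Pow ground. \<Sum>j\<in>A. ratio A j * (indicator {X} (A - {j}) * g X))) / total A"
    by (simp only: sum_divide_distrib[symmetric] sum.distrib sum_distrib_left[of "real (card A)"])
  also have "(\<Sum>X\<in>Pow ground. \<Sum>j\<in>A. ratio A j * (indicator {X} (A - {j}) * g X))
    = (\<Sum>j\<in>A. ratio A j * g (A - {j}))"
  proof -
    have "(\<Sum>X\<in>Pow ground. \<Sum>j\<in>A. ratio A j * (indicator {X} (A - {j}) * g X))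
      = (\<Sum>j\<in>A. ratio A j * (\<Sum>X\<in>Pow ground. indicator {X} (A - {j}) * g X))"
      by (subst sum.swap) (simp only: sum_distrib_left)
    moreover have "A - {j} \<subseteq> ground" for j using assms by auto
    ultimately show ?thesis by (simp only: *)
  qed
  finally show ?thesis unfolding up_mean_def using * assms by simp
qed

lemma sum_up: "(\<Sum>X\<in>Pow ground. up \<rho> X * g X) = (\<Sum>A\<in>Pow ground. \<rho> A * up_mean g A)"
proof -
  have "(\<Sum>X\<in>Pow ground. up \<rho> X * g X)
    = (\<Sum>A\<in>Pow ground. \<rho> A * (\<Sum>X\<in>Pow ground. up_mean (indicator {X}) A * g X))"
    unfolding up_def sum_distrib_right sum_distrib_left
    by (subst sum.swap) (simp add: mult.assoc)
  then show ?thesis by (simp add: up_mean_indicator_sum)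
qed

lemma sum_down: "(\<Sum>A\<in>Pow ground. down \<mu> A * h A) = (\<Sum>S\<in>Pow ground. \<mu> S * ((\<Sum>u\<in>ground. h (insert u S)) / n))"
proof -
  have "(\<Sum>A\<in>Pow ground. down \<mu> A * h A)
    = ((\<Sum>A\<in>Pow ground. real (card A) * \<mu> A * h A) + (\<Sum>A\<in>Pow ground. \<Sum>i\<in>A. \<mu> (A - {i}) * h A)) / n"
    unfolding down_def
    by (simp only: sum_distrib_right distrib_right times_divide_eq_left sum.distrib sum_divide_distrib[symmetric])
  also have "(\<Sum>A\<in>Pow ground. \<Sum>i\<in>A. \<mu> (A - {i}) * h A) = (\<Sum>S\<in>Pow ground. \<Sum>i\<in>ground - S. \<mu> S * h (insert i S))"
    by (rule sum_remove_insert[where f = "\<lambda>A B. \<mu> B * h A"]) simp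
  also have "(\<Sum>A\<in>Pow ground. real (card A) * \<mu> A * h A) = (\<Sum>S\<in>Pow ground. \<Sum>i\<in>S. \<mu> S * h (insert i S))"
    by (intro sum.cong refl) (simp add: insert_absorb)
  also have "(\<Sum>S\<in>Pow ground. \<Sum>i\<in>S. \<mu> S * h (insert i S)) + (\<Sum>S\<in>Pow ground. \<Sum>i\<in>ground - S. \<mu> S * h (insert i S))
    = (\<Sum>S\<in>Pow ground. \<mu> S * (\<Sum>u\<in>ground. h (insert u S)))"
    unfolding sum.distrib[symmetric]
  proof (intro sum.cong refl)
    fix S assume "S \<in> Pow ground"
    then have "(\<Sum>i\<in>ground. h (insert i S)) = (\<Sum>i\<in>ground - S. h (insert i S)) + (\<Sum>i\<in>S. h (insert i S))"
      by (intro sum.subset_diff) auto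
    then show "(\<Sum>i\<in>S. \<mu> S * h (insert i S)) + (\<Sum>i\<in>ground - S. \<mu> S * h (insert i S))
      = \<mu> S * (\<Sum>u\<in>ground. h (insert u S))"
      by (simp add: sum_distrib_left[symmetric] algebra_simps)
  qed
  finally show ?thesis by (subst (asm) sum_divide_distrib) (simp only: times_divide_eq_right)
qed

lemma sum_chain_step: "(\<Sum>X\<in>Pow ground. chain_step \<mu> X * g X) = (\<Sum>S\<in>Pow ground. \<mu> S * step_mean g S)"
  unfolding chain_step_def sum_up sum_down step_mean_def ..

lemma up_mean_const: "A \<subseteq> ground \<Longrightarrow> A \<noteq> {} \<Longrightarrow> up_mean (\<lambda>_. 1) A = 1"
  using total_pos[of A] by (simp add: up_mean_def) (simp add: total_def)

lemma step_mean_const: "S \<subseteq> ground \<Longrightarrow> step_mean (\<lambda>_. 1) S = 1"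
  using n by (simp add: step_mean_def up_mean_const)

lemma down_nonneg: "(\<And>S. \<mu> S \<ge> 0) \<Longrightarrow> down \<mu> A \<ge> 0"
  by (simp add: down_def sum_nonneg)

lemma chain_step_nonneg: "(\<And>S. \<mu> S \<ge> 0) \<Longrightarrow> chain_step \<mu> X \<ge> 0"
  unfolding chain_step_def up_def
  by (intro sum_nonneg mult_nonneg_nonneg down_nonneg up_mean_nonneg) auto

lemma chain_step_sum: "(\<Sum>X\<in>Pow ground. chain_step \<mu> X) = (\<Sum>S\<in>Pow ground. \<mu> S)"
  using sum_chain_step[of \<mu> "\<lambda>_. 1"] by (simp add: step_mean_const)

lemma chain_step_outside: "\<not> X \<subseteq> ground \<Longrightarrow> chain_step \<mu> X = 0"
  unfolding chain_step_def up_def up_mean_def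
  by (intro sum.neutral ballI) (auto simp: indicator_def intro!: sum.neutral)

lemma down_gibbs:
  assumes "A \<subseteq> ground"
  shows "down gibbs A = gibbs A * total A / n"
  unfolding down_def total_def using assms
  by (simp add: gibbs_remove sum_distrib_left algebra_simps)

lemma down_gibbs_zero:
  assumes "\<And>S. S \<subseteq> ground \<Longrightarrow> gibbs S = 0 \<Longrightarrow> \<mu> S = 0" "A \<subseteq> ground" "down gibbs A = 0"
  shows "down \<mu> A = 0"
proof (cases "A = {}")
  case False
  then have "gibbs A = 0" using assms down_gibbs total_pos[of A] n by auto
  then have "gibbs (A - {i}) = 0" if "i \<in> A" for i using that assms by (simp add: gibbs_remove)
  then have "\<mu> A = 0" "\<And>i. i \<in> A \<Longrightarrow> \<mu> (A - {i}) = 0"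
    using assms \<open>gibbs A = 0\<close> by blast+
  then show ?thesis by (simp add: down_def)
qed (simp add: down_def)

text \<open>The normaliser \<open>total\<close> cancels against \<open>down_gibbs\<close>. What
  remains counts a set \<open>S\<close> once for each of its elements, when it is kept, and once for
  each element outside, when that element was added and is removed again: \<open>n\<close> times
  altogether.\<close>

lemma gibbs_stationary:
  assumes "X \<subseteq> ground"
  shows "chain_step gibbs X = gibbs X"
proof -
  have "chain_step gibbs X = (\<Sum>A\<in>Pow ground. (real (card A) * (gibbs A * indicator {X} A)
      + (\<Sum>j\<in>A. gibbs (A - {j}) * indicator {X} (A - {j}))) / n)"
    unfolding chain_step_def up_def
  proof (intro sum.cong refl)
    fix A assume A: "A \<in> Pow ground"
    show "down gibbs A * up_mean (indicator {X}) A = (real (card A) * (gibbs A * indicator {X} A)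
      + (\<Sum>j\<in>A. gibbs (A - {j}) * indicator {X} (A - {j}))) / n"
    proof (cases "A = {}")
      case False
      then have "total A > 0" using A by (intro total_pos) auto
      then have "down gibbs A * up_mean (indicator {X}) A
        = gibbs A * (real (card A) * indicator {X} A + (\<Sum>j\<in>A. ratio A j * indicator {X} (A - {j}))) / n"
        using A by (simp add: down_gibbs up_mean_def)
      also have "\<dots> = (real (card A) * (gibbs A * indicator {X} A)
          + (\<Sum>j\<in>A. gibbs (A - {j}) * indicator {X} (A - {j}))) / n"
        using A by (simp add: gibbs_remove sum_distrib_left algebra_simps)
      finally show ?thesis .
    qed (simp add: down_def)
  qed
  also have "\<dots> = ((\<Sum>A\<in>Pow ground. real (card A) * (gibbs A * indicator {X} A))
      + (\<Sum>A\<in>Pow ground. \<Sum>j\<in>A. gibbs (A - {j}) * indicator {X} (A - {j}))) / n"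
    by (simp add: sum.distrib sum_divide_distrib[symmetric])
  also have "(\<Sum>A\<in>Pow ground. \<Sum>j\<in>A. gibbs (A - {j}) * indicator {X} (A - {j}))
     = (\<Sum>S\<in>Pow ground. \<Sum>i\<in>ground - S. gibbs S * indicator {X} S)"
    by (rule sum_remove_insert[where f = "\<lambda>A B. gibbs B * indicator {X} B"]) simp
  also have "(\<Sum>A\<in>Pow ground. real (card A) * (gibbs A * indicator {X} A))
      + (\<Sum>S\<in>Pow ground. \<Sum>i\<in>ground - S. gibbs S * indicator {X} S)
    = (\<Sum>S\<in>Pow ground. real n * (gibbs S * indicator {X} S))"
    unfolding sum.distrib[symmetric]
  proof (intro sum.cong refl)
    fix S assume "S \<in> Pow ground"
    then have "card (ground - S) = n - card S" "card S \<le> n"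
      using card_mono[of ground S] by (auto simp: card_Diff_subset finite_subset_ground)
    then show "real (card S) * (gibbs S * indicator {X} S) + (\<Sum>i\<in>ground - S. gibbs S * indicator {X} S)
      = real n * (gibbs S * indicator {X} S)"
      by (simp add: of_nat_diff algebra_simps)
  qed
  also have "\<dots> = real n * gibbs X"
  proof -
    have "(\<Sum>S\<in>Pow ground. real n * (gibbs S * indicator {X} S)) = (\<Sum>S\<in>Pow ground. if S = X then real n * gibbs X else 0)"
      by (intro sum.cong refl) (auto simp: indicator_def)
    then show ?thesis using assms by simp
  qed
  finally show ?thesis using n by simp
qed

lemma sum_gibbs: "(\<Sum>S\<in>Pow ground. gibbs S) = 1"
  using partition_function_pos by (simp add: gibbs_def sum_divide_distrib[symmetric] partition_function_def)

section \<open>Entropy of the chain in terms of partial sequences\<close>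

lemma multiset_law_encode:
  assumes "T \<subseteq> ground"
  shows "multiset_law n \<mu> (encode T n) = \<mu> (ground - T) * fact (n - card T) / fact n"
proof -
  have "finite T" "0 \<notin> T" using assms finite_subset_ground by auto
  moreover have "ground - set_mset (encode T n) = ground - T"
    using set_encode_minus[of T n] \<open>finite T\<close> by fastforce
  ultimately show ?thesis
    using assms by (simp add: multiset_law_def simple_encode count_encode_0)
qed

text \<open>Identifies the law of the first \<open>n - 1\<close> entries with \<open>down\<close>.
  The factorial quotient is the reciprocal of the number of orderings in
  \<open>expand_funpow_empty\<close>, so the two cancel in the entropy.\<close>

lemma marginal_encode:
  assumes "T \<subseteq> ground" "card T < n"
  shows "marginal n \<mu> (encode T (n - 1)) = fact (n - 1 - card T) / fact (n - 1) * down \<mu> (ground - T)"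
proof -
  have fin: "finite T" using assms finite_subset_ground by blast
  define S where "S = ground - T"
  have card_S: "card S = n - card T" using assms fin by (simp add: S_def card_Diff_subset)
  have n1: "Suc (n - 1) = n" using n by simp
  have "marginal n \<mu> (encode T (n - 1)) = expand {0..n} (marginal n \<mu>) (encode T (n - 1))"
    using assms fin n by (subst marginal_rec) (auto simp: expand_def size_encode)
  also have "\<dots> = marginal n \<mu> (encode T n) + (\<Sum>i\<in>S. marginal n \<mu> (encode (insert i T) n))"
    using assms by (subst expand_encode) (auto simp: marginal_not_simple n1 S_def)
  also have "marginal n \<mu> (encode T n) = \<mu> S * fact (card S) / fact n"
    using assms fin by (simp add: marginal_top size_encode multiset_law_encode S_def[symmetric] card_S)
  also have "(\<Sum>i\<in>S. marginal n \<mu> (encode (insert i T) n)) = (\<Sum>i\<in>S. \<mu> (S - {i}) * fact (card S - 1) / fact n)"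
  proof (intro sum.cong refl)
    fix i assume i: "i \<in> S"
    have "ground - insert i T = S - {i}" by (auto simp: S_def)
    moreover have "card (insert i T) = Suc (card T)" using i fin by (simp add: S_def)
    moreover have "i \<in> ground" using i by (simp add: S_def)
    ultimately show "marginal n \<mu> (encode (insert i T) n) = \<mu> (S - {i}) * fact (card S - 1) / fact n"
      using assms fin by (simp add: marginal_top size_encode multiset_law_encode card_S Suc_eq_plus1)
  qed
  also have "\<mu> S * fact (card S) / fact n + (\<Sum>i\<in>S. \<mu> (S - {i}) * fact (card S - 1) / fact n)
    = fact (card S - 1) / fact n * (real (card S) * \<mu> S + (\<Sum>i\<in>S. \<mu> (S - {i})))"
  proof -
    have "fact (card S) = real (card S) * (fact (card S - 1) :: real)"
      using assms card_S by (intro fact_reduce) simp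
    then show ?thesis by (simp add: sum_distrib_left algebra_simps sum_divide_distrib add_divide_distrib)
  qed
  also have "\<dots> = fact (card S - 1) / fact (n - 1) * down \<mu> S"
  proof -
    have "fact n = n * (fact (n - 1) :: real)" using n by (intro fact_reduce) simp
    then show ?thesis by (simp add: down_def)
  qed
  finally show ?thesis using card_S by (simp add: S_def add.commute)
qed

lemma sum_complement: "(\<Sum>T\<in>Pow ground. f (ground - T)) = (\<Sum>S\<in>Pow ground. f S)"
  by (rule sum.reindex_bij_witness[where i = "\<lambda>S. ground - S" and j = "\<lambda>S. ground - S"]) auto

lemma marginal_empty: "marginal n \<mu> {#} = (\<Sum>S\<in>Pow ground. \<mu> S)"
proof -
  have sets: "{T. T \<subseteq> ground \<and> card T \<le> n} = Pow ground"
    using card_mono[of ground] by auto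
  have "marginal n \<mu> {#} = (\<Sum>T\<in>Pow ground. fact n / fact (n - card T) * multiset_law n \<mu> (encode T n))"
    unfolding marginal_def by (subst expand_funpow_empty[of n]) (auto simp: multiset_law_def sets)
  also have "\<dots> = (\<Sum>T\<in>Pow ground. \<mu> (ground - T))"
    by (intro sum.cong refl) (simp add: multiset_law_encode)
  also have "\<dots> = (\<Sum>S\<in>Pow ground. \<mu> S)" by (rule sum_complement)
  finally show ?thesis .
qed

lemma entropy_contraction_down:
  assumes nonneg: "\<And>S. \<mu> S \<ge> 0" and sum1: "(\<Sum>S\<in>Pow ground. \<mu> S) = 1"
    and ac: "\<And>S. S \<subseteq> ground \<Longrightarrow> gibbs S = 0 \<Longrightarrow> \<mu> S = 0"
  shows "real n * relative_entropy (Pow ground) (down \<mu>) (down gibbs)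
    \<le> (real n - 1) * relative_entropy (Pow ground) \<mu> gibbs"
proof -
  define e where "e x = marginal n \<mu> x * ln (marginal n \<mu> x / marginal n gibbs x)" for x
  have e0: "e x = 0" if "\<not> simple n x" for x using that by (simp add: e_def marginal_not_simple)
  have "real n * (expand {0..n} ^^ (n - 1)) e {#} \<le> (real n - 1) * (expand {0..n} ^^ n) e {#}"
  proof (rule entropy_contraction[OF _ _ _ e_def])
    show "marginal n \<mu> x \<ge> 0" for x using nonneg by (rule marginal_nonneg)
    show "size x < n \<Longrightarrow> marginal n \<mu> x = (\<Sum>b\<in>{0..n}. marginal n \<mu> (add_mset b x))" for x
      by (rule marginal_rec)
    show "marginal n gibbs x = 0 \<Longrightarrow> marginal n \<mu> x = 0" for x
      using gibbs_nonneg ac by (rule marginal_zero)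
    show "marginal n \<mu> {#} = marginal n gibbs {#}" by (simp add: marginal_empty sum1 sum_gibbs)
  qed (rule n)
  moreover have "(expand {0..n} ^^ n) e {#} = relative_entropy (Pow ground) \<mu> gibbs"
  proof -
    have sets: "{T. T \<subseteq> ground \<and> card T \<le> n} = Pow ground"
      using card_mono[of ground] by auto
    have "(expand {0..n} ^^ n) e {#} = (\<Sum>T\<in>Pow ground. fact n / fact (n - card T) * e (encode T n))"
      by (subst expand_funpow_empty[of n]) (auto simp: e0 sets)
    also have "\<dots> = (\<Sum>T\<in>Pow ground. \<mu> (ground - T) * ln (\<mu> (ground - T) / gibbs (ground - T)))"
    proof (intro sum.cong refl)
      fix T assume "T \<in> Pow ground"
      then have "size (encode T n) = n"
        using card_mono[of ground T] by (simp add: size_encode finite_subset_ground)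
      then show "fact n / fact (n - card T) * e (encode T n) = \<mu> (ground - T) * ln (\<mu> (ground - T) / gibbs (ground - T))"
        using \<open>T \<in> Pow ground\<close> by (simp add: e_def marginal_top multiset_law_encode)
    qed
    finally show ?thesis
      unfolding relative_entropy_def sum_complement[of "\<lambda>S. \<mu> S * ln (\<mu> S / gibbs S)"] .
  qed
  moreover have "(expand {0..n} ^^ (n - 1)) e {#} = relative_entropy (Pow ground) (down \<mu>) (down gibbs)"
  proof -
    have "(expand {0..n} ^^ (n - 1)) e {#}
      = (\<Sum>T\<in>{T. T \<subseteq> ground \<and> card T \<le> n - 1}. fact (n - 1) / fact (n - 1 - card T) * e (encode T (n - 1)))"
      by (subst expand_funpow_empty[of n]) (auto simp: e0)
    also have "\<dots> = (\<Sum>T\<in>{T. T \<subseteq> ground \<and> card T \<le> n - 1}.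
        down \<mu> (ground - T) * ln (down \<mu> (ground - T) / down gibbs (ground - T)))"
      using n by (intro sum.cong refl) (auto simp: e_def marginal_encode)
    \<comment> \<open>Only \<open>T = ground\<close> is added, which corresponds to the empty set,
      where \<open>down\<close> vanishes.\<close>
    also have "\<dots> = (\<Sum>T\<in>Pow ground. down \<mu> (ground - T) * ln (down \<mu> (ground - T) / down gibbs (ground - T)))"
    proof (rule sum.mono_neutral_left)
      show "\<forall>T\<in>Pow ground - {T. T \<subseteq> ground \<and> card T \<le> n - 1}.
        down \<mu> (ground - T) * ln (down \<mu> (ground - T) / down gibbs (ground - T)) = 0"
      proof
        fix T assume T: "T \<in> Pow ground - {T. T \<subseteq> ground \<and> card T \<le> n - 1}"
        then have "card T = card ground" using card_mono[of ground T] by auto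
        then have "T = ground" using T by (intro card_subset_eq) auto
        then show "down \<mu> (ground - T) * ln (down \<mu> (ground - T) / down gibbs (ground - T)) = 0"
          by (simp add: down_def)
      qed
    qed auto
    finally show ?thesis
      unfolding relative_entropy_def sum_complement[of "\<lambda>S. down \<mu> S * ln (down \<mu> S / down gibbs S)"] .
  qed
  ultimately show ?thesis by simp
qed

text \<open>Stationarity makes a sum of nonnegative terms vanish at \<open>X\<close>. Each
  transition into \<open>X\<close> therefore starts from a set without mass under
  \<open>down gibbs\<close>, hence without mass under \<open>down \<mu>\<close>.\<close>

lemma chain_step_gibbs_zero:
  assumes ac: "\<And>S. S \<subseteq> ground \<Longrightarrow> gibbs S = 0 \<Longrightarrow> \<mu> S = 0" and X: "X \<subseteq> ground" "gibbs X = 0"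
  shows "chain_step \<mu> X = 0"
proof -
  have "chain_step gibbs X = 0" using X by (simp add: gibbs_stationary)
  then have "\<forall>A\<in>Pow ground. down gibbs A * up_mean (indicator {X}) A = 0"
    unfolding chain_step_def up_def
    by (subst (asm) sum_nonneg_eq_0_iff) (auto intro!: mult_nonneg_nonneg down_nonneg gibbs_nonneg up_mean_nonneg)
  then show ?thesis
    unfolding chain_step_def up_def using down_gibbs_zero[of \<mu>, OF ac] by (intro sum.neutral ballI) auto
qed

text \<open>All contraction happens in \<open>down\<close>. The second half of the step applies one
  kernel to both laws and by data processing does not increase the entropy; stationarity restores
  \<open>gibbs\<close> as the reference.\<close>

lemma entropy_contraction_step:
  assumes nonneg: "\<And>S. \<mu> S \<ge> 0" and sum1: "(\<Sum>S\<in>Pow ground. \<mu> S) = 1"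
    and ac: "\<And>S. S \<subseteq> ground \<Longrightarrow> gibbs S = 0 \<Longrightarrow> \<mu> S = 0"
  shows "relative_entropy (Pow ground) (chain_step \<mu>) gibbs
    \<le> (1 - 1 / n) * relative_entropy (Pow ground) \<mu> gibbs"
proof -
  have "relative_entropy (Pow ground) (chain_step \<mu>) gibbs
    = relative_entropy (Pow ground) (chain_step \<mu>) (chain_step gibbs)"
    unfolding relative_entropy_def by (intro sum.cong refl) (simp add: gibbs_stationary)
  also have "\<dots> \<le> relative_entropy (Pow ground) (down \<mu>) (down gibbs)"
    unfolding chain_step_def up_def
  proof (rule relative_entropy_data_processing)
    fix A assume A: "A \<in> Pow ground" "down \<mu> A \<noteq> 0"
    then have "A \<noteq> {}" by (auto simp: down_def)
    then show "(\<Sum>X\<in>Pow ground. up_mean (indicator {X}) A) = 1"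
      using A up_mean_indicator_sum[of A "\<lambda>_. 1"] up_mean_const[of A] by simp
  qed (auto intro!: up_mean_nonneg down_nonneg nonneg gibbs_nonneg down_gibbs_zero[of \<mu>, OF ac])
  also have "\<dots> \<le> (1 - 1 / n) * relative_entropy (Pow ground) \<mu> gibbs"
    using entropy_contraction_down[OF assms] n by (simp add: field_simps)
  finally show ?thesis .
qed

lemma chain_law:
  assumes S: "S \<subseteq> ground" "gibbs S > 0"
  defines "\<mu> \<equiv> \<lambda>N. (chain_step ^^ N) (indicator {S})"
  shows chain_law_nonneg: "\<mu> N X \<ge> 0"
    and chain_law_sum: "(\<Sum>X\<in>Pow ground. \<mu> N X) = 1"
    and chain_law_zero: "X \<subseteq> ground \<Longrightarrow> gibbs X = 0 \<Longrightarrow> \<mu> N X = 0"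
    and chain_law_outside: "\<not> X \<subseteq> ground \<Longrightarrow> \<mu> N X = 0"
    and chain_law_entropy: "relative_entropy (Pow ground) (\<mu> N) gibbs \<le> (1 - 1 / n) ^ N * ln (1 / gibbs S)"
    and chain_law_mean: "(\<Sum>X\<in>Pow ground. \<mu> N X * g X) = (step_mean ^^ N) g S"
proof -
  have init: "(\<Sum>X\<in>Pow ground. indicator {S} X * f X) = (f S :: real)" for f
  proof -
    have "(\<Sum>X\<in>Pow ground. indicator {S} X * f X) = (\<Sum>X\<in>Pow ground. if X = S then f S else 0)"
      by (intro sum.cong refl) (auto simp: indicator_def)
    then show ?thesis using S by simp
  qed
  show nonneg: "\<mu> N X \<ge> 0" for N X
    unfolding \<mu>_def by (induction N arbitrary: X) (auto intro: chain_step_nonneg)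
  show sum1: "(\<Sum>X\<in>Pow ground. \<mu> N X) = 1" for N
    unfolding \<mu>_def using init[of "\<lambda>_. 1"] by (induction N) (auto simp: chain_step_sum)
  show zero: "\<mu> N X = 0" if "X \<subseteq> ground" "gibbs X = 0" for N X
    using that S unfolding \<mu>_def
    by (induction N arbitrary: X) (auto simp: indicator_def intro: chain_step_gibbs_zero)
  show "\<not> X \<subseteq> ground \<Longrightarrow> \<mu> N X = 0"
    using S unfolding \<mu>_def by (cases N) (auto simp: chain_step_outside indicator_def)
  show "relative_entropy (Pow ground) (\<mu> N) gibbs \<le> (1 - 1 / n) ^ N * ln (1 / gibbs S)"
  proof (induction N)
    case 0
    have "relative_entropy (Pow ground) (\<mu> 0) gibbs
      = (\<Sum>X\<in>Pow ground. indicator {S} X * ln (1 / gibbs X))"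
      unfolding relative_entropy_def \<mu>_def by (intro sum.cong refl) (auto simp: indicator_def)
    then show ?case by (simp add: init)
  next
    case (Suc N)
    have "relative_entropy (Pow ground) (\<mu> (Suc N)) gibbs = relative_entropy (Pow ground) (chain_step (\<mu> N)) gibbs"
      by (simp add: \<mu>_def)
    also have "\<dots> \<le> (1 - 1 / n) * relative_entropy (Pow ground) (\<mu> N) gibbs"
      by (rule entropy_contraction_step[OF nonneg sum1 zero])
    also have "\<dots> \<le> (1 - 1 / n) * ((1 - 1 / n) ^ N * ln (1 / gibbs S))"
      using n by (intro mult_left_mono Suc.IH) simp
    finally show ?case by simp
  qed
  show "(\<Sum>X\<in>Pow ground. \<mu> N X * g X) = (step_mean ^^ N) g S"
  proof (induction N arbitrary: g)
    case 0
    then show ?case by (simp add: \<mu>_def init)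
  next
    case (Suc N)
    have "(\<Sum>X\<in>Pow ground. \<mu> (Suc N) X * g X) = (\<Sum>X\<in>Pow ground. \<mu> N X * step_mean g X)"
      by (simp add: \<mu>_def sum_chain_step)
    then show ?case by (simp add: Suc.IH funpow_swap1)
  qed
qed

end

section \<open>Weakest preexpectations\<close>

lemma run_Suc_first: "run n rk (Suc k) c = bind_pmf (step n rk c) (run n rk k)"
proof (induction k)
  case 0
  then show ?case by (simp add: bind_return_pmf bind_return_pmf')
next
  case (Suc k)
  have "run n rk (Suc (Suc k)) c = bind_pmf (bind_pmf (step n rk c) (run n rk k)) (step n rk)"
    using Suc.IH by simp
  then show ?case by (simp add: bind_assoc_pmf)
qed

lemma ennreal_half_sum: "x * ennreal (1 / 2) + y * ennreal (1 / 2) = (x + y) / 2"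
proof -
  have "ennreal (1 / 2) = 1 / 2" using ennreal_divide_numeral[of 1 "num.Bit0 num.One"] by simp
  then show ?thesis by (simp add: ennreal_times_divide add_divide_distrib_ennreal)
qed

text \<open>The two cost parameters are the time of a command and the additional time of a rank query:
  \<open>(1, t)\<close> for running times and \<open>(0, 0)\<close> for output probabilities.\<close>

locale machine =
  fixes n :: nat and rk :: "nat set \<Rightarrow> nat" and a b :: real
  assumes a: "a \<ge> 0" and b: "b \<ge> 0"
begin

fun command_cost :: "com \<Rightarrow> real" where
  "command_cost (QueryRank x e y) = a + b"
| "command_cost _ = a"

fun config_cost :: "config \<Rightarrow> real" where
  "config_cost ([], s) = 0"
| "config_cost (c # cs, s) = command_cost c"

text \<open>The expected cost of the first \<open>k\<close> steps plus \<open>\<phi>\<close> on the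
  runs halted by then; unfinished runs contribute only their cost.\<close>

primrec reward :: "(store \<Rightarrow> ennreal) \<Rightarrow> nat \<Rightarrow> config \<Rightarrow> ennreal" where
  "reward \<phi> 0 c = (if fst c = [] then \<phi> (snd c) else 0)"
| "reward \<phi> (Suc k) c = ennreal (config_cost c) + (\<integral>\<^sup>+ d. reward \<phi> k d \<partial>measure_pmf (step n rk c))"

lemma reward_halted [simp]: "reward \<phi> k ([], s) = \<phi> s"
  by (induction k) auto

lemma reward_eq:
  "reward \<phi> k c = (\<Sum>i<k. \<integral>\<^sup>+ d. ennreal (config_cost d) \<partial>measure_pmf (run n rk i c))
    + (\<integral>\<^sup>+ d. (if fst d = [] then \<phi> (snd d) else 0) \<partial>measure_pmf (run n rk k c))"
proof (induction k arbitrary: c)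
  case (Suc k)
  have "(\<integral>\<^sup>+ d. reward \<phi> k d \<partial>measure_pmf (step n rk c))
    = (\<Sum>i<k. \<integral>\<^sup>+ d. ennreal (config_cost d) \<partial>measure_pmf (run n rk (Suc i) c))
      + (\<integral>\<^sup>+ d. (if fst d = [] then \<phi> (snd d) else 0) \<partial>measure_pmf (run n rk (Suc k) c))"
    unfolding Suc.IH run_Suc_first nn_integral_bind_pmf
    by (subst nn_integral_add) (auto simp: nn_integral_sum)
  moreover have "(\<Sum>i<Suc k. \<integral>\<^sup>+ d. ennreal (config_cost d) \<partial>measure_pmf (run n rk i c))
    = ennreal (config_cost c) + (\<Sum>i<k. \<integral>\<^sup>+ d. ennreal (config_cost d) \<partial>measure_pmf (run n rk (Suc i) c))"
    by (subst sum.lessThan_Suc_shift) simp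
  ultimately show ?case by (simp only: reward.simps add.assoc)
qed simp

text \<open>The expected runtime transformer of probabilistic programs: the expected cost of the
  command followed by a continuation of expected cost \<open>f\<close>. A loop is a least fixed
  point, so any prefixed point bounds it from above.\<close>

primrec ert :: "com \<Rightarrow> (store \<Rightarrow> ennreal) \<Rightarrow> store \<Rightarrow> ennreal" where
  "ert Skip f = (\<lambda>s. ennreal a + f s)"
| "ert (NAssign x e v) f = (\<lambda>s. ennreal a + f (write_nat x (nval s e) (nval s v) s))"
| "ert (RAssign x e v) f = (\<lambda>s. ennreal a + f (write_real x (nval s e) (rval s v) s))"
| "ert (Flip x e) f =
    (\<lambda>s. ennreal a + (f (write_nat x (nval s e) 1 s) + f (write_nat x (nval s e) 0 s)) / 2)"
| "ert (QueryRank x e y) f =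
    (\<lambda>s. ennreal (a + b) + f (write_nat x (nval s e) (rk (read_set n y s)) s))"
| "ert (Seq c d) f = (\<lambda>s. ennreal a + ert c (ert d f) s)"
| "ert (Cond t c d) f = (\<lambda>s. ennreal a + (if bval s t then ert c f s else ert d f s))"
| "ert (While t c) f = lfp (\<lambda>X s. ennreal a + (if bval s t then ert c X s else f s))"

lemma ert_mono: "f \<le> g \<Longrightarrow> ert p f \<le> ert p g"
proof (induction p arbitrary: f g)
  case (Flip x e)
  then show ?case by (auto simp: le_fun_def intro!: add_mono divide_right_mono_ennreal)
next
  case (Seq c d)
  have "ert c (ert d f) \<le> ert c (ert d g)" by (intro Seq.IH Seq.prems)
  then show ?case by (simp add: le_fun_def add_left_mono)
next
  case (Cond t c d)
  have "ert c f \<le> ert c g" "ert d f \<le> ert d g" by (intro Cond.IH Cond.prems)+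
  then show ?case by (simp add: le_fun_def add_left_mono)
next
  case (While t c)
  have "f s \<le> g s" for s using While.prems by (rule le_funD)
  then show ?case unfolding ert.simps by (intro lfp_mono le_funI add_left_mono) simp
qed (simp_all add: le_fun_def add_left_mono)

lemma ert_While:
  "ert (While t c) f s = ennreal a + (if bval s t then ert c (ert (While t c) f) s else f s)"
proof -
  have "mono (\<lambda>X s. ennreal a + (if bval s t then ert c X s else f s))"
  proof (rule monoI, rule le_funI)
    fix X Y :: "store \<Rightarrow> ennreal" and s assume "X \<le> Y"
    then have "ert c X s \<le> ert c Y s" by (intro le_funD[OF ert_mono])
    then show "ennreal a + (if bval s t then ert c X s else f s) \<le> ennreal a + (if bval s t then ert c Y s else f s)"
      by (simp add: add_left_mono)
  qed
  from lfp_unfold[OF this] show ?thesis by (simp add: fun_eq_iff)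
qed

declare ert.simps(8) [simp del]

text \<open>The bound \<open>f\<close> stands for the pending commands \<open>cs\<close>, for every
  remaining number of steps up to \<open>k\<close>, as \<open>p\<close> consumes an unknown number
  of them. The loop case needs an inner induction on \<open>k\<close>, because the loop reappears
  among the pending commands.\<close>

lemma reward_le_ert:
  assumes "\<And>j s. j \<le> k \<Longrightarrow> reward \<phi> j (cs, s) \<le> f s"
  shows "reward \<phi> k (p # cs, s) \<le> ert p f s"
  using assms
proof (induction p arbitrary: cs f k s)
  case (Flip x e)
  show ?case
  proof (cases k)
    case (Suc j)
    have "reward \<phi> k (Flip x e # cs, s)
      = ennreal a + (reward \<phi> j (cs, write_nat x (nval s e) 1 s) * ennreal (1 / 2)
          + reward \<phi> j (cs, write_nat x (nval s e) 0 s) * ennreal (1 / 2))"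
      by (simp add: Suc)
    also have "\<dots> \<le> ennreal a + (f (write_nat x (nval s e) 1 s) * ennreal (1 / 2)
          + f (write_nat x (nval s e) 0 s) * ennreal (1 / 2))"
      using Flip Suc by (intro add_left_mono add_mono mult_right_mono) auto
    finally show ?thesis unfolding ennreal_half_sum by simp
  qed simp
next
  case (Seq c d)
  show ?case
  proof (cases k)
    case (Suc j)
    have "reward \<phi> j (c # d # cs, s) \<le> ert c (ert d f) s"
    proof (rule Seq.IH(1))
      fix i s assume "i \<le> j"
      show "reward \<phi> i (d # cs, s) \<le> ert d f s"
        by (rule Seq.IH(2)) (use \<open>i \<le> j\<close> Suc Seq.prems in auto)
    qed
    then show ?thesis by (simp add: Suc add_left_mono)
  qed simp
next
  case (Cond t c d)
  show ?case
  proof (cases k)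
    case (Suc j)
    have "reward \<phi> j (c # cs, s) \<le> ert c f s" "reward \<phi> j (d # cs, s) \<le> ert d f s"
      by (rule Cond.IH; use Suc Cond.prems in auto)+
    then show ?thesis by (simp add: Suc add_left_mono)
  qed simp
next
  case (While t c)
  from While.prems show ?case
  proof (induction k arbitrary: s rule: less_induct)
    case (less k)
    show ?case
    proof (cases k)
      case (Suc j)
      have "reward \<phi> j (c # While t c # cs, s) \<le> ert c (ert (While t c) f) s"
        by (rule While.IH) (use less Suc in auto)
      moreover have "reward \<phi> j (cs, s) \<le> f s" using less.prems Suc by auto
      ultimately show ?thesis
        by (subst ert_While) (simp add: Suc add_left_mono)
    qed simp
  qed
qed (case_tac k; simp add: add_left_mono)+

end

lemma expected_time_le_ert:
  assumes "t \<ge> 0"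
  shows "expected_time n rk t p s \<le> machine.ert n rk 1 t p (\<lambda>_. 0) s"
proof -
  interpret machine n rk 1 t by unfold_locales (use assms in auto)
  have cost: "step_cost t c = config_cost c" for c
  proof (cases c)
    case (Pair cs s)
    then show ?thesis
    proof (cases cs)
      case (Cons d ds)
      then show ?thesis using Pair by (cases d) auto
    qed simp
  qed
  have "(\<Sum>i<k. \<integral>\<^sup>+ d. ennreal (config_cost d) \<partial>measure_pmf (run n rk i ([p], s))) \<le> ert p (\<lambda>_. 0) s" for k
  proof -
    have "reward (\<lambda>_. 0) k ([p], s) \<le> ert p (\<lambda>_. 0) s" by (rule reward_le_ert) simp
    then show ?thesis unfolding reward_eq by simp
  qed
  then show ?thesis unfolding expected_time_def cost by (intro suminf_le_const summableI) auto
qed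

text \<open>With unit costs and free queries a step costs 1 exactly while the program is running, so
  the expected time is the sum of the probabilities of not having halted; a finite sum forces these
  to 0.\<close>

lemma tendsto_prob_halted:
  assumes "machine.ert n rk 1 0 p (\<lambda>_. 0) s < \<infinity>"
  shows "(\<lambda>k. measure_pmf.prob (run n rk k ([p], s)) {c. fst c = []}) \<longlonglongrightarrow> 1"
proof -
  define h where "h k = measure_pmf.prob (run n rk k ([p], s)) {c. fst c \<noteq> []}" for k
  have "ennreal (h k) \<le> (\<integral>\<^sup>+ c. ennreal (step_cost 0 c) \<partial>measure_pmf (run n rk k ([p], s)))" for k
  proof -
    have "ennreal (h k) = (\<integral>\<^sup>+ c. indicator {c. fst c \<noteq> []} c \<partial>measure_pmf (run n rk k ([p], s)))"
      by (simp add: h_def measure_pmf.emeasure_eq_measure)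
    also have "\<dots> \<le> (\<integral>\<^sup>+ c. ennreal (step_cost 0 c) \<partial>measure_pmf (run n rk k ([p], s)))"
    proof (rule nn_integral_mono)
      fix c :: config
      show "indicator {c. fst c \<noteq> []} c \<le> ennreal (step_cost 0 c)"
      proof (cases c)
        case (Pair cs s)
        then show ?thesis
        proof (cases cs)
          case (Cons d ds)
          then show ?thesis using Pair by (cases d) auto
        qed simp
      qed
    qed
    finally show ?thesis .
  qed
  then have "(\<Sum>k. ennreal (h k)) \<le> expected_time n rk 0 p s"
    unfolding expected_time_def by (intro suminf_le summableI) auto
  also have "\<dots> < \<infinity>" using expected_time_le_ert[of 0 n rk p s] assms by simp
  finally have "summable h"
    by (intro summable_suminf_not_top) (auto simp: h_def)
  then have "h \<longlonglongrightarrow> 0" by (rule summable_LIMSEQ_zero)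
  then have "(\<lambda>k. 1 - h k) \<longlonglongrightarrow> 1 - 0" by (intro tendsto_intros)
  moreover have "1 - h k = measure_pmf.prob (run n rk k ([p], s)) {c. fst c = []}" for k
  proof -
    have "h k = 1 - measure_pmf.prob (run n rk k ([p], s)) {c. fst c = []}"
      unfolding h_def by (subst measure_pmf.prob_compl[symmetric]) (auto intro!: arg_cong[where f = "measure _"])
    then show ?thesis by simp
  qed
  ultimately show ?thesis by simp
qed

text \<open>The gaps between \<open>pmf \<mu> X\<close> and the probability of having halted with
  output \<open>X\<close> are nonnegative, and they sum to at most the probability of not having
  halted. The latter tends to 0, so every gap closes and the upper bounds are attained.\<close>

lemma output_distributionI:
  assumes fin: "machine.ert n rk 1 0 p (\<lambda>_. 0) s < \<infinity>"
    and upper: "\<And>X. X \<subseteq> {1..n} \<Longrightarrow>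
      machine.ert n rk 0 0 p (\<lambda>s. indicator {X} (read_set n 1 s)) s \<le> ennreal (pmf \<mu> X)"
    and outside: "\<And>X. \<not> X \<subseteq> {1..n} \<Longrightarrow> pmf \<mu> X = 0"
  shows "output_distribution n rk p s \<mu>"
proof -
  interpret machine n rk 0 0 by unfold_locales auto
  define h where "h k X = measure_pmf.prob (run n rk k ([p], s)) {c. fst c = [] \<and> read_set n 1 (snd c) = X}" for k X
  have read: "read_set n 1 s \<subseteq> {1..n}" for s by (auto simp: read_set_def)
  have h_le: "h k X \<le> pmf \<mu> X" if "X \<subseteq> {1..n}" for k X
  proof -
    let ?\<phi> = "\<lambda>s. indicator {X} (read_set n 1 s) :: ennreal"
    have "ennreal (h k X) = (\<integral>\<^sup>+ c. indicator {c. fst c = [] \<and> read_set n 1 (snd c) = X} c \<partial>measure_pmf (run n rk k ([p], s)))"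
      by (simp add: h_def measure_pmf.emeasure_eq_measure)
    also have "\<dots> = (\<integral>\<^sup>+ c. (if fst c = [] then ?\<phi> (snd c) else 0) \<partial>measure_pmf (run n rk k ([p], s)))"
      by (intro nn_integral_cong) (auto simp: indicator_def)
    also have "\<dots> \<le> reward ?\<phi> k ([p], s)"
      unfolding reward_eq by (rule add_increasing) auto
    also have "\<dots> \<le> ert p ?\<phi> s" by (rule reward_le_ert) simp
    also have "\<dots> \<le> ennreal (pmf \<mu> X)" by (rule upper[OF that])
    finally show ?thesis by simp
  qed
  have halted: "(\<Sum>X\<in>Pow {1..n}. h k X) = measure_pmf.prob (run n rk k ([p], s)) {c. fst c = []}" for k
  proof -
    have "(\<Sum>X\<in>Pow {1..n}. h k X)
      = measure_pmf.prob (run n rk k ([p], s)) (\<Union>X\<in>Pow {1..n}. {c. fst c = [] \<and> read_set n 1 (snd c) = X})"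
      unfolding h_def
      by (rule measure_pmf.finite_measure_finite_Union[symmetric]) (auto simp: disjoint_family_on_def)
    also have "(\<Union>X\<in>Pow {1..n}. {c. fst c = [] \<and> read_set n 1 (snd c) = X}) = {c :: config. fst c = []}"
      using read by blast
    finally show ?thesis .
  qed
  have total: "(\<Sum>X\<in>Pow {1..n}. pmf \<mu> X) \<le> 1"
    by (metis measure_pmf.prob_le_1 measure_measure_pmf_finite finite_Pow_iff finite_atLeastAtMost)
  have lim: "(\<lambda>k. \<Sum>X\<in>Pow {1..n}. h k X) \<longlonglongrightarrow> 1"
    using tendsto_prob_halted[OF fin] unfolding halted .
  have "pmf \<mu> X = (SUP k. h k X)" for X
  proof (cases "X \<subseteq> {1..n}")
    case True
    have bdd: "bdd_above (range (\<lambda>k. h k X))" using h_le[OF True] by (intro bdd_aboveI) auto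
    have "pmf \<mu> X - (1 - (\<Sum>Y\<in>Pow {1..n}. h k Y)) \<le> (SUP k. h k X)" for k
    proof -
      have "pmf \<mu> X - h k X \<le> (\<Sum>Y\<in>Pow {1..n}. pmf \<mu> Y - h k Y)"
        using True h_le by (intro member_le_sum[of X "Pow {1..n}" "\<lambda>Y. pmf \<mu> Y - h k Y"]) auto
      also have "\<dots> \<le> 1 - (\<Sum>Y\<in>Pow {1..n}. h k Y)" using total by (simp add: sum_subtractf)
      finally have "pmf \<mu> X - (1 - (\<Sum>Y\<in>Pow {1..n}. h k Y)) \<le> h k X" by simp
      also have "\<dots> \<le> (SUP k. h k X)" by (intro cSUP_upper bdd) simp
      finally show ?thesis .
    qed
    moreover have "(\<lambda>k. pmf \<mu> X - (1 - (\<Sum>Y\<in>Pow {1..n}. h k Y))) \<longlonglongrightarrow> pmf \<mu> X - (1 - 1)"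
      by (intro tendsto_intros lim)
    ultimately have "pmf \<mu> X - (1 - 1) \<le> (SUP k. h k X)"
      by (intro LIMSEQ_le_const2) auto
    moreover have "(SUP k. h k X) \<le> pmf \<mu> X" using h_le[OF True] by (intro cSUP_least) auto
    ultimately show ?thesis by simp
  next
    case False
    then have "{c :: config. fst c = [] \<and> read_set n 1 (snd c) = X} = {}" using read by blast
    then have "h k X = 0" for k by (simp add: h_def)
    then show ?thesis using outside[OF False] by simp
  qed
  then show ?thesis unfolding output_distribution_def h_def by simp
qed

text \<open>Couples an extended value with a real bound known to be nonnegative, so that costs can
  be subtracted and compared in the reals.\<close>

definition bounded_by :: "ennreal \<Rightarrow> real \<Rightarrow> bool"  (infix "\<sqsubseteq>" 50) where
  "x \<sqsubseteq> r \<longleftrightarrow> 0 \<le> r \<and> x \<le> ennreal r"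

lemma bounded_by_mono: "x \<sqsubseteq> r \<Longrightarrow> r \<le> r' \<Longrightarrow> x \<sqsubseteq> r'"
  unfolding bounded_by_def by (meson ennreal_leI order_trans)

lemma bounded_by_add: "0 \<le> c \<Longrightarrow> x \<sqsubseteq> r - c \<Longrightarrow> ennreal c + x \<sqsubseteq> r"
proof -
  assume c: "0 \<le> c" and x: "x \<sqsubseteq> r - c"
  then have "ennreal c + x \<le> ennreal c + ennreal (r - c)"
    by (intro add_left_mono) (simp add: bounded_by_def)
  also have "\<dots> = ennreal r" using c x by (simp add: ennreal_plus[symmetric] bounded_by_def del: ennreal_plus)
  finally show ?thesis using c x by (simp add: bounded_by_def)
qed

lemma bounded_by_add_right: "0 \<le> c \<Longrightarrow> x \<sqsubseteq> r \<Longrightarrow> ennreal c + x \<sqsubseteq> c + r"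
  by (rule bounded_by_add) simp_all

lemma bounded_by_eq_trans [trans]: "x = y \<Longrightarrow> y \<sqsubseteq> r \<Longrightarrow> x \<sqsubseteq> r"
  by simp

lemma bounded_by_half: "x \<sqsubseteq> r \<Longrightarrow> y \<sqsubseteq> r' \<Longrightarrow> (x + y) / 2 \<sqsubseteq> (r + r') / 2"
proof -
  assume x: "x \<sqsubseteq> r" and y: "y \<sqsubseteq> r'"
  then have "(x + y) / 2 \<le> (ennreal r + ennreal r') / 2"
    by (intro divide_right_mono_ennreal add_mono) (auto simp: bounded_by_def)
  also have "\<dots> = ennreal ((r + r') / 2)"
    using x y by (simp add: bounded_by_def ennreal_plus[symmetric] ennreal_divide_numeral del: ennreal_plus)
  finally show ?thesis using x y by (simp add: bounded_by_def)
qed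

context machine
begin

text \<open>Park induction: \<open>W\<close> on the invariant, with the top element elsewhere, is a
  prefixed point of the loop functional. The continuation \<open>F\<close> is arbitrary subject to
  its bound, so the body can be analysed without the loop.\<close>

lemma bounded_by_While:
  assumes "Inv s"
    and W: "\<And>s. Inv s \<Longrightarrow> W s \<ge> 0"
    and step: "\<And>s F. Inv s \<Longrightarrow> bval s t \<Longrightarrow> (\<And>s'. Inv s' \<Longrightarrow> F s' \<sqsubseteq> W s') \<Longrightarrow> ert c F s \<sqsubseteq> W s - a"
    and exit: "\<And>s. Inv s \<Longrightarrow> \<not> bval s t \<Longrightarrow> f s \<sqsubseteq> W s - a"
  shows "ert (While t c) f s \<sqsubseteq> W s"
proof -
  define X where "X s = (if Inv s then ennreal (W s) else \<top>)" for s
  have X: "X s \<sqsubseteq> W s" if "Inv s" for s using W[OF that] that by (simp add: X_def bounded_by_def)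
  have "ert (While t c) f \<le> X"
    unfolding ert.simps
  proof (rule lfp_lowerbound, rule le_funI)
    fix s
    show "ennreal a + (if bval s t then ert c X s else f s) \<le> X s"
    proof (cases "Inv s")
      case True
      have "(if bval s t then ert c X s else f s) \<sqsubseteq> W s - a"
        using step[OF True _ X] exit[OF True] by simp
      then have "ennreal a + (if bval s t then ert c X s else f s) \<sqsubseteq> W s"
        by (rule bounded_by_add[OF a])
      then show ?thesis using True by (simp add: bounded_by_def X_def)
    qed (simp add: X_def)
  qed
  then have "ert (While t c) f s \<le> X s" by (rule le_funD)
  then show ?thesis using X[OF \<open>Inv s\<close>] unfolding bounded_by_def by (meson order_trans)
qed

lemma bounded_by_NAssign:
  "f (write_nat x (nval s e) (nval s v) s) \<sqsubseteq> r - a \<Longrightarrow> ert (NAssign x e v) f s \<sqsubseteq> r"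
  by (simp add: bounded_by_add a)

lemma bounded_by_Seq: "ert c (ert d f) s \<sqsubseteq> r - a \<Longrightarrow> ert (Seq c d) f s \<sqsubseteq> r"
  by (simp add: bounded_by_add a)

end

section \<open>Store updates and frame conditions\<close>

lemma store_access [simp]:
  "nats (write_nat x i v s) y = (if y = x then (nats s x)(i := v) else nats s y)"
  "reals (write_nat x i v s) = reals s"
  "reals (write_real x i r s) y = (if y = x then (reals s x)(i := r) else reals s y)"
  "nats (write_real x i r s) = nats s"
  by (simp_all add: write_nat_def write_real_def)

lemma read_set_cong: "nats s x = nats s' x \<Longrightarrow> read_set n x s = read_set n x s'"
  by (simp add: read_set_def)

lemma read_set_write [simp]:
  "read_set n y (write_real x i r s) = read_set n y s"
  "y \<noteq> x \<Longrightarrow> read_set n y (write_nat x i v s) = read_set n y s"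
  "i \<in> {1..n} \<Longrightarrow> read_set n x (write_nat x i v s)
    = (if v = 0 then read_set n x s - {i} else insert i (read_set n x s))"
  by (auto simp: read_set_def)

definition frame :: "nat set \<Rightarrow> nat set \<Rightarrow> store \<Rightarrow> store \<Rightarrow> bool" where
  "frame A B s s' \<longleftrightarrow> (\<forall>x. x \<notin> A \<longrightarrow> nats s' x = nats s x) \<and> (\<forall>x. x \<notin> B \<longrightarrow> reals s' x = reals s x)"

lemma frame_refl [simp]: "frame A B s s"
  by (simp add: frame_def)

lemma frame_trans: "frame A B s s' \<Longrightarrow> frame A B s' s'' \<Longrightarrow> frame A B s s''"
  by (simp add: frame_def)

lemma frame_write [simp]:
  "x \<in> A \<Longrightarrow> frame A B s (write_nat x i v s') \<longleftrightarrow> frame A B s s'"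
  "x \<in> B \<Longrightarrow> frame A B s (write_real x i r s') \<longleftrightarrow> frame A B s s'"
  by (auto simp: frame_def)

lemma frame_nats: "frame A B s s' \<Longrightarrow> x \<notin> A \<Longrightarrow> nats s' x = nats s x"
  and frame_reals: "frame A B s s' \<Longrightarrow> x \<notin> B \<Longrightarrow> reals s' x = reals s x"
  by (simp_all add: frame_def)

abbreviation nv :: "nat \<Rightarrow> nexp" where "nv x \<equiv> NRead x (NConst 0)"
abbreviation rv :: "nat \<Rightarrow> rexp" where "rv x \<equiv> RRead x (NConst 0)"
abbreviation nset :: "nat \<Rightarrow> nexp \<Rightarrow> com" where "nset x e \<equiv> NAssign x (NConst 0) e"
abbreviation rset :: "nat \<Rightarrow> rexp \<Rightarrow> com" where "rset x e \<equiv> RAssign x (NConst 0) e"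
abbreviation sequential :: "com \<Rightarrow> com \<Rightarrow> com" (infixr ";;" 60) where "c ;; d \<equiv> Seq c d"

section \<open>Random numbers from fair coins\<close>

text \<open>Register 13 collects random bits, while register 14, starting at 1, doubles until it
  reaches the bound in register \<open>m\<close>.\<close>

definition draw_loop :: "nat \<Rightarrow> com" where
  "draw_loop m = While (NLess (nv 14) (nv m))
    (Flip 15 (NConst 0) ;; nset 13 (NAdd (NAdd (nv 13) (nv 13)) (nv 15)) ;; nset 14 (NAdd (nv 14) (nv 14)))"

text \<open>Rejection sampling. Register 13 starts at the bound itself, an invalid value that forces
  the first round.\<close>

definition uniform :: "nat \<Rightarrow> com" where
  "uniform m = (nset 13 (nv m) ;;
    While (BNot (NLess (nv 13) (nv m))) (nset 13 (NConst 0) ;; nset 14 (NConst 1) ;; draw_loop m))"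

definition bits :: "nat \<Rightarrow> nat" where
  "bits m = (LEAST l. m \<le> 2 ^ l)"

lemma bits_upper: "m \<le> 2 ^ bits m"
  unfolding bits_def by (rule LeastI[of _ m]) (simp add: less_imp_le)

lemma bits_lower: "e < bits m \<Longrightarrow> 2 ^ e < m"
  unfolding bits_def by (auto dest: not_less_Least)

lemma bits_le: "m \<ge> 1 \<Longrightarrow> 2 ^ bits m \<le> 2 * m"
  using bits_lower[of "bits m - 1" m] by (cases "bits m") auto

lemma bits_mono: "m \<le> m' \<Longrightarrow> bits m \<le> bits m'"
  unfolding bits_def[of m] by (rule Least_le) (use bits_upper[of m'] in simp)

context machine
begin

text \<open>\<open>d\<close> is the number of bits still to be drawn; the two continuations of a
  coin flip take the lower and the upper half of the \<open>2 ^ d\<close> possible suffixes. A round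
  costs 6 commands including the loop test, and the additional \<open>a\<close> is the final
  test.\<close>

lemma bounded_by_draw_loop:
  assumes m: "m \<notin> {13, 14, 15}"
    and "nats s m 0 \<le> nats s 14 0 * 2 ^ d" "\<And>e. e < d \<Longrightarrow> nats s 14 0 * 2 ^ e < nats s m 0"
    and post: "\<And>s'. frame {13, 14, 15} {} s s' \<Longrightarrow> f s' \<sqsubseteq> \<phi> (nats s' 13 0)"
  shows "ert (draw_loop m) f s \<sqsubseteq> a + 6 * a * d + (\<Sum>v<2 ^ d. \<phi> (nats s 13 0 * 2 ^ d + v)) / 2 ^ d"
  using assms(2-)
proof (induction d arbitrary: s)
  case 0
  then have "f s \<sqsubseteq> \<phi> (nats s 13 0)" by simp
  moreover have "\<not> nats s 14 0 < nats s m 0" using 0 by simp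
  ultimately show ?case
    unfolding draw_loop_def by (subst ert_While) (auto intro!: bounded_by_add a)
next
  case (Suc d)
  define u where "u = nats s 13 0"
  define A where "A u = (\<Sum>v<2 ^ d. \<phi> (u * 2 ^ d + v)) / 2 ^ d" for u
  have guard: "nats s 14 0 < nats s m 0" using Suc.prems(2)[of 0] by simp
  have IH: "ert (draw_loop m) f (write_nat 14 0 (nats s 14 0 + nats s 14 0)
      (write_nat 13 0 (u + u + v) (write_nat 15 0 v s))) \<sqsubseteq> a + 6 * a * d + A (u + u + v)" for v
  proof -
    let ?s = "write_nat 14 0 (nats s 14 0 + nats s 14 0) (write_nat 13 0 (u + u + v) (write_nat 15 0 v s))"
    have "ert (draw_loop m) f ?s \<sqsubseteq> a + 6 * a * d
        + (\<Sum>v<2 ^ d. \<phi> (nats ?s 13 0 * 2 ^ d + v)) / 2 ^ d"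
    proof (rule Suc.IH)
      show "nats ?s m 0 \<le> nats ?s 14 0 * 2 ^ d" using m Suc.prems(1) by (simp add: algebra_simps)
      show "nats ?s 14 0 * 2 ^ e < nats ?s m 0" if "e < d" for e
        using m Suc.prems(2)[of "Suc e"] that by (simp add: algebra_simps)
      show "f s' \<sqsubseteq> \<phi> (nats s' 13 0)" if "frame {13, 14, 15} {} ?s s'" for s'
      proof (rule Suc.prems(3))
        have "frame {13, 14, 15} {} s ?s" by simp
        then show "frame {13, 14, 15} {} s s'" using that by (rule frame_trans)
      qed
    qed
    then show ?thesis by (simp add: A_def)
  qed
  have avg: "(\<Sum>v<2 ^ Suc d. \<phi> (u * 2 ^ Suc d + v)) / 2 ^ Suc d = (A (u + u + 1) + A (u + u)) / 2"
  proof -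
    have "(\<Sum>v<2 ^ Suc d. \<phi> (u * 2 ^ Suc d + v))
      = (\<Sum>v<2 ^ d. \<phi> (u * 2 ^ Suc d + v)) + (\<Sum>v\<in>{2 ^ d..<2 ^ d + 2 ^ d}. \<phi> (u * 2 ^ Suc d + v))"
      by (subst sum.union_disjoint[symmetric]) (auto intro!: sum.cong)
    also have "(\<Sum>v\<in>{2 ^ d..<2 ^ d + 2 ^ d}. \<phi> (u * 2 ^ Suc d + v)) = (\<Sum>v<2 ^ d. \<phi> (u * 2 ^ Suc d + (2 ^ d + v)))"
      by (rule sum.reindex_bij_witness[where i = "\<lambda>v. 2 ^ d + v" and j = "\<lambda>v. v - 2 ^ d"]) auto
    finally have "(\<Sum>v<2 ^ Suc d. \<phi> (u * 2 ^ Suc d + v))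
      = (\<Sum>v<2 ^ d. \<phi> ((u + u) * 2 ^ d + v)) + (\<Sum>v<2 ^ d. \<phi> ((u + u + 1) * 2 ^ d + v))"
      by (simp add: algebra_simps mult_2[symmetric])
    then show ?thesis by (simp only: A_def) (simp add: field_simps)
  qed
  have "ert (Flip 15 (NConst 0) ;; nset 13 (NAdd (NAdd (nv 13) (nv 13)) (nv 15)) ;; nset 14 (NAdd (nv 14) (nv 14)))
      (ert (draw_loop m) f) s \<sqsubseteq> 6 * a + 6 * a * d + (A (u + u + 1) + A (u + u)) / 2"
    apply (simp add: u_def[symmetric])
    apply (rule bounded_by_mono, (rule bounded_by_add_right[OF a] bounded_by_half IH[of 1, simplified] IH[of 0, simplified])+)
    apply (simp add: field_simps)
    done
  then have "ert (draw_loop m) f s \<sqsubseteq> a + (6 * a + 6 * a * d + (A (u + u + 1) + A (u + u)) / 2)"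
    unfolding draw_loop_def by (subst ert_While, subst if_P) (use guard a in \<open>simp_all only: bval.simps nval.simps bounded_by_add_right\<close>)
  then show ?case unfolding u_def[symmetric] avg by (simp add: algebra_simps)
qed

lemma bounded_by_uniform:
  assumes m: "m \<notin> {13, 14, 15}" and M: "nats s m 0 = M" "M \<ge> 1"
    and g: "\<And>v. v < M \<Longrightarrow> g v \<ge> 0"
    and post: "\<And>s' v. frame {13, 14, 15} {} s s' \<Longrightarrow> v < M \<Longrightarrow> nats s' 13 0 = v \<Longrightarrow> f s' \<sqsubseteq> g v"
    and r: "15 * a * (bits M + 1) + (\<Sum>v<M. g v) / M \<le> r"
  shows "ert (uniform m) f s \<sqsubseteq> r"
proof -
  define avg where "avg = (\<Sum>v<M. g v) / M"
  define d where "d = bits M"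
  \<comment> \<open>A round costs \<open>6 * a * (d + 1)\<close> and succeeds with probability at
    least 1/2 because \<open>2 ^ d \<le> 2 * M\<close>, hence the factor 12; the single
    \<open>a\<close> is the exit test.\<close>
  define W0 where "W0 = 12 * a * (d + 1) + a + avg"
  define W where "W s' = (if nats s' 13 0 < M then a + g (nats s' 13 0) else W0)" for s' :: store
  have avg0: "avg \<ge> 0" unfolding avg_def using g by (intro divide_nonneg_nonneg sum_nonneg) auto
  have d: "M \<le> 2 ^ d" "\<And>e. e < d \<Longrightarrow> 2 ^ e < M" "2 ^ d \<le> 2 * M"
    unfolding d_def using bits_upper bits_lower bits_le M by auto
  have W0: "W0 \<ge> 0" using avg0 a by (simp add: W0_def)
  have loop: "ert (While (BNot (NLess (nv 13) (nv m))) (nset 13 (NConst 0) ;; nset 14 (NConst 1) ;; draw_loop m)) f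
      (write_nat 13 0 M s) \<sqsubseteq> W (write_nat 13 0 M s)"
  proof (rule bounded_by_While[where Inv = "frame {13, 14, 15} {} s"])
    show "frame {13, 14, 15} {} s (write_nat 13 0 M s)" by simp
    show "W s' \<ge> 0" for s' using W0 g a by (simp add: W_def)
    show "f s' \<sqsubseteq> W s' - a" if "frame {13, 14, 15} {} s s'" "\<not> bval s' (BNot (NLess (nv 13) (nv m)))" for s'
      using that frame_nats[OF that(1) m] M post[OF that(1)] by (simp add: W_def)
    fix s' F
    assume s': "frame {13, 14, 15} {} s s'" "bval s' (BNot (NLess (nv 13) (nv m)))"
      and F: "\<And>s''. frame {13, 14, 15} {} s s'' \<Longrightarrow> F s'' \<sqsubseteq> W s''"
    let ?s = "write_nat 14 0 1 (write_nat 13 0 0 s')"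
    define \<phi> where "\<phi> v = (if v < M then a + g v else W0)" for v
    have m': "nats s' m 0 = M" using frame_nats[OF s'(1) m] M by simp
    have draw: "ert (draw_loop m) F ?s \<sqsubseteq> a + 6 * a * d + (\<Sum>v<2 ^ d. \<phi> (nats ?s 13 0 * 2 ^ d + v)) / 2 ^ d"
    proof (rule bounded_by_draw_loop[OF m])
      show "nats ?s m 0 \<le> nats ?s 14 0 * 2 ^ d" using m m' d by simp
      show "e < d \<Longrightarrow> nats ?s 14 0 * 2 ^ e < nats ?s m 0" for e using m m' d by simp
      fix s'' assume "frame {13, 14, 15} {} ?s s''"
      moreover have "frame {13, 14, 15} {} s ?s" using s'(1) by simp
      ultimately have "frame {13, 14, 15} {} s s''" by (rule frame_trans[rotated])
      then show "F s'' \<sqsubseteq> \<phi> (nats s'' 13 0)" using F by (simp add: W_def \<phi>_def)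
    qed
    have sum_\<phi>: "(\<Sum>v<2 ^ d. \<phi> v) = M * a + (\<Sum>v<M. g v) + (2 ^ d - real M) * W0"
    proof -
      have "(\<Sum>v<2 ^ d. \<phi> v) = sum \<phi> ({..<M} \<union> {M..<2 ^ d})"
        using d(1) by (intro sum.cong) auto
      also have "\<dots> = (\<Sum>v<M. \<phi> v) + (\<Sum>v\<in>{M..<2 ^ d}. \<phi> v)"
        by (rule sum.union_disjoint) auto
      also have "(\<Sum>v<M. \<phi> v) = M * a + (\<Sum>v<M. g v)" by (simp add: \<phi>_def sum.distrib)
      also have "(\<Sum>v\<in>{M..<2 ^ d}. \<phi> v) = (2 ^ d - real M) * W0" using d by (simp add: \<phi>_def of_nat_diff)
      finally show ?thesis .
    qed
    have sum_g: "(\<Sum>v<M. g v) = M * avg" using M by (simp add: avg_def)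
    have 1: "ert (draw_loop m) F ?s \<sqsubseteq> a + 6 * a * d + (M * a + M * avg + (2 ^ d - real M) * W0) / 2 ^ d"
      using draw by (simp add: sum_\<phi> sum_g)
    have "6 * a * (d + 1) * 2 ^ d \<le> 6 * a * (d + 1) * (2 * real M)"
    proof (rule mult_left_mono)
      have "real (2 ^ d) \<le> real (2 * M)" using d(3) by (intro of_nat_mono)
      then show "2 ^ d \<le> 2 * real M" by simp
    qed (use a in simp)
    also have "\<dots> = M * (W0 - a - avg)" by (simp add: W0_def)
    finally have "(6 * a * (d + 1) * 2 ^ d + (M * a + M * avg + (2 ^ d - real M) * W0)) / 2 ^ d \<le> W0"
      by (simp add: divide_le_eq algebra_simps)
    then have "6 * a * (d + 1) + (M * a + M * avg + (2 ^ d - real M) * W0) / 2 ^ d \<le> W0"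
      by (simp add: add_divide_distrib)
    then have 2: "ert (draw_loop m) F ?s \<sqsubseteq> W0 - 5 * a"
      by (intro bounded_by_mono[OF 1]) (simp add: algebra_simps)
    have "W s' = W0" using s'(2) m' by (simp add: W_def)
    then show "ert (nset 13 (NConst 0) ;; nset 14 (NConst 1) ;; draw_loop m) F s' \<sqsubseteq> W s' - a"
      by (intro bounded_by_Seq bounded_by_NAssign) (use 2 in \<open>simp add: algebra_simps\<close>)
  qed
  have "W (write_nat 13 0 M s) = W0" by (simp add: W_def)
  moreover have "W0 \<le> r - a - a"
  proof -
    have "a * d \<ge> 0" using a by simp
    moreover have "15 * (a * d) + 15 * a + avg \<le> r" using r by (simp add: algebra_simps avg_def d_def)
    moreover have "W0 = 12 * (a * d) + 13 * a + avg" by (simp add: W0_def algebra_simps)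
    ultimately show ?thesis by linarith
  qed
  ultimately have "ert (While (BNot (NLess (nv 13) (nv m))) (nset 13 (NConst 0) ;; nset 14 (NConst 1) ;; draw_loop m)) f
      (write_nat 13 0 M s) \<sqsubseteq> r - a - a"
    using loop by (auto intro: bounded_by_mono)
  then show ?thesis
    unfolding uniform_def by (intro bounded_by_Seq bounded_by_NAssign) (simp add: M)
qed

end

text \<open>The bits of \<open>p\<close> are produced one by one; a fair coin stops at each of them with
  probability 1/2.\<close>

definition bernoulli :: com where
  "bernoulli = (nset 20 (NConst 0) ;;
    While (NLess (nv 20) (NConst 1))
      (Flip 20 (NConst 0) ;; rset 6 (RAdd (rv 6) (rv 6)) ;;
       Cond (RLess (rv 6) (ROfNat (NConst 1))) (nset 21 (NConst 0))
         (nset 21 (NConst 1) ;; rset 6 (RSub (rv 6) (ROfNat (NConst 1))))))"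

context machine
begin

lemma bounded_by_bernoulli:
  assumes p: "0 \<le> reals s 6 0" "reals s 6 0 \<le> 1"
    and g: "g0 \<ge> 0" "g1 \<ge> 0"
    and post0: "\<And>s'. frame {20, 21} {6} s s' \<Longrightarrow> nats s' 21 0 = 0 \<Longrightarrow> f s' \<sqsubseteq> g0"
    and post1: "\<And>s'. frame {20, 21} {6} s s' \<Longrightarrow> nats s' 21 0 = 1 \<Longrightarrow> f s' \<sqsubseteq> g1"
    and r: "21 * a + (reals s 6 0 * g1 + (1 - reals s 6 0) * g0) \<le> r"
  shows "ert bernoulli f s \<sqsubseteq> r"
proof -
  \<comment> \<open>19 solves \<open>c = 9 + (1 + c) / 2\<close>: the longer branch takes 9 commands
    with the loop test, after which there is either the exit test or another round.\<close>
  define W where "W s' = (if nats s' 20 0 < 1 then 19 * a + (reals s' 6 0 * g1 + (1 - reals s' 6 0) * g0)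
    else a + (if nats s' 21 0 = 0 then g0 else g1))" for s' :: store
  define Inv where "Inv s' \<longleftrightarrow> frame {20, 21} {6} s s' \<and> 0 \<le> reals s' 6 0 \<and> reals s' 6 0 \<le> 1 \<and>
    (nats s' 20 0 \<ge> 1 \<longrightarrow> nats s' 21 0 \<in> {0, 1})" for s'
  have "ert (While (NLess (nv 20) (NConst 1))
      (Flip 20 (NConst 0) ;; rset 6 (RAdd (rv 6) (rv 6)) ;;
       Cond (RLess (rv 6) (ROfNat (NConst 1))) (nset 21 (NConst 0))
         (nset 21 (NConst 1) ;; rset 6 (RSub (rv 6) (ROfNat (NConst 1)))))) f (write_nat 20 0 0 s)
    \<sqsubseteq> W (write_nat 20 0 0 s)"
  proof (rule bounded_by_While[where Inv = Inv])
    show "Inv (write_nat 20 0 0 s)" using p by (simp add: Inv_def)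
    show "W s' \<ge> 0" if "Inv s'" for s' using that g a by (simp add: W_def Inv_def)
    show "f s' \<sqsubseteq> W s' - a" if "Inv s'" "\<not> bval s' (NLess (nv 20) (NConst 1))" for s'
      using that post0[of s'] post1[of s'] by (auto simp: W_def Inv_def)
    fix s' F
    assume s': "Inv s'" "bval s' (NLess (nv 20) (NConst 1))" and F: "\<And>s''. Inv s'' \<Longrightarrow> F s'' \<sqsubseteq> W s''"
    define x where "x = reals s' 6 0"
    have x: "0 \<le> x" "x \<le> 1" and fr: "frame {20, 21} {6} s s'" using s' by (auto simp: Inv_def x_def)
    have Wx: "W s' = 19 * a + (x * g1 + (1 - x) * g0)" using s'(2) by (simp add: W_def x_def)
    show "ert (Flip 20 (NConst 0) ;; rset 6 (RAdd (rv 6) (rv 6)) ;;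
       Cond (RLess (rv 6) (ROfNat (NConst 1))) (nset 21 (NConst 0))
         (nset 21 (NConst 1) ;; rset 6 (RSub (rv 6) (ROfNat (NConst 1))))) F s' \<sqsubseteq> W s' - a"
    proof (cases "x + x < 1")
      case True
      let ?s = "\<lambda>v. write_nat 21 0 0 (write_real 6 0 (x + x) (write_nat 20 0 v s'))"
      have 1: "F (?s 1) \<sqsubseteq> a + g0"
        using F[of "?s 1"] True x fr by (simp add: Inv_def W_def)
      have 0: "F (?s 0) \<sqsubseteq> 19 * a + ((x + x) * g1 + (1 - (x + x)) * g0)"
        using F[of "?s 0"] True x fr by (simp add: Inv_def W_def)
      show ?thesis
        using True apply (simp add: x_def[symmetric])
        apply (rule bounded_by_mono, (rule bounded_by_add_right[OF a] bounded_by_half 1[simplified] 0[simplified])+)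
        apply (use a in \<open>simp add: Wx field_simps\<close>)
        done
    next
      case False
      let ?s = "\<lambda>v. write_real 6 0 (x + x - 1) (write_nat 21 0 1 (write_real 6 0 (x + x) (write_nat 20 0 v s')))"
      have 1: "F (?s 1) \<sqsubseteq> a + g1"
        using F[of "?s 1"] False x fr by (simp add: Inv_def W_def)
      have 0: "F (?s 0) \<sqsubseteq> 19 * a + ((x + x - 1) * g1 + (1 - (x + x - 1)) * g0)"
        using F[of "?s 0"] False x fr by (simp add: Inv_def W_def)
      show ?thesis
        using False apply (simp add: x_def[symmetric])
        apply (rule bounded_by_mono, (rule bounded_by_add_right[OF a] bounded_by_half 1[simplified] 0[simplified])+)
        apply (use a in \<open>simp add: Wx field_simps\<close>)
        done
    qed
  qed
  moreover have "W (write_nat 20 0 0 s) \<le> r - a - a" using r by (simp add: W_def)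
  ultimately show ?thesis
    unfolding bernoulli_def by (intro bounded_by_Seq bounded_by_NAssign) (auto intro: bounded_by_mono)
qed

end

section \<open>One step of the chain\<close>

text \<open>Array 1 holds the current set, array 2 lists its elements from index 1 on, and array 3
  its cardinality.\<close>

definition propose :: com where
  "propose = (nset 18 (NRead 2 (NAdd (nv 13) (NConst 1))) ;; Flip 17 (NConst 0) ;;
    Cond (NLess (NConst 0) (nv 17)) (rset 6 (RDiv (ROfNat (NConst 1)) (rv 2)))
     (NAssign 1 (nv 18) (NConst 0) ;; QueryRank 24 (NConst 0) 1 ;; NAssign 1 (nv 18) (NConst 1) ;;
      Cond (NLess (nv 24) (nv 23)) (rset 6 (RDiv (rv 0) (RMul (RRead 1 (nv 18)) (rv 2))))
        (rset 6 (RDiv (ROfNat (NConst 1)) (RMul (RRead 1 (nv 18)) (rv 2))))) ;;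
    bernoulli)"

definition accept_loop :: com where
  "accept_loop = While (NLess (nv 21) (NConst 1)) (uniform 3 ;; propose)"

text \<open>Register 23 caches the rank of the enlarged set, so a trial needs at most one query. On
  acceptance registers 13 and 18 still hold the index and the element, so a removal takes constantly
  many commands.\<close>

definition chain_iteration :: com where
  "chain_iteration = (uniform 0 ;; nset 9 (NAdd (nv 13) (NConst 1)) ;;
    Cond (NLess (NConst 0) (NRead 1 (nv 9))) Skip
      (NAssign 1 (nv 9) (NConst 1) ;; nset 3 (NAdd (nv 3) (NConst 1)) ;; NAssign 2 (nv 3) (nv 9)) ;;
    QueryRank 23 (NConst 0) 1 ;; nset 21 (NConst 0) ;; accept_loop ;;
    Cond (NLess (NConst 0) (nv 17)) Skip
      (NAssign 1 (nv 18) (NConst 0) ;; NAssign 2 (NAdd (nv 13) (NConst 1)) (NRead 2 (nv 3)) ;;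
       nset 3 (NSub (nv 3) (NConst 1))))"

definition chain_loop :: com where
  "chain_loop = While (NLess (NConst 0) (nv 4)) (chain_iteration ;; nset 4 (NSub (nv 4) (NConst 1)))"

text \<open>Deletion from an unordered list: the last entry moves into the gap. If the gap is the
  last position itself, the shortened index range hides it.\<close>

lemma bij_betw_remove_last:
  assumes L: "bij_betw L {..<card S} S" and p: "p < card S"
  shows "bij_betw (\<lambda>i. if i = p then L (card S - 1) else L i) {..<card S - 1} (S - {L p})"
proof -
  let ?f = "\<lambda>i. if i = p then L (card S - 1) else L i"
  have fin: "finite S" using p by (metis card.infinite not_less0)
  have inj: "L i = L k \<longleftrightarrow> i = k" if "i < card S" "k < card S" for i k
    using L that by (auto simp: bij_betw_def inj_on_def)
  have mem: "L i \<in> S" if "i < card S" for i using L that by (auto simp: bij_betw_def)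
  have inj_f: "inj_on ?f {..<card S - 1}"
  proof (rule inj_onI)
    fix i k assume "i \<in> {..<card S - 1}" "k \<in> {..<card S - 1}" and eq: "?f i = ?f k"
    then have "i < card S" "k < card S" "card S - 1 < card S" "i \<noteq> card S - 1" "k \<noteq> card S - 1" by auto
    then show "i = k" using eq inj by (cases "i = p"; cases "k = p") auto
  qed
  have "?f ` {..<card S - 1} = S - {L p}"
  proof (rule card_subset_eq)
    show "?f ` {..<card S - 1} \<subseteq> S - {L p}"
    proof (rule image_subsetI)
      fix i assume "i \<in> {..<card S - 1}"
      then have "i < card S" "card S - 1 < card S" "i \<noteq> card S - 1" by auto
      then show "?f i \<in> S - {L p}" using mem inj p by (cases "i = p") auto
    qed
    show "card (?f ` {..<card S - 1}) = card (S - {L p})"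
      unfolding card_image[OF inj_f] using mem[OF p] fin by simp
  qed (use fin in simp)
  with inj_f show ?thesis unfolding bij_betw_def by blast
qed

lemma bij_betw_append:
  assumes L: "bij_betw L {..<card S} S" and u: "u \<notin> S" "finite S"
  shows "bij_betw (\<lambda>i. if i = card S then u else L i) {..<card (insert u S)} (insert u S)"
proof -
  have "{..<card (insert u S)} = insert (card S) {..<card S}" using u by auto
  moreover have "bij_betw (\<lambda>i. if i = card S then u else L i) {..<card S} S"
    using L by (rule bij_betw_cong[THEN iffD1, rotated]) auto
  ultimately show ?thesis
    using notIn_Un_bij_betw[of "card S" "{..<card S}" "\<lambda>i. if i = card S then u else L i" S] u by simp
qed

text \<open>A trial succeeds with probability \<open>T / (2 * B * M)\<close>, at least
  \<open>1 / (2 * B)\<close>. Each success replaces \<open>K\<close> by a value of mean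
  \<open>U\<close>, and the gain \<open>K - U = 2 * B * C\<close> pays for the cost \<open>C\<close>
  of a trial.\<close>

lemma acceptance_arithmetic:
  fixes B a b C K M T U x :: real
  assumes "B \<ge> 1" "a \<ge> 0" "C \<ge> 0" "M \<ge> 0" "M \<le> T" "K = 2 * B * C + U"
  shows "M * (35 * a + b + K + (a / B + (x - K) / B) / 2) + M * (a / 2) + (T * U - M * x - (T - M) * K) / (2 * B)
    \<le> M * (36 * a + b + K - C)"
proof -
  define c where "c = 1 / (2 * B)"
  have c: "y / B = 2 * (c * y)" "y / (2 * B) = c * y" for y by (simp_all add: c_def)
  have cB: "c * (2 * B * C) = C" using assms(1) by (simp add: c_def)
  have "M * (35 * a + b + K + (a / B + (x - K) / B) / 2) + M * (a / 2) + (T * U - M * x - (T - M) * K) / (2 * B)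
    = M * (35 * a + b + K) + M * (c * a) + M * (a / 2) - T * (c * (K - U))"
    unfolding c by (simp add: field_simps)
  also have "c * (K - U) = C" using assms(6) cB by simp
  also have "M * (35 * a + b + K) + M * (c * a) + M * (a / 2) - T * C
     \<le> M * (35 * a + b + K) + M * (a / 2) + M * (a / 2) - M * C"
  proof -
    have "c * a \<le> 1 / 2 * a" using assms by (intro mult_right_mono) (auto simp: c_def field_simps)
    then have "M * (c * a) \<le> M * (a / 2)" using assms by (intro mult_left_mono) auto
    moreover have "M * C \<le> T * C" using assms by (intro mult_right_mono)
    ultimately show ?thesis by linarith
  qed
  also have "\<dots> = M * (36 * a + b + K - C)" by (simp add: algebra_simps)
  finally show ?thesis .
qed

locale cluster_machine = cluster_model n rk q lam + machine n rk a b
  for n rk q lam a b +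
  fixes B :: real
  assumes B: "B \<ge> 1" "i \<in> {1..n} \<Longrightarrow> 1 / lam i \<le> B"
begin

definition good :: "nat set \<Rightarrow> store \<Rightarrow> bool" where
  "good S s \<longleftrightarrow> read_set n 1 s = S \<and> nats s 3 0 = card S \<and>
    bij_betw (\<lambda>p. nats s 2 (Suc p)) {..<card S} S \<and> nats s 0 0 = n \<and>
    reals s 0 0 = q \<and> reals s 2 0 = B \<and> (\<forall>i\<in>ground. reals s 1 i = lam i)"

lemma good_subset: "good S s \<Longrightarrow> S \<subseteq> ground"
  by (auto simp: good_def read_set_def)

lemma good_frame: "good S s \<Longrightarrow> frame A R s s' \<Longrightarrow> A \<inter> {0, 1, 2, 3} = {} \<Longrightarrow> R \<inter> {0, 1, 2} = {} \<Longrightarrow> good S s'"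
proof -
  assume "good S s" and fr: "frame A R s s'" and "A \<inter> {0, 1, 2, 3} = {}" "R \<inter> {0, 1, 2} = {}"
  then have "nats s' 0 = nats s 0" "nats s' 1 = nats s 1" "nats s' 2 = nats s 2" "nats s' 3 = nats s 3"
    "reals s' 0 = reals s 0" "reals s' 1 = reals s 1" "reals s' 2 = reals s 2"
    by (auto intro!: frame_nats[OF fr] frame_reals[OF fr])
  moreover from this have "read_set n 1 s' = read_set n 1 s" by (intro read_set_cong)
  ultimately show ?thesis using \<open>good S s\<close> by (simp add: good_def)
qed

definition accept_cost :: real where
  "accept_cost = 15 * a * (bits n + 1) + 40 * a + b"

definition iteration_cost :: real where
  "iteration_cost = 15 * a * (bits n + 1) + 30 * a + b + 2 * B * accept_cost"

lemma accept_cost_nonneg: "accept_cost \<ge> 0"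
  using a b by (simp add: accept_cost_def)

lemma iteration_cost_nonneg: "iteration_cost \<ge> 0"
  using a b B accept_cost_nonneg by (simp add: iteration_cost_def)

lemma ratio_le: "S \<subseteq> ground \<Longrightarrow> j \<in> S \<Longrightarrow> ratio S j / B \<le> 1"
proof -
  assume S: "S \<subseteq> ground" and j: "j \<in> S"
  then have "lam j > 0" "1 / lam j \<le> B" using lam B(2) by auto
  then have "q ^ (rk S - rk (S - {j})) / lam j \<le> 1 / lam j"
    using q by (intro divide_right_mono power_le_one) auto
  also have "\<dots> \<le> B" by fact
  finally have "ratio S j \<le> B" unfolding ratio_def .
  then show ?thesis using B(1) by (simp add: divide_le_eq)
qed

lemma ratio_cases:
  "ratio S j / B = (if rk (S - {j}) < rk S then q / (lam j * B) else 1 / (lam j * B))"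
  using rk_remove[of S j] by (cases "rk (S - {j}) < rk S") (auto simp: ratio_def le_Suc_eq)

lemma bounded_by_propose:
  assumes good: "good S s" and v: "nats s 13 0 = v" "v < card S" and r1: "nats s 23 0 = rk S" and N: "nats s 4 0 = N"
    and j: "j = nats s 2 (Suc v)"
    and gs: "x \<ge> 0" "y \<ge> 0" "w \<ge> 0"
    and stay: "\<And>s'. good S s' \<Longrightarrow> nats s' 23 0 = rk S \<Longrightarrow> nats s' 4 0 = N \<Longrightarrow>
        nats s' 21 0 = 1 \<Longrightarrow> nats s' 17 0 = 1 \<Longrightarrow> F s' \<sqsubseteq> x"
    and remove: "\<And>s'. good S s' \<Longrightarrow> nats s' 23 0 = rk S \<Longrightarrow> nats s' 4 0 = N \<Longrightarrow>
        nats s' 21 0 = 1 \<Longrightarrow> nats s' 17 0 = 0 \<Longrightarrow> nats s' 13 0 = v \<Longrightarrow> nats s' 18 0 = j \<Longrightarrow>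
        nats s' 2 (Suc v) = j \<Longrightarrow> F s' \<sqsubseteq> y"
    and reject: "\<And>s'. good S s' \<Longrightarrow> nats s' 23 0 = rk S \<Longrightarrow> nats s' 4 0 = N \<Longrightarrow> nats s' 21 0 = 0 \<Longrightarrow> F s' \<sqsubseteq> w"
  shows "ert propose F s \<sqsubseteq> 35 * a + b + ((1 / B * x + (1 - 1 / B) * w)
    + (ratio S j / B * y + (1 - ratio S j / B) * w)) / 2"
proof -
  define p where "p = ratio S j / B"
  have "j \<in> S" using good v(2) unfolding j good_def by (auto simp: bij_betw_def)
  then have S: "S \<subseteq> ground" "j \<in> S" "j \<in> ground" using good_subset[OF good] by auto
  then have p: "0 \<le> p" "p \<le> 1" using ratio_nonneg[of S j] ratio_le[of S j] B by (auto simp: p_def)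
  have goods: "nats s 0 0 = n" "reals s 0 0 = q" "reals s 2 0 = B" "reals s 1 j = lam j" "read_set n 1 s = S"
    "nats s 3 0 = card S" "bij_betw (\<lambda>p. nats s 2 (Suc p)) {..<card S} S" "\<And>i. i \<in> ground \<Longrightarrow> reals s 1 i = lam i"
    using good S by (auto simp: good_def)
  let ?s1 = "write_real 6 0 (1 / B) (write_nat 17 0 1 (write_nat 18 0 j s))"
  \<comment> \<open>The element is taken out of array 1 only for the query and is put back before
    the trial is decided.\<close>
  let ?s0 = "write_real 6 0 p (write_nat 1 j 1 (write_nat 24 0 (rk (S - {j}))
      (write_nat 1 j 0 (write_nat 17 0 0 (write_nat 18 0 j s)))))"
  have good1: "good S ?s1" using goods by (simp add: good_def)
  have good0: "good S ?s0" using goods S by (simp add: good_def insert_absorb)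
  have keep: "good S s'" "nats s' 23 0 = rk S" "nats s' 4 0 = N" "nats s' 17 = nats t 17"
      "nats s' 13 = nats t 13" "nats s' 18 = nats t 18" "nats s' 2 = nats t 2"
    if fr: "frame {20, 21} {6} t s'" and t: "good S t" "nats t 23 0 = rk S" "nats t 4 0 = N" for t s'
  proof -
    show "good S s'" by (rule good_frame[OF t(1) fr]) auto
    show "nats s' 23 0 = rk S" using frame_nats[OF fr, of 23] t(2) by simp
    show "nats s' 4 0 = N" using frame_nats[OF fr, of 4] t(3) by simp
    show "nats s' 17 = nats t 17" "nats s' 13 = nats t 13" "nats s' 18 = nats t 18" "nats s' 2 = nats t 2"
      by (rule frame_nats[OF fr]; simp)+
  qed
  have k1: "nats ?s1 23 0 = rk S" "nats ?s1 4 0 = N" "nats ?s1 17 0 = 1" using r1 N by simp_all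
  have k0: "nats ?s0 23 0 = rk S" "nats ?s0 4 0 = N" "nats ?s0 17 0 = 0" "nats ?s0 13 0 = v" "nats ?s0 18 0 = j"
    "nats ?s0 2 (Suc v) = j" using r1 N v j by simp_all
  have 1: "ert bernoulli F ?s1 \<sqsubseteq> 21 * a + (1 / B * x + (1 - 1 / B) * w)"
  proof (rule bounded_by_bernoulli[OF _ _ gs(3) gs(1)])
    show "F s' \<sqsubseteq> w" if "frame {20, 21} {6} ?s1 s'" "nats s' 21 0 = 0" for s'
      by (rule reject[OF keep(1-3)[OF that(1) good1 k1(1,2)] that(2)])
    show "F s' \<sqsubseteq> x" if "frame {20, 21} {6} ?s1 s'" "nats s' 21 0 = 1" for s'
      by (rule stay[OF keep(1-3)[OF that(1) good1 k1(1,2)] that(2)])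
        (simp only: keep(4)[OF that(1) good1 k1(1,2)] k1(3))
  qed (use B(1) in simp_all)
  have 0: "ert bernoulli F ?s0 \<sqsubseteq> 21 * a + (p * y + (1 - p) * w)"
  proof (rule bounded_by_bernoulli[OF _ _ gs(3) gs(2)])
    show "F s' \<sqsubseteq> w" if "frame {20, 21} {6} ?s0 s'" "nats s' 21 0 = 0" for s'
      by (rule reject[OF keep(1-3)[OF that(1) good0 k0(1,2)] that(2)])
    show "F s' \<sqsubseteq> y" if "frame {20, 21} {6} ?s0 s'" "nats s' 21 0 = 1" for s'
      by (rule remove[OF keep(1-3)[OF that(1) good0 k0(1,2)] that(2)])
        (simp_all only: keep(4-7)[OF that(1) good0 k0(1,2)] k0(3-6))
  qed (use p in simp_all)
  have ab: "0 \<le> a + b" using a b by simp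
  have rank: "rk (S - {j}) < rk S \<Longrightarrow> p = q / (lam j * B)" "\<not> rk (S - {j}) < rk S \<Longrightarrow> p = 1 / (lam j * B)"
    by (simp_all add: p_def ratio_cases)
  let ?C = "Cond (NLess (NConst 0) (nv 17)) (rset 6 (RDiv (ROfNat (NConst 1)) (rv 2)))
     (NAssign 1 (nv 18) (NConst 0) ;; QueryRank 24 (NConst 0) 1 ;; NAssign 1 (nv 18) (NConst 1) ;;
      Cond (NLess (nv 24) (nv 23)) (rset 6 (RDiv (rv 0) (RMul (RRead 1 (nv 18)) (rv 2))))
        (rset 6 (RDiv (ROfNat (NConst 1)) (RMul (RRead 1 (nv 18)) (rv 2)))))"
  have C1: "ert ?C (ert bernoulli F) (write_nat 17 0 1 (write_nat 18 0 j s)) \<sqsubseteq> 23 * a + (1 / B * x + (1 - 1 / B) * w)"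
  proof -
    have "ert ?C (ert bernoulli F) (write_nat 17 0 1 (write_nat 18 0 j s)) = ennreal a + (ennreal a + ert bernoulli F ?s1)"
      by (simp add: goods)
    also have "\<dots> \<sqsubseteq> a + (a + (21 * a + (1 / B * x + (1 - 1 / B) * w)))"
      by (intro bounded_by_add_right a 1)
    finally show ?thesis by (simp add: algebra_simps)
  qed
  have C0: "ert ?C (ert bernoulli F) (write_nat 17 0 0 (write_nat 18 0 j s)) \<sqsubseteq> 30 * a + b + (p * y + (1 - p) * w)"
  proof -
    have "ert ?C (ert bernoulli F) (write_nat 17 0 0 (write_nat 18 0 j s))
      = ennreal a + (ennreal a + (ennreal a + (ennreal a + (ennreal (a + b) + (ennreal a + (ennreal a +
         (ennreal a + (ennreal a + ert bernoulli F ?s0))))))))"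
    proof (cases "rk (S - {j}) < rk S")
      case True
      then show ?thesis using S by (simp add: goods r1 rank(1)[OF True] insert_absorb)
    next
      case False
      then show ?thesis using S by (simp add: goods r1 rank(2)[OF False] insert_absorb)
    qed
    also have "\<dots> \<sqsubseteq> a + (a + (a + (a + ((a + b) + (a + (a + (a + (a + (21 * a + (p * y + (1 - p) * w))))))))))"
      by (intro bounded_by_add_right a ab 0)
    finally show ?thesis by (simp add: algebra_simps)
  qed
  have eq: "ert propose F s = ennreal a + (ennreal a + (ennreal a + (ennreal a +
     ((ennreal a + ert ?C (ert bernoulli F) (write_nat 17 0 1 (write_nat 18 0 j s)))
      + (ennreal a + ert ?C (ert bernoulli F) (write_nat 17 0 0 (write_nat 18 0 j s)))) / 2)))"
    unfolding propose_def ert.simps(4,6) ert.simps(2)[of 18] by (simp add: v j Suc_eq_plus1 del: ert.simps)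
  have le: "a + (a + (a + (a + ((a + (23 * a + X)) + (a + (30 * a + b + Y))) / 2))) \<le> 35 * a + b + (X + Y) / 2" for X Y
    using a b by (simp add: field_simps)
  show ?thesis
    unfolding eq p_def[symmetric]
    by (rule bounded_by_mono[OF _ le]) (rule bounded_by_add_right[OF a] bounded_by_half C1 C0)+
qed

lemma bounded_by_accept_loop:
  assumes good: "good S s" "S \<noteq> {}" and r1: "nats s 23 0 = rk S" and N: "nats s 4 0 = N" and bit: "nats s 21 0 = 0"
    and g: "\<And>X. X \<subseteq> ground \<Longrightarrow> g X \<ge> 0"
    and stay: "\<And>s'. good S s' \<Longrightarrow> nats s' 4 0 = N \<Longrightarrow> nats s' 17 0 = 1 \<Longrightarrow> f s' \<sqsubseteq> g S"
    and remove: "\<And>s' v. good S s' \<Longrightarrow> nats s' 4 0 = N \<Longrightarrow> nats s' 17 0 = 0 \<Longrightarrow> v < card S \<Longrightarrow> nats s' 13 0 = v \<Longrightarrow>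
        nats s' 18 0 = nats s' 2 (Suc v) \<Longrightarrow> f s' \<sqsubseteq> g (S - {nats s' 2 (Suc v)})"
  shows "ert accept_loop f s \<sqsubseteq> 2 * B * accept_cost + up_mean g S"
proof -
  have S: "S \<subseteq> ground" "finite S" using good_subset[OF good(1)] finite_subset by auto
  define M where "M = card S"
  have "M > 0" using S good(2) by (simp add: M_def card_gt_0_iff)
  then have M: "M \<ge> 1" "M \<le> n" using S card_mono[of ground S] by (auto simp: M_def)
  define K where "K = 2 * B * accept_cost + up_mean g S"
  define Inv where "Inv s' \<longleftrightarrow> good S s' \<and> nats s' 23 0 = rk S \<and> nats s' 4 0 = N \<and>
    (nats s' 21 0 = 0 \<or> nats s' 21 0 = 1 \<and> (nats s' 17 0 = 1 \<or> nats s' 17 0 = 0 \<and> nats s' 13 0 < M \<and>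
      nats s' 18 0 = nats s' 2 (Suc (nats s' 13 0))))" for s'
  \<comment> \<open>Register 21 is the acceptance flag. Before acceptance the value is the fixed
    point \<open>K\<close>, afterwards one loop test and the value of the chosen set.\<close>
  define W where "W s' = (if nats s' 21 0 = 0 then K
    else a + (if nats s' 17 0 = 1 then g S else g (S - {nats s' 18 0})))" for s' :: store
  have K0: "K \<ge> 0" using B accept_cost_nonneg up_mean_nonneg[of S g] S g by (simp add: K_def)
  have gS: "g S \<ge> 0" "g (S - {j}) \<ge> 0" for j by (intro g; use S in auto)+
  have "ert accept_loop f s \<sqsubseteq> W s"
    unfolding accept_loop_def
  proof (rule bounded_by_While[where Inv = Inv])
    show "Inv s" using good r1 N bit by (simp add: Inv_def)
    show "W s' \<ge> 0" for s' using K0 gS a by (simp add: W_def)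
    show "f s' \<sqsubseteq> W s' - a" if "Inv s'" "\<not> bval s' (NLess (nv 21) (NConst 1))" for s'
      using that stay[of s'] remove[of s' "nats s' 13 0"] by (auto simp: Inv_def W_def M_def)
    fix s' F
    assume s': "Inv s'" "bval s' (NLess (nv 21) (NConst 1))" and F: "\<And>s''. Inv s'' \<Longrightarrow> F s'' \<sqsubseteq> W s''"
    have good': "good S s'" "nats s' 23 0 = rk S" "nats s' 4 0 = N" using s' by (auto simp: Inv_def)
    define L where "L v = nats s' 2 (Suc v)" for v
    have L: "bij_betw L {..<M} S" using good' by (simp add: good_def L_def[abs_def] M_def)
    define h where "h j = 35 * a + b + ((1 / B * (a + g S) + (1 - 1 / B) * K)
      + (ratio S j / B * (a + g (S - {j})) + (1 - ratio S j / B) * K)) / 2" for j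
    have prob: "0 \<le> ratio S j / B" "ratio S j / B \<le> 1" if "j \<in> S" for j
      using ratio_nonneg[OF S(1) that] ratio_le[OF S(1) that] B by auto
    have h0: "h j \<ge> 0" if "j \<in> S" for j
      unfolding h_def using a b B(1) K0 gS prob[OF that] ratio_nonneg[OF S(1) that]
      by (intro add_nonneg_nonneg divide_nonneg_pos mult_nonneg_nonneg) auto
    \<comment> \<open>As the list is a bijection, a uniform index is a uniform element, and the
      ratios add up to \<open>total S - M\<close>.\<close>
    have sum_h: "(\<Sum>v<M. h (L v)) / M \<le> 36 * a + b + K - accept_cost"
    proof -
      define c0 where "c0 = 35 * a + b + K + (a / B + (g S - K) / B) / 2"
      have eq: "h j = c0 + (ratio S j * a + (ratio S j * g (S - {j}) - ratio S j * K)) * (1 / (2 * B))" for j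
        unfolding h_def c0_def by (simp add: algebra_simps add_divide_distrib diff_divide_distrib)
      have sum_ratio: "(\<Sum>j\<in>S. ratio S j) = total S - M" by (simp add: total_def M_def)
      have sum_g: "(\<Sum>j\<in>S. ratio S j * g (S - {j})) = total S * up_mean g S - M * g S"
        using total_pos[OF S(1) good(2)] by (simp add: up_mean_def M_def)
      have "(\<Sum>v<M. h (L v)) = (\<Sum>j\<in>S. h j)" by (rule sum.reindex_bij_betw[OF L])
      also have "\<dots> = real M * c0 + ((total S - M) * a + (total S * up_mean g S - M * g S - (total S - M) * K)) * (1 / (2 * B))"
        unfolding eq sum.distrib sum_subtractf sum_distrib_right[symmetric] sum_ratio sum_g by (simp add: M_def)
      finally have sum_h: "(\<Sum>v<M. h (L v)) = real M * c0 + (total S - M) * a / (2 * B)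
          + (total S * up_mean g S - M * g S - (total S - M) * K) / (2 * B)"
        by (simp add: add_divide_distrib)
      have "(\<Sum>j\<in>S. ratio S j) \<le> card S * B"
        using prob B(1) by (intro sum_bounded_above) (simp add: divide_le_eq)
      then have "(total S - M) * a \<le> M * B * a"
        unfolding sum_ratio M_def[symmetric] using a by (intro mult_right_mono)
      then have "(total S - M) * a / (2 * B) \<le> M * B * a / (2 * B)"
        using B(1) by (intro divide_right_mono) auto
      then have "(total S - M) * a / (2 * B) \<le> M * (a / 2)" using B(1) by simp
      then have 1: "(\<Sum>v<M. h (L v)) \<le> real M * c0 + real M * (a / 2)
          + (total S * up_mean g S - real M * g S - (total S - real M) * K) / (2 * B)"
        unfolding sum_h by linarith
      have "real M \<le> total S"
        unfolding total_def M_def using ratio_nonneg[OF S(1)] by (simp add: sum_nonneg)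
      then have "real M * c0 + real M * (a / 2)
          + (total S * up_mean g S - real M * g S - (total S - real M) * K) / (2 * B)
        \<le> real M * (36 * a + b + K - accept_cost)"
        unfolding c0_def by (intro acceptance_arithmetic[OF B(1) a accept_cost_nonneg]) (simp_all add: K_def)
      with 1 have "(\<Sum>v<M. h (L v)) \<le> real M * (36 * a + b + K - accept_cost)" by linarith
      then show ?thesis using M by (simp add: divide_le_eq mult.commute)
    qed
    have "ert (uniform 3) (ert propose F) s' \<sqsubseteq> K - a - a"
    proof (rule bounded_by_uniform[where M = M and g = "\<lambda>v. h (L v)"])
      show "nats s' 3 0 = M" using good' by (simp add: good_def M_def)
      show "h (L v) \<ge> 0" if "v < M" for v using h0 L that by (auto simp: bij_betw_def)
      have "a * bits M \<le> a * bits n" using bits_mono[OF M(2)] a by (intro mult_left_mono) auto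
      then have "15 * a * (bits M + 1) + 38 * a + b \<le> accept_cost" using a by (simp add: accept_cost_def algebra_simps)
      then show "15 * a * (bits M + 1) + (\<Sum>v<M. h (L v)) / M \<le> K - a - a" using sum_h by linarith
      fix s'' v assume s'': "frame {13, 14, 15} {} s' s''" "v < M" "nats s'' 13 0 = v"
      have good'': "good S s''" "nats s'' 23 0 = rk S" "nats s'' 4 0 = N" "nats s'' 2 (Suc v) = L v"
        using good_frame[OF good'(1) s''(1)] good' frame_nats[OF s''(1), of 23] frame_nats[OF s''(1), of 4]
          frame_nats[OF s''(1), of 2] by (auto simp: L_def)
      show "ert propose F s'' \<sqsubseteq> h (L v)"
        unfolding h_def
      proof (rule bounded_by_propose[OF good''(1) s''(3) _ good''(2,3)])
        show "F t \<sqsubseteq> a + g S" if "good S t" "nats t 23 0 = rk S" "nats t 4 0 = N" "nats t 21 0 = 1" "nats t 17 0 = 1" for t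
          using F[of t] that by (simp add: Inv_def W_def)
        show "F t \<sqsubseteq> a + g (S - {L v})" if "good S t" "nats t 23 0 = rk S" "nats t 4 0 = N" "nats t 21 0 = 1" "nats t 17 0 = 0"
          "nats t 13 0 = v" "nats t 18 0 = L v" "nats t 2 (Suc v) = L v" for t
          using F[of t] that s''(2) by (simp add: Inv_def W_def)
        show "F t \<sqsubseteq> K" if "good S t" "nats t 23 0 = rk S" "nats t 4 0 = N" "nats t 21 0 = 0" for t
          using F[of t] that by (simp add: Inv_def W_def)
      qed (use s'' good'' a gS K0 in \<open>auto simp: M_def\<close>)
    qed (use M in auto)
    then have "ert (uniform 3 ;; propose) F s' \<sqsubseteq> K - a" by (intro bounded_by_Seq) simp
    then show "ert (uniform 3 ;; propose) F s' \<sqsubseteq> W s' - a" using s'(2) by (simp add: W_def)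
  qed
  moreover have "W s = K" by (simp add: W_def bit)
  ultimately show ?thesis by (simp add: K_def)
qed

lemma up_mean_add_const:
  assumes "S \<subseteq> ground" "S \<noteq> {}"
  shows "up_mean (\<lambda>X. c + g X) S = c + up_mean g S"
proof -
  have "real (card S) * (c + g S) + (\<Sum>j\<in>S. ratio S j * (c + g (S - {j})))
    = c * total S + (real (card S) * g S + (\<Sum>j\<in>S. ratio S j * g (S - {j})))"
    by (simp add: total_def distrib_left sum.distrib sum_distrib_left mult.commute)
  then show ?thesis using total_pos[OF assms] by (simp add: up_mean_def add_divide_distrib)
qed

lemma good_remove:
  assumes good: "good S s" and v: "v < card S" and j: "j = nats s 2 (Suc v)"
  shows "good (S - {j}) (write_nat 3 0 (card S - 1) (write_nat 2 (Suc v) (nats s 2 (card S)) (write_nat 1 j 0 s)))"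
proof -
  let ?L = "\<lambda>p. nats s 2 (Suc p)"
  have L: "bij_betw ?L {..<card S} S" using good by (simp add: good_def)
  have "j \<in> S" using L v j by (auto simp: bij_betw_def)
  then have "j \<in> ground" using good_subset[OF good] by auto
  have card: "card (S - {j}) = card S - 1"
    using \<open>j \<in> S\<close> good_subset[OF good] finite_subset_ground by simp
  have eq: "(\<lambda>p. nats (write_nat 3 0 (card S - 1) (write_nat 2 (Suc v) (nats s 2 (card S)) (write_nat 1 j 0 s))) 2 (Suc p))
    = (\<lambda>i. if i = v then ?L (card S - 1) else ?L i)"
    using v by (auto simp: fun_eq_iff)
  have "Suc (card S - 1) = card S" using v by simp
  then show ?thesis
    using good \<open>j \<in> ground\<close> bij_betw_remove_last[OF L v] unfolding good_def eq card by (simp add: j[symmetric])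
qed

lemma good_insert:
  assumes good: "good S s" and u: "u \<in> ground" "u \<notin> S"
  shows "good (insert u S) (write_nat 2 (Suc (card S)) u (write_nat 3 0 (Suc (card S)) (write_nat 1 u 1 s)))"
proof -
  let ?L = "\<lambda>p. nats s 2 (Suc p)"
  have L: "bij_betw ?L {..<card S} S" using good by (simp add: good_def)
  have fin: "finite S" using good_subset[OF good] finite_subset_ground by simp
  have eq: "(\<lambda>p. nats (write_nat 2 (Suc (card S)) u (write_nat 3 0 (Suc (card S)) (write_nat 1 u 1 s))) 2 (Suc p))
    = (\<lambda>i. if i = card S then u else ?L i)"
    by (auto simp: fun_eq_iff)
  show ?thesis
    using good u fin bij_betw_append[OF L u(2) fin] unfolding good_def eq by simp
qed

lemma bounded_by_chain_iteration:
  assumes good: "good S s" and N: "nats s 4 0 = N"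
    and g: "\<And>X. X \<subseteq> ground \<Longrightarrow> g X \<ge> 0"
    and post: "\<And>s' X. good X s' \<Longrightarrow> nats s' 4 0 = N \<Longrightarrow> f s' \<sqsubseteq> g X"
  shows "ert chain_iteration f s \<sqsubseteq> iteration_cost + step_mean g S"
proof -
  have ab: "0 \<le> a + b" using a b by simp
  let ?end = "Cond (NLess (NConst 0) (nv 17)) Skip
      (NAssign 1 (nv 18) (NConst 0) ;; NAssign 2 (NAdd (nv 13) (NConst 1)) (NRead 2 (nv 3)) ;;
       nset 3 (NSub (nv 3) (NConst 1)))"
  let ?add = "Cond (NLess (NConst 0) (NRead 1 (nv 9))) Skip
      (NAssign 1 (nv 9) (NConst 1) ;; nset 3 (NAdd (nv 3) (NConst 1)) ;; NAssign 2 (nv 3) (nv 9))"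
  let ?accept = "QueryRank 23 (NConst 0) 1 ;; nset 21 (NConst 0) ;; accept_loop ;; ?end"
  have accept: "ert ?accept f t \<sqsubseteq> 12 * a + b + 2 * B * accept_cost + up_mean g X"
    if t: "good X t" "X \<noteq> {}" "nats t 4 0 = N" for t X
  proof -
    let ?t = "write_nat 21 0 0 (write_nat 23 0 (rk X) t)"
    have X: "X \<subseteq> ground" using good_subset[OF t(1)] .
    have good_t: "good X ?t" using t(1) by (simp add: good_def)
    have "ert accept_loop (ert ?end f) ?t \<sqsubseteq> 2 * B * accept_cost + up_mean (\<lambda>X. 6 * a + g X) X"
    proof (rule bounded_by_accept_loop[OF good_t t(2)])
      show "6 * a + g Y \<ge> 0" if "Y \<subseteq> ground" for Y using g[OF that] a by simp
      show "ert ?end f s' \<sqsubseteq> 6 * a + g X" if "good X s'" "nats s' 4 0 = N" "nats s' 17 0 = 1" for s'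
      proof -
        have "ert ?end f s' = ennreal a + (ennreal a + f s')" using that by simp
        also have "\<dots> \<sqsubseteq> a + (a + g X)" using that by (intro bounded_by_add_right a post)
        finally show ?thesis by (rule bounded_by_mono) (use a in simp)
      qed
      fix s' v assume s': "good X s'" "nats s' 4 0 = N" "nats s' 17 0 = 0" "v < card X" "nats s' 13 0 = v"
        "nats s' 18 0 = nats s' 2 (Suc v)"
      let ?s = "write_nat 3 0 (card X - 1) (write_nat 2 (Suc v) (nats s' 2 (card X)) (write_nat 1 (nats s' 2 (Suc v)) 0 s'))"
      have card: "nats s' 3 0 = card X" using s'(1) by (simp add: good_def)
      have "ert ?end f s' = ennreal a + (ennreal a + (ennreal a + (ennreal a + (ennreal a + (ennreal a + f ?s)))))"
        using s' by (simp add: card Suc_eq_plus1)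
      also have "\<dots> \<sqsubseteq> a + (a + (a + (a + (a + (a + g (X - {nats s' 2 (Suc v)}))))))"
        by (intro bounded_by_add_right a post good_remove s'(1,4) refl) (simp add: s'(2))
      finally show "ert ?end f s' \<sqsubseteq> 6 * a + g (X - {nats s' 2 (Suc v)})" by (simp add: algebra_simps)
    qed (use t in simp_all)
    then have loop: "ert accept_loop (ert ?end f) ?t \<sqsubseteq> 2 * B * accept_cost + (6 * a + up_mean g X)"
      by (simp add: up_mean_add_const X t)
    have "ert ?accept f t = ennreal a + (ennreal (a + b) + (ennreal a + (ennreal a + (ennreal a +
        ert accept_loop (ert ?end f) ?t))))"
      using t(1) by (simp add: good_def del: ert.simps(1,7)) 
    also have "\<dots> \<sqsubseteq> a + ((a + b) + (a + (a + (a + (2 * B * accept_cost + (6 * a + up_mean g X))))))"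
      by (intro bounded_by_add_right a ab loop)
    finally show ?thesis by (rule bounded_by_mono) (use a in simp)
  qed
  have rest: "ert (nset 9 (NAdd (nv 13) (NConst 1)) ;; ?add ;; ?accept) f t
      \<sqsubseteq> 22 * a + b + 2 * B * accept_cost + up_mean g (insert (Suc v) S)"
    if t: "frame {13, 14, 15} {} s t" "v < n" "nats t 13 0 = v" for t v
  proof -
    define u where "u = Suc v"
    have u: "u \<in> ground" using t by (auto simp: u_def)
    let ?t = "write_nat 9 0 u t"
    have "good S t" using good_frame[OF good t(1)] by simp
    then have good_t: "good S ?t" by (simp add: good_def)
    have N': "nats ?t 4 0 = N" using frame_nats[OF t(1), of 4] N by simp
    have card: "nats t 3 0 = card S" "read_set n 1 t = S" using \<open>good S t\<close> by (auto simp: good_def)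
    have "ert ?add (ert ?accept f) ?t \<sqsubseteq> 6 * a + (12 * a + b + 2 * B * accept_cost + up_mean g (insert u S))"
    proof (cases "u \<in> S")
      case True
      then have "nats t 1 u \<noteq> 0" using card by (auto simp: read_set_def)
      then have add: "ert ?add h ?t = ennreal a + (ennreal a + h ?t)" for h by simp
      have "ert ?add (ert ?accept f) ?t = ennreal a + (ennreal a + ert ?accept f ?t)" by (rule add)
      also have "\<dots> \<sqsubseteq> a + (a + (12 * a + b + 2 * B * accept_cost + up_mean g S))"
        using True by (intro bounded_by_add_right a accept good_t N') auto
      finally show ?thesis by (rule bounded_by_mono) (use a True in \<open>simp add: insert_absorb\<close>)
    next
      case False
      let ?t' = "write_nat 2 (Suc (card S)) u (write_nat 3 0 (Suc (card S)) (write_nat 1 u 1 ?t))"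
      have "nats t 1 u = 0" using False card u by (auto simp: read_set_def)
      then have add: "ert ?add h ?t = ennreal a + (ennreal a + (ennreal a + (ennreal a + (ennreal a + (ennreal a + h ?t')))))" for h
        by (simp add: card Suc_eq_plus1)
      have "ert ?add (ert ?accept f) ?t = ennreal a + (ennreal a + (ennreal a + (ennreal a + (ennreal a + (ennreal a + ert ?accept f ?t')))))"
        by (rule add)
      also have "\<dots> \<sqsubseteq> a + (a + (a + (a + (a + (a + (12 * a + b + 2 * B * accept_cost + up_mean g (insert u S)))))))"
        using N' by (intro bounded_by_add_right a accept good_insert good_t u False) auto
      finally show ?thesis by (simp add: algebra_simps)
    qed
    then have "ert (?add ;; ?accept) f ?t \<sqsubseteq> a + (6 * a + (12 * a + b + 2 * B * accept_cost + up_mean g (insert u S)))"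
      by (intro bounded_by_Seq) simp
    then have "ert (nset 9 (NAdd (nv 13) (NConst 1)) ;; ?add ;; ?accept) f t
      \<sqsubseteq> a + (a + (a + (6 * a + (12 * a + b + 2 * B * accept_cost + up_mean g (insert u S)))))"
      by (intro bounded_by_Seq[of "nset 9 e" for e] bounded_by_NAssign) (simp add: t u_def Suc_eq_plus1 del: ert.simps)
    then show ?thesis unfolding u_def by (rule bounded_by_mono) (use a in simp)
  qed
  have S: "S \<subseteq> ground" using good_subset[OF good] .
  have up0: "up_mean g (insert u S) \<ge> 0" if "u \<in> ground" for u
    using that S by (intro up_mean_nonneg g) auto
  have ac: "0 \<le> 2 * B * accept_cost" using B accept_cost_nonneg by simp
  have "ert (uniform 0) (ert (nset 9 (NAdd (nv 13) (NConst 1)) ;; ?add ;; ?accept) f) s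
    \<sqsubseteq> 15 * a * (bits n + 1) + 22 * a + b + 2 * B * accept_cost + step_mean g S"
  proof (rule bounded_by_uniform[where M = n and g = "\<lambda>v. 22 * a + b + 2 * B * accept_cost + up_mean g (insert (Suc v) S)"])
    show "nats s 0 0 = n" using good by (simp add: good_def)
    show "22 * a + b + 2 * B * accept_cost + up_mean g (insert (Suc v) S) \<ge> 0" if "v < n" for v
      using a b ac up0[of "Suc v"] that by (auto intro!: add_nonneg_nonneg)
    \<comment> \<open>\<open>uniform 0\<close> draws from \<open>{..<n}\<close>, whereas the ground
      set begins at 1.\<close>
    have "(\<Sum>v<n. up_mean g (insert (Suc v) S)) = (\<Sum>u\<in>ground. up_mean g (insert u S))"
      unfolding One_nat_def by (rule sum.atLeast1_atMost_eq[symmetric])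
    then have "(\<Sum>v<n. 22 * a + b + 2 * B * accept_cost + up_mean g (insert (Suc v) S)) / n
      = 22 * a + b + 2 * B * accept_cost + step_mean g S"
      using n by (simp add: sum.distrib step_mean_def add_divide_distrib)
    then show "15 * a * (bits n + 1) + (\<Sum>v<n. 22 * a + b + 2 * B * accept_cost + up_mean g (insert (Suc v) S)) / n
      \<le> 15 * a * (bits n + 1) + 22 * a + b + 2 * B * accept_cost + step_mean g S" by simp
  qed (use n rest in auto)
  then have "ert (uniform 0) (ert (nset 9 (NAdd (nv 13) (NConst 1)) ;; ?add ;; ?accept) f) s
    \<sqsubseteq> iteration_cost + step_mean g S - a"
    by (rule bounded_by_mono) (use a in \<open>simp add: iteration_cost_def\<close>)
  then show ?thesis unfolding chain_iteration_def by (rule bounded_by_Seq)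
qed

lemma bounded_by_chain_loop:
  assumes good: "good S s"
    and g: "\<And>X. X \<subseteq> ground \<Longrightarrow> g X \<ge> 0"
    and post: "\<And>s' X. good X s' \<Longrightarrow> f s' \<sqsubseteq> g X"
  shows "ert chain_loop f s \<sqsubseteq> a + nats s 4 0 * (iteration_cost + 3 * a) + (step_mean ^^ nats s 4 0) g S"
proof -
  define W where "W s' = a + nats s' 4 0 * (iteration_cost + 3 * a) + (step_mean ^^ nats s' 4 0) g (read_set n 1 s')" for s'
  have pos: "(step_mean ^^ k) g X \<ge> 0" if "X \<subseteq> ground" for k X
    using that by (induction k arbitrary: X) (auto intro: g step_mean_nonneg)
  have sub: "read_set n 1 s' \<subseteq> ground" for s' by (auto simp: read_set_def)
  have "ert chain_loop f s \<sqsubseteq> W s"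
    unfolding chain_loop_def
  proof (rule bounded_by_While[where Inv = "\<lambda>s'. good (read_set n 1 s') s'"])
    show "good (read_set n 1 s) s" using good by (simp add: good_def)
    show "W s' \<ge> 0" for s'
      unfolding W_def using a pos[OF sub] iteration_cost_nonneg by (intro add_nonneg_nonneg mult_nonneg_nonneg) auto
    show "f s' \<sqsubseteq> W s' - a" if "good (read_set n 1 s') s'" "\<not> bval s' (NLess (NConst 0) (nv 4))" for s'
      using post[OF that(1)] that(2) by (simp add: W_def)
    fix s' F
    assume s': "good (read_set n 1 s') s'" "bval s' (NLess (NConst 0) (nv 4))"
      and F: "\<And>s''. good (read_set n 1 s'') s'' \<Longrightarrow> F s'' \<sqsubseteq> W s''"
    obtain k where k: "nats s' 4 0 = Suc k" using s'(2) by (cases "nats s' 4 0") auto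
    \<comment> \<open>The cost of the remaining iterations. \<open>step_mean\<close> preserves
      constants, so this number passes through the current iteration unchanged.\<close>
    define c where "c = a + (a + k * (iteration_cost + 3 * a))"
    have c: "c \<ge> 0" using a iteration_cost_nonneg by (simp add: c_def)
    have "ert chain_iteration (ert (nset 4 (NSub (nv 4) (NConst 1))) F) s'
      \<sqsubseteq> iteration_cost + step_mean (\<lambda>X. c + (step_mean ^^ k) g X) (read_set n 1 s')"
    proof (rule bounded_by_chain_iteration[OF s'(1) k])
      show "0 \<le> c + (step_mean ^^ k) g X" if "X \<subseteq> ground" for X using c pos[OF that] by simp
      fix s'' X assume s'': "good X s''" "nats s'' 4 0 = Suc k"
      let ?s = "write_nat 4 0 k s''"
      have "good X ?s" using s'' by (simp add: good_def)
      moreover have "read_set n 1 ?s = X" using s'' by (simp add: good_def)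
      ultimately have "F ?s \<sqsubseteq> a + k * (iteration_cost + 3 * a) + (step_mean ^^ k) g X"
        using F[of ?s] by (simp add: W_def)
      then have "ennreal a + F ?s \<sqsubseteq> a + (a + k * (iteration_cost + 3 * a) + (step_mean ^^ k) g X)"
        by (intro bounded_by_add_right a)
      then show "ert (nset 4 (NSub (nv 4) (NConst 1))) F s'' \<sqsubseteq> c + (step_mean ^^ k) g X"
        by (simp add: s'' c_def add.assoc)
    qed
    also have "step_mean (\<lambda>X. c + (step_mean ^^ k) g X) (read_set n 1 s') = c + (step_mean ^^ Suc k) g (read_set n 1 s')"
      using n sub[of s'] by (simp add: step_mean_def up_mean_add_const sum.distrib add_divide_distrib)
    finally show "ert (chain_iteration ;; nset 4 (NSub (nv 4) (NConst 1))) F s' \<sqsubseteq> W s' - a"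
      by (intro bounded_by_Seq) (simp add: W_def k c_def algebra_simps)
  qed
  then show ?thesis using good by (simp add: W_def good_def)
qed

end

section \<open>Finding a start of large weight\<close>

text \<open>The binary digits of the number in array 6 are decoded into a set; real array 4 receives
  the product of \<open>1 / lam i\<close> over the complement.\<close>

definition decode_body :: com where
  "decode_body = (nset 11 (NHalf (nv 10)) ;;
     Cond (NLess (NAdd (nv 11) (nv 11)) (nv 10))
       (NAssign 1 (nv 9) (NConst 1) ;; nset 3 (NAdd (nv 3) (NConst 1)) ;; NAssign 2 (nv 3) (nv 9))
       (NAssign 1 (nv 9) (NConst 0) ;; rset 4 (RDiv (rv 4) (RRead 1 (nv 9)))) ;;
     nset 10 (nv 11) ;; nset 9 (NAdd (nv 9) (NConst 1)))"

definition decode :: com where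
  "decode = (nset 3 (NConst 0) ;; rset 4 (ROfNat (NConst 1)) ;; nset 9 (NConst 1) ;; nset 10 (nv 6) ;;
     While (BNot (NLess (nv 0) (nv 9))) decode_body)"

text \<open>Register 12 holds the rank deficit. Repeated multiplication covers \<open>q = 0\<close>,
  since no factor is applied when the deficit is 0.\<close>

definition power_loop :: com where
  "power_loop = While (NLess (NConst 0) (nv 12)) (rset 4 (RMul (rv 4) (rv 0)) ;; nset 12 (NSub (nv 12) (NConst 1)))"

text \<open>Register 6 counts the codes down, register 7 keeps the best code so far, and real array
  5 keeps its weight.\<close>

definition search_body :: com where
  "search_body = (nset 6 (NSub (nv 6) (NConst 1)) ;; decode ;; QueryRank 12 (NConst 0) 1 ;;
     nset 12 (NSub (nv 8) (nv 12)) ;; power_loop ;;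
     Cond (RLess (rv 5) (rv 4)) (rset 5 (rv 4) ;; nset 7 (nv 6)) Skip)"

definition search :: com where
  "search = (rset 5 (ROfNat (NConst 0)) ;; nset 6 (nv 5) ;; While (NLess (NConst 0) (nv 6)) search_body)"

definition sub :: "nat \<Rightarrow> nat \<Rightarrow> nat set" where
  "sub k c = {i \<in> {1..k}. odd (c div 2 ^ (i - 1))}"

lemma sub_Suc: "sub (Suc k) c = (if odd (c div 2 ^ k) then insert (Suc k) (sub k c) else sub k c)"
  by (auto simp: sub_def le_Suc_eq)

lemma finite_sub: "finite (sub k c)"
  by (simp add: sub_def)

lemma sub_subset: "sub k c \<subseteq> {1..k}"
  by (auto simp: sub_def)

lemma sub_surj:
  assumes "S \<subseteq> {1..k}"
  shows "\<exists>c<2 ^ k. sub k c = S"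
  using assms
proof (induction k arbitrary: S)
  case 0
  then show ?case by (simp add: sub_def)
next
  case (Suc k)
  have "S - {Suc k} \<subseteq> {1..k}" using Suc.prems by (auto simp: le_Suc_eq)
  from Suc.IH[OF this] obtain c where c: "c < 2 ^ k" "sub k c = S - {Suc k}" by blast
  show ?case
  proof (cases "Suc k \<in> S")
    case False
    then have "sub (Suc k) c = S" using c by (simp add: sub_Suc)
    then show ?thesis using c by (intro exI[of _ c]) simp
  next
    case True
    \<comment> \<open>Setting digit \<open>k\<close> leaves the lower digits alone, because
      \<open>2 ^ k\<close> is an even multiple of \<open>2 ^ (i - 1)\<close>.\<close>
    have eq: "odd ((2 ^ k + c) div 2 ^ (i - 1)) \<longleftrightarrow> odd (c div 2 ^ (i - 1))" if "i \<in> {1..k}" for i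
    proof -
      have "2 ^ k = 2 ^ (i - 1) * (2 * 2 ^ (k - i) :: nat)"
      proof -
        have "k = (i - 1) + Suc (k - i)" using that by auto
        then have "(2 :: nat) ^ k = 2 ^ ((i - 1) + Suc (k - i))" by (rule arg_cong)
        then show ?thesis by (simp only: power_add power_Suc)
      qed
      then have "(2 ^ k + c) div 2 ^ (i - 1) = 2 * 2 ^ (k - i) + c div 2 ^ (i - 1)"
        by simp
      then show ?thesis by simp
    qed
    have "sub k (2 ^ k + c) = sub k c" unfolding sub_def using eq by blast
    moreover have "odd ((2 ^ k + c) div 2 ^ k)" using c by simp
    ultimately have "sub (Suc k) (2 ^ k + c) = S" using c True by (simp add: sub_Suc insert_absorb)
    then show ?thesis using c by (intro exI[of _ "2 ^ k + c"]) simp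
  qed
qed

lemma sub_full: "sub k (2 ^ k - 1) = {1..k}"
proof -
  have "odd ((2 ^ k - 1) div 2 ^ (i - 1) :: nat)" if "i \<in> {1..k}" for i
  proof -
    have "k = i - 1 + Suc (k - i)" using that by auto
    then obtain d where d: "k = i - 1 + Suc d" by blast
    \<comment> \<open>Division with remainder by \<open>2 ^ (i - 1)\<close>: the quotient
      \<open>2 * 2 ^ d - 1\<close> is odd.\<close>
    have "(2 :: nat) ^ k - 1 = 2 ^ (i - 1) * (2 * 2 ^ d - 1) + (2 ^ (i - 1) - 1)"
      unfolding d by (simp add: power_add diff_mult_distrib2)
    moreover have "(m * x + (m - 1)) div m = x" if "m > 0" for m x :: nat
      by (rule div_nat_eqI) (use that in \<open>auto simp: algebra_simps\<close>)
    ultimately have "((2 :: nat) ^ k - 1) div 2 ^ (i - 1) = 2 * 2 ^ d - 1" by simp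
    then show ?thesis by simp
  qed
  then show ?thesis unfolding sub_def by blast
qed

context cluster_machine
begin

definition base :: "store \<Rightarrow> bool" where
  "base s \<longleftrightarrow> nats s 0 0 = n \<and> reals s 0 0 = q \<and> reals s 2 0 = B \<and> (\<forall>i\<in>ground. reals s 1 i = lam i)"

lemma base_frame: "base s \<Longrightarrow> frame A R s s' \<Longrightarrow> 0 \<notin> A \<Longrightarrow> R \<inter> {0, 1, 2} = {} \<Longrightarrow> base s'"
  using frame_nats[of A R s s' 0] frame_reals[of A R s s' 0] frame_reals[of A R s s' 1] frame_reals[of A R s s' 2]
  by (simp add: base_def)

lemma base_good: "good S s \<Longrightarrow> base s"
  by (simp add: base_def good_def)

lemma bounded_by_decode:
  assumes base: "base s" and r: "r \<ge> 0"
    and post: "\<And>s'. frame {1, 2, 3, 9, 10, 11} {4} s s' \<Longrightarrow> good (sub n (nats s 6 0)) s' \<Longrightarrow>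
      reals s' 4 0 = (\<Prod>i\<in>ground - sub n (nats s 6 0). 1 / lam i) \<Longrightarrow> f s' \<sqsubseteq> r"
  shows "ert decode f s \<sqsubseteq> 13 * a * n + 10 * a + r"
proof -
  define c where "c = nats s 6 0"
  \<comment> \<open>After \<open>k\<close> rounds the \<open>k\<close> lowest digits have been
    consumed. \<open>k\<close> can be recovered from register 9, which holds the next element, so
    the loop invariant may quantify it away.\<close>
  define I where "I k s' \<longleftrightarrow> frame {1, 2, 3, 9, 10, 11} {4} s s' \<and> k \<le> n \<and> nats s' 9 0 = Suc k \<and>
    nats s' 10 0 = c div 2 ^ k \<and> (\<forall>i\<in>{1..k}. nats s' 1 i \<noteq> 0 \<longleftrightarrow> i \<in> sub k c) \<and>
    nats s' 3 0 = card (sub k c) \<and> bij_betw (\<lambda>p. nats s' 2 (Suc p)) {..<card (sub k c)} (sub k c) \<and>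
    reals s' 4 0 = (\<Prod>i\<in>{1..k} - sub k c. 1 / lam i)" for k s'
  define Inv where "Inv s' \<longleftrightarrow> (\<exists>k. I k s')" for s'
  define W where "W s' = a + real (Suc n - nats s' 9 0) * (13 * a) + r" for s' :: store
  let ?s = "write_nat 10 0 c (write_nat 9 0 1 (write_real 4 0 1 (write_nat 3 0 0 s)))"
  have baseD: "nats s 0 0 = n" "\<And>i. i \<in> ground \<Longrightarrow> reals s 1 i = lam i" using base by (auto simp: base_def)
  have "ert (While (BNot (NLess (nv 0) (nv 9))) decode_body) f ?s \<sqsubseteq> W ?s"
  proof (rule bounded_by_While[where Inv = Inv])
    have "sub 0 c = {}" by (simp add: sub_def)
    then show "Inv ?s" unfolding Inv_def I_def by (intro conjI exI[of _ 0]) (auto simp: bij_betw_def)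
    show "W s' \<ge> 0" for s' using a r by (simp add: W_def)
    show "f s' \<sqsubseteq> W s' - a" if inv: "Inv s'" and ex: "\<not> bval s' (BNot (NLess (nv 0) (nv 9)))" for s'
    proof -
      obtain k where "I k s'" using inv unfolding Inv_def by blast
      then have k: "k \<le> n" "nats s' 9 0 = Suc k" "\<forall>i\<in>{1..k}. nats s' 1 i \<noteq> 0 \<longleftrightarrow> i \<in> sub k c"
        "nats s' 3 0 = card (sub k c)" "bij_betw (\<lambda>p. nats s' 2 (Suc p)) {..<card (sub k c)} (sub k c)"
        "reals s' 4 0 = (\<Prod>i\<in>{1..k} - sub k c. 1 / lam i)" and fr: "frame {1, 2, 3, 9, 10, 11} {4} s s'"
        unfolding I_def by blast+
      have base': "base s'" by (rule base_frame[OF base fr]) auto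
      then have "nats s' 0 0 = n" by (simp add: base_def)
      then have "k = n" using ex k by simp
      have "read_set n 1 s' = sub n c"
        using k(3) sub_subset[of n c] unfolding \<open>k = n\<close> by (auto simp: read_set_def)
      then have "good (sub n c) s'" using base' k \<open>k = n\<close> by (simp add: good_def base_def)
      then have "f s' \<sqsubseteq> r" using post[OF fr] k \<open>k = n\<close> unfolding c_def by simp
      then show ?thesis by (rule bounded_by_mono) (use a in \<open>simp add: W_def\<close>)
    qed
    fix s' F
    assume s': "Inv s'" "bval s' (BNot (NLess (nv 0) (nv 9)))" and F: "\<And>s''. Inv s'' \<Longrightarrow> F s'' \<sqsubseteq> W s''"
    obtain k where "I k s'" using s'(1) unfolding Inv_def by blast
    then have k: "k \<le> n" "nats s' 9 0 = Suc k" "nats s' 10 0 = c div 2 ^ k"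
      "\<forall>i\<in>{1..k}. nats s' 1 i \<noteq> 0 \<longleftrightarrow> i \<in> sub k c"
      "nats s' 3 0 = card (sub k c)" "bij_betw (\<lambda>p. nats s' 2 (Suc p)) {..<card (sub k c)} (sub k c)"
      "reals s' 4 0 = (\<Prod>i\<in>{1..k} - sub k c. 1 / lam i)" and fr: "frame {1, 2, 3, 9, 10, 11} {4} s s'"
      unfolding I_def by blast+
    have base': "base s'" by (rule base_frame[OF base fr]) auto
    then have n0: "nats s' 0 0 = n" by (simp add: base_def)
    then have kn: "Suc k \<le> n" using s'(2) k by simp
    then have lam_k: "reals s' 1 (Suc k) = lam (Suc k)" using base' by (simp add: base_def)
    have half: "c div 2 ^ k div 2 = c div 2 ^ Suc k" by (simp only: power_Suc2 div_mult2_eq)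
    have Wk: "W s' = a + (13 * a + real (n - Suc k) * (13 * a) + r)"
    proof -
      have "real (Suc n - Suc k) = 1 + real (n - Suc k)" using kn by simp
      then show ?thesis by (simp add: W_def k(2) algebra_simps)
    qed
    have half_iff: "x div 2 + x div 2 < x \<longleftrightarrow> odd x" for x :: nat by presburger
    have notin: "Suc k \<notin> sub k c" using sub_subset[of k c] by auto
    show "ert decode_body F s' \<sqsubseteq> W s' - a"
    proof (cases "odd (c div 2 ^ k)")
      case True
      let ?t = "write_nat 9 0 (Suc (Suc k)) (write_nat 10 0 (c div 2 ^ k div 2)
        (write_nat 2 (Suc (card (sub k c))) (Suc k) (write_nat 3 0 (Suc (card (sub k c)))
        (write_nat 1 (Suc k) 1 (write_nat 11 0 (c div 2 ^ k div 2) s')))))"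
      have "c div 2 ^ k div 2 + c div 2 ^ k div 2 < c div 2 ^ k" using half_iff[of "c div 2 ^ k"] True by blast
      then have eq: "ert decode_body F s' = ennreal a + (ennreal a + (ennreal a + (ennreal a + (ennreal a + (ennreal a +
         (ennreal a + (ennreal a + (ennreal a + (ennreal a + (ennreal a + (ennreal a + F ?t)))))))))))"
        unfolding decode_body_def by (simp add: k(2,3,5) Suc_eq_plus1)
      have S: "sub (Suc k) c = insert (Suc k) (sub k c)" using True by (simp add: sub_Suc)
      have list: "(\<lambda>p. nats ?t 2 (Suc p)) = (\<lambda>i. if i = card (sub k c) then Suc k else nats s' 2 (Suc i))"
        by (auto simp: fun_eq_iff)
      have "Inv ?t"
        unfolding Inv_def I_def
      proof (intro conjI exI[of _ "Suc k"])
        show "frame {1, 2, 3, 9, 10, 11} {4} s ?t" using fr by simp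
        show "nats ?t 10 0 = c div 2 ^ Suc k" using half by simp
        show "\<forall>i\<in>{1..Suc k}. nats ?t 1 i \<noteq> 0 \<longleftrightarrow> i \<in> sub (Suc k) c"
          unfolding S using k(4) by (auto simp: le_Suc_eq)
        show "nats ?t 3 0 = card (sub (Suc k) c)" unfolding S using notin finite_sub by simp
        show "bij_betw (\<lambda>p. nats ?t 2 (Suc p)) {..<card (sub (Suc k) c)} (sub (Suc k) c)"
          unfolding list S by (rule bij_betw_append[OF k(6) notin finite_sub])
        have "{1..Suc k} - sub (Suc k) c = {1..k} - sub k c" unfolding S by (auto simp: le_Suc_eq)
        then show "reals ?t 4 0 = (\<Prod>i\<in>{1..Suc k} - sub (Suc k) c. 1 / lam i)" using k(7) by simp
      qed (use kn in simp_all)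
      from F[OF this] have Ft: "F ?t \<sqsubseteq> a + real (n - Suc k) * (13 * a) + r" by (simp add: W_def)
      show ?thesis
        unfolding eq Wk
        by (rule bounded_by_mono, (rule bounded_by_add_right[OF a] Ft)+) (use a in simp)
    next
      case False
      let ?t = "write_nat 9 0 (Suc (Suc k)) (write_nat 10 0 (c div 2 ^ k div 2)
        (write_real 4 0 (reals s' 4 0 / lam (Suc k)) (write_nat 1 (Suc k) 0 (write_nat 11 0 (c div 2 ^ k div 2) s'))))"
      have "\<not> c div 2 ^ k div 2 + c div 2 ^ k div 2 < c div 2 ^ k" using half_iff[of "c div 2 ^ k"] False by blast
      then have eq: "ert decode_body F s' = ennreal a + (ennreal a + (ennreal a + (ennreal a + (ennreal a + (ennreal a +
         (ennreal a + (ennreal a + (ennreal a + (ennreal a + F ?t)))))))))"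
        unfolding decode_body_def by (simp add: k(2,3) lam_k Suc_eq_plus1[symmetric])
      have S: "sub (Suc k) c = sub k c" using False by (simp add: sub_Suc)
      have "Inv ?t"
        unfolding Inv_def I_def
      proof (intro conjI exI[of _ "Suc k"])
        show "frame {1, 2, 3, 9, 10, 11} {4} s ?t" using fr by simp
        show "nats ?t 10 0 = c div 2 ^ Suc k" using half by simp
        show "\<forall>i\<in>{1..Suc k}. nats ?t 1 i \<noteq> 0 \<longleftrightarrow> i \<in> sub (Suc k) c"
          unfolding S using k(4) notin by (auto simp: le_Suc_eq)
        show "nats ?t 3 0 = card (sub (Suc k) c)" unfolding S using k(5) by simp
        show "bij_betw (\<lambda>p. nats ?t 2 (Suc p)) {..<card (sub (Suc k) c)} (sub (Suc k) c)"
          unfolding S using k(6) by simp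
        have "{1..Suc k} - sub (Suc k) c = insert (Suc k) ({1..k} - sub k c)"
          unfolding S using notin by (auto simp: le_Suc_eq)
        then show "reals ?t 4 0 = (\<Prod>i\<in>{1..Suc k} - sub (Suc k) c. 1 / lam i)" using k(7) by simp
      qed (use kn in simp_all)
      from F[OF this] have Ft: "F ?t \<sqsubseteq> a + real (n - Suc k) * (13 * a) + r" by (simp add: W_def)
      show ?thesis
        unfolding eq Wk
        by (rule bounded_by_mono, (rule bounded_by_add_right[OF a] Ft)+) (use a in simp)
    qed
  qed
  moreover have "W ?s = a + n * (13 * a) + r" by (simp add: W_def Suc_eq_plus1)
  ultimately have loop: "ert (While (BNot (NLess (nv 0) (nv 9))) decode_body) f ?s \<sqsubseteq> a + n * (13 * a) + r" by simp
  have eq: "ert decode f s = ennreal a + (ennreal a + (ennreal a + (ennreal a + (ennreal a + (ennreal a +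
     (ennreal a + (ennreal a + ert (While (BNot (NLess (nv 0) (nv 9))) decode_body) f ?s)))))))"
    unfolding decode_def by (simp add: c_def)
  show ?thesis
    unfolding eq
    by (rule bounded_by_mono, (rule bounded_by_add_right[OF a] loop)+) (use a in \<open>simp add: algebra_simps\<close>)
qed

lemma bounded_by_power_loop:
  assumes r: "r \<ge> 0"
    and post: "\<And>s'. frame {12} {4} s s' \<Longrightarrow> reals s' 4 0 = reals s 4 0 * reals s 0 0 ^ nats s 12 0 \<Longrightarrow> f s' \<sqsubseteq> r"
  shows "ert power_loop f s \<sqsubseteq> a + nats s 12 0 * (4 * a) + r"
proof -
  define Inv where "Inv s' \<longleftrightarrow> frame {12} {4} s s' \<and>
    reals s' 4 0 * reals s 0 0 ^ nats s' 12 0 = reals s 4 0 * reals s 0 0 ^ nats s 12 0" for s'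
  define W where "W s' = a + real (nats s' 12 0) * (4 * a) + r" for s' :: store
  have "ert power_loop f s \<sqsubseteq> W s"
    unfolding power_loop_def
  proof (rule bounded_by_While[where Inv = Inv])
    show "Inv s" by (simp add: Inv_def)
    show "W s' \<ge> 0" for s' using a r by (simp add: W_def)
    show "f s' \<sqsubseteq> W s' - a" if "Inv s'" "\<not> bval s' (NLess (NConst 0) (nv 12))" for s'
      using that post[of s'] by (simp add: Inv_def W_def)
    fix s' F
    assume s': "Inv s'" "bval s' (NLess (NConst 0) (nv 12))" and F: "\<And>s''. Inv s'' \<Longrightarrow> F s'' \<sqsubseteq> W s''"
    obtain d where d: "nats s' 12 0 = Suc d" using s'(2) by (cases "nats s' 12 0") auto
    let ?t = "write_nat 12 0 d (write_real 4 0 (reals s' 4 0 * reals s' 0 0) s')"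
    have fr: "frame {12} {4} s s'" using s'(1) by (simp add: Inv_def)
    have "reals s' 0 = reals s 0" by (rule frame_reals[OF fr]) simp
    then have "Inv ?t" using s'(1) d by (simp add: Inv_def mult.assoc)
    from F[OF this] have Ft: "F ?t \<sqsubseteq> a + real d * (4 * a) + r" by (simp add: W_def)
    have eq: "ert (rset 4 (RMul (rv 4) (rv 0)) ;; nset 12 (NSub (nv 12) (NConst 1))) F s'
      = ennreal a + (ennreal a + (ennreal a + F ?t))" by (simp add: d)
    show "ert (rset 4 (RMul (rv 4) (rv 0)) ;; nset 12 (NSub (nv 12) (NConst 1))) F s' \<sqsubseteq> W s' - a"
      unfolding eq
      by (rule bounded_by_mono, (rule bounded_by_add_right[OF a] Ft)+) (simp add: W_def d algebra_simps)
  qed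
  then show ?thesis by (simp add: W_def)
qed

end

definition init_body :: com where
  "init_body = (nset 5 (NAdd (nv 5) (nv 5)) ;;
     Cond (RLess (rv 2) (RDiv (ROfNat (NConst 1)) (RRead 1 (nv 9)))) (rset 2 (RDiv (ROfNat (NConst 1)) (RRead 1 (nv 9)))) Skip ;;
     nset 9 (NAdd (nv 9) (NConst 1)))"

text \<open>One pass over the fields yields the two numbers to be compared: \<open>2 ^ n\<close>, by
  doubling, and \<open>B\<close>, the maximum of 1 and all \<open>1 / lam i\<close>.\<close>

definition init :: com where
  "init = (rset 2 (ROfNat (NConst 1)) ;; nset 5 (NConst 1) ;; nset 9 (NConst 1) ;;
     While (BNot (NLess (nv 0) (nv 9))) init_body)"

text \<open>Doubling \<open>\<epsilon>\<close> until it reaches \<open>2 * n\<close>, and adding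
  \<open>2 * n\<close> to the counter each time, produces the logarithmic number of steps although
  no real can be converted to a natural number.\<close>

definition count_steps :: com where
  "count_steps = (rset 3 (RRead 0 (NConst 1)) ;; nset 4 (NConst 0) ;;
     While (RLess (rv 3) (ROfNat (NAdd (nv 0) (nv 0))))
       (rset 3 (RAdd (rv 3) (rv 3)) ;; nset 4 (NAdd (nv 4) (NAdd (nv 0) (nv 0)))))"

text \<open>Register 6 holds \<open>2 ^ n - 1\<close> here, so decoding it fills array 1 with the
  full set and the query returns the rank of the ground set.\<close>

definition choose_start :: com where
  "choose_start = Cond (RLess (ROfNat (nv 5)) (rv 2)) (decode ;; QueryRank 8 (NConst 0) 1 ;; search) Skip"

definition sampler :: com where
  "sampler = (init ;; count_steps ;; nset 6 (NSub (nv 5) (NConst 1)) ;; nset 7 (nv 6) ;; choose_start ;;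
     nset 6 (nv 7) ;; decode ;; chain_loop)"

definition doublings :: "nat \<Rightarrow> real \<Rightarrow> nat" where
  "doublings n \<epsilon> = (LEAST k. 2 * real n \<le> \<epsilon> * 2 ^ k)"

lemma doublings_upper:
  assumes "\<epsilon> > 0"
  shows "2 * real n \<le> \<epsilon> * 2 ^ doublings n \<epsilon>"
proof -
  obtain k where "2 * real n / \<epsilon> < 2 ^ k" using real_arch_pow[of 2 "2 * real n / \<epsilon>"] by auto
  then have "2 * real n \<le> \<epsilon> * 2 ^ k" using assms by (simp add: field_simps)
  then show ?thesis unfolding doublings_def by (rule LeastI)
qed

lemma doublings_lower: "k < doublings n \<epsilon> \<Longrightarrow> \<epsilon> * 2 ^ k < 2 * real n"
  unfolding doublings_def by (auto dest: not_less_Least)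

section \<open>Exhaustive search as a recursion on codes\<close>

context cluster_model
begin

text \<open>The best weight and its code after \<open>k\<close> rounds, with codes descending from
  \<open>2 ^ n - 1\<close>. The initial pair has weight 0, a lower bound for the weight of its
  code.\<close>

primrec scan :: "nat \<Rightarrow> real \<times> nat" where
  "scan 0 = (0, 2 ^ n - 1)"
| "scan (Suc k) = (if fst (scan k) < wt (sub n (2 ^ n - Suc k))
     then (wt (sub n (2 ^ n - Suc k)), 2 ^ n - Suc k) else scan k)"

lemma scan_best:
  "k \<le> 2 ^ n \<Longrightarrow> snd (scan k) < 2 ^ n \<and> fst (scan k) \<le> wt (sub n (snd (scan k))) \<and>
    (\<forall>c. 2 ^ n - k \<le> c \<and> c < 2 ^ n \<longrightarrow> wt (sub n c) \<le> fst (scan k))"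
proof (induction k)
  case 0
  then show ?case by (simp add: wt_nonneg)
next
  case (Suc k)
  define c where "c = 2 ^ n - Suc k"
  have c: "c < 2 ^ n" "2 ^ n - k = Suc c" using Suc.prems by (auto simp: c_def)
  have IH: "snd (scan k) < 2 ^ n" "fst (scan k) \<le> wt (sub n (snd (scan k)))"
    "\<And>c'. Suc c \<le> c' \<Longrightarrow> c' < 2 ^ n \<Longrightarrow> wt (sub n c') \<le> fst (scan k)"
    using Suc.IH Suc.prems c(2) by auto
  have step: "scan (Suc k) = (if fst (scan k) < wt (sub n c) then (wt (sub n c), c) else scan k)"
    by (simp add: c_def)
  have "wt (sub n c') \<le> fst (scan (Suc k))" if "c \<le> c'" "c' < 2 ^ n" for c'
  proof (cases "c' = c")
    case True
    then show ?thesis unfolding step by auto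
  next
    case False
    then have "wt (sub n c') \<le> fst (scan k)" using that by (intro IH(3)) auto
    then show ?thesis unfolding step by auto
  qed
  then show ?case using IH(1,2) c(1) unfolding c_def[symmetric] step by auto
qed

lemma scan_maximal: "S \<subseteq> ground \<Longrightarrow> wt S \<le> wt (sub n (snd (scan (2 ^ n))))"
  using sub_surj[of S n] scan_best[of "2 ^ n"] by fastforce

text \<open>Each element raises the rank by at most 1. This bounds the rounds of
  \<open>power_loop\<close>.\<close>

lemma rk_deficit_le:
  assumes "S \<subseteq> ground"
  shows "rk ground - rk S \<le> n"
proof -
  have "rk (S \<union> T) \<le> rk S + card T" if "finite T" for T
    using that
  proof (induction T rule: finite_induct)
    case (insert x T)
    then show ?case using rk_insert_le[of x "S \<union> T"] by simp
  qed simp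
  from this[of "ground - S"] have "rk ground \<le> rk S + card (ground - S)"
    using assms by (simp add: Un_absorb1)
  also have "card (ground - S) \<le> n" using card_mono[of ground "ground - S"] by auto
  finally show ?thesis by simp
qed

text \<open>The inserted 1 makes \<open>1 / B\<close> a probability, as the rejection step
  requires.\<close>

definition field_bound :: "nat \<Rightarrow> real" where
  "field_bound k = Max (insert 1 ((\<lambda>i. 1 / lam i) ` {1..k}))"

lemma field_bound_Suc: "field_bound (Suc k) = max (field_bound k) (1 / lam (Suc k))"
proof -
  have "insert 1 ((\<lambda>i. 1 / lam i) ` {1..Suc k}) = insert (1 / lam (Suc k)) (insert 1 ((\<lambda>i. 1 / lam i) ` {1..k}))"
  proof -
    have "{1..Suc k} = insert (Suc k) {1..k}" by auto
    then show ?thesis by (simp only: image_insert insert_commute)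
  qed
  then show ?thesis unfolding field_bound_def by (simp add: max.commute)
qed

end

section \<open>Cost bounds for search, initialisation and step counter\<close>

context cluster_machine
begin

definition search_cost :: real where
  "search_cost = 17 * a * n + 26 * a + b"

lemma search_cost_nonneg: "search_cost \<ge> 0"
  using a b by (simp add: search_cost_def)

lemma bounded_by_search:
  assumes base: "base s" and s: "nats s 5 0 = 2 ^ n" "nats s 7 0 = 2 ^ n - 1" "nats s 8 0 = rk ground" "nats s 4 0 = N"
    and r: "r \<ge> 0"
    and post: "\<And>s'. base s' \<Longrightarrow> nats s' 4 0 = N \<Longrightarrow> nats s' 7 0 = snd (scan (2 ^ n)) \<Longrightarrow> f s' \<sqsubseteq> r"
  shows "ert search f s \<sqsubseteq> 2 ^ n * search_cost + 5 * a + r"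
proof -
  have ab: "0 \<le> a + b" using a b by simp
  define I where "I k s' \<longleftrightarrow> k \<le> 2 ^ n \<and> base s' \<and> nats s' 6 0 = 2 ^ n - k \<and> nats s' 8 0 = rk ground \<and>
    nats s' 4 0 = N \<and> reals s' 5 0 = fst (scan k) \<and> nats s' 7 0 = snd (scan k)" for k s'
  define W where "W s' = a + real (nats s' 6 0) * search_cost + r" for s' :: store
  let ?s = "write_nat 6 0 (2 ^ n) (write_real 5 0 0 s)"
  have "ert (While (NLess (NConst 0) (nv 6)) search_body) f ?s \<sqsubseteq> W ?s"
  proof (rule bounded_by_While[where Inv = "\<lambda>s'. \<exists>k. I k s'"])
    have "I 0 ?s" using base s by (simp add: I_def base_def)
    then show "\<exists>k. I k ?s" by blast
    show "W s' \<ge> 0" for s' using a r search_cost_nonneg by (simp add: W_def)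
    show "f s' \<sqsubseteq> W s' - a" if inv: "\<exists>k. I k s'" and ex: "\<not> bval s' (NLess (NConst 0) (nv 6))" for s'
    proof -
      obtain k where k: "I k s'" using inv by blast
      then have "k = 2 ^ n" using ex by (simp add: I_def)
      then have "f s' \<sqsubseteq> r" using k by (intro post) (auto simp: I_def)
      then show ?thesis using ex by (simp add: W_def)
    qed
    fix s' F
    assume inv: "\<exists>k. I k s'" "bval s' (NLess (NConst 0) (nv 6))" and F: "\<And>s''. \<exists>k. I k s'' \<Longrightarrow> F s'' \<sqsubseteq> W s''"
    obtain k where k: "I k s'" using inv(1) by blast
    define c where "c = 2 ^ n - Suc k"
    have kn: "Suc k \<le> 2 ^ n" and n6: "nats s' 6 0 = Suc c" using k inv(2) by (auto simp: I_def c_def)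
    define S where "S = sub n c"
    have S: "S \<subseteq> ground" unfolding S_def by (rule sub_subset)
    define r' where "r' = a + real c * search_cost + r"
    have r': "r' \<ge> 0" using a r search_cost_nonneg by (simp add: r'_def)
    let ?cond = "Cond (RLess (rv 5) (rv 4)) (rset 5 (rv 4) ;; nset 7 (nv 6)) Skip"
    let ?tail = "QueryRank 12 (NConst 0) 1 ;; nset 12 (NSub (nv 8) (nv 12)) ;; power_loop ;; ?cond"
    let ?s1 = "write_nat 6 0 c s'"
    have base1: "base ?s1" using k by (simp add: I_def base_def)
    have "ert decode (ert ?tail F) ?s1 \<sqsubseteq> 13 * a * n + 10 * a + (11 * a + 4 * a * n + b + r')"
    proof (rule bounded_by_decode[OF base1])
      show "11 * a + 4 * a * n + b + r' \<ge> 0" using a b r' by simp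
      fix s2 assume fr: "frame {1, 2, 3, 9, 10, 11} {4} ?s1 s2" and good2: "good (sub n (nats ?s1 6 0)) s2"
        and w2: "reals s2 4 0 = (\<Prod>i\<in>ground - sub n (nats ?s1 6 0). 1 / lam i)"
      have good2: "good S s2" and w2: "reals s2 4 0 = (\<Prod>i\<in>ground - S. 1 / lam i)"
        using good2 w2 by (simp_all add: S_def)
      have s2: "nats s2 6 0 = c" "nats s2 8 0 = rk ground" "nats s2 4 0 = N" "reals s2 5 0 = fst (scan k)"
        "nats s2 7 0 = snd (scan k)"
        using k frame_nats[OF fr, of 6] frame_nats[OF fr, of 8] frame_nats[OF fr, of 4] frame_nats[OF fr, of 7]
          frame_reals[OF fr, of 5] by (simp_all add: I_def)
      have base2: "base s2" by (rule base_good[OF good2])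
      define d where "d = rk ground - rk S"
      let ?s3 = "write_nat 12 0 d (write_nat 12 0 (rk S) s2)"
      have power: "ert power_loop (ert ?cond F) ?s3 \<sqsubseteq> a + nats ?s3 12 0 * (4 * a) + (4 * a + r')"
      proof (rule bounded_by_power_loop)
        show "4 * a + r' \<ge> 0" using a r' by simp
        fix s4 assume fr4: "frame {12} {4} ?s3 s4" and w4: "reals s4 4 0 = reals ?s3 4 0 * reals ?s3 0 0 ^ nats ?s3 12 0"
        have s4: "nats s4 6 0 = c" "nats s4 8 0 = rk ground" "nats s4 4 0 = N" "reals s4 5 0 = fst (scan k)"
          "nats s4 7 0 = snd (scan k)"
          using s2 frame_nats[OF fr4, of 6] frame_nats[OF fr4, of 8] frame_nats[OF fr4, of 4] frame_nats[OF fr4, of 7]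
            frame_reals[OF fr4, of 5] by simp_all
        have "base ?s3" using base2 by (simp add: base_def)
        from base_frame[OF this fr4] have base4: "base s4" by simp
        have w: "reals s4 4 0 = wt S"
          using w4 base2 by (simp add: w2 base_def wt_def d_def mult.commute)
        have scan: "scan (Suc k) = (if fst (scan k) < wt S then (wt S, c) else scan k)"
          by (simp add: S_def c_def)
        show "ert ?cond F s4 \<sqsubseteq> 4 * a + r'"
        proof (cases "fst (scan k) < wt S")
          case True
          let ?s5 = "write_nat 7 0 c (write_real 5 0 (wt S) s4)"
          have "I (Suc k) ?s5" using True kn s4 base4 unfolding I_def scan by (simp add: base_def c_def)
          then have F5: "F ?s5 \<sqsubseteq> r'" using F[of ?s5] s4 by (auto simp: W_def r'_def)
          have eq: "ert ?cond F s4 = ennreal a + (ennreal a + (ennreal a + (ennreal a + F ?s5)))"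
            using True by (simp add: s4 w)
          show ?thesis unfolding eq
            by (rule bounded_by_mono, (rule bounded_by_add_right[OF a] F5)+) simp
        next
          case False
          have "I (Suc k) s4" using False kn s4 base4 unfolding I_def scan by (simp add: c_def)
          then have F4: "F s4 \<sqsubseteq> r'" using F[of s4] s4 by (auto simp: W_def r'_def)
          have eq: "ert ?cond F s4 = ennreal a + (ennreal a + F s4)"
            using False by (simp add: s4 w)
          show ?thesis unfolding eq
            by (rule bounded_by_mono, (rule bounded_by_add_right[OF a] F4)+) (use a in simp)
        qed
      qed
      have "d \<le> n" unfolding d_def by (rule rk_deficit_le[OF S])
      then have "real d * (4 * a) \<le> real n * (4 * a)" using a by (intro mult_right_mono) auto
      then have power': "ert power_loop (ert ?cond F) ?s3 \<sqsubseteq> 5 * a + 4 * a * n + r'"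
        by (intro bounded_by_mono[OF power]) (simp add: algebra_simps)
      have eq: "ert ?tail F s2 = ennreal a + (ennreal (a + b) + (ennreal a + (ennreal a + (ennreal a +
          ert power_loop (ert ?cond F) ?s3))))"
      proof -
        have q: "ert (QueryRank 12 (NConst 0) 1 ;; nset 12 (NSub (nv 8) (nv 12)) ;; power_loop ;; X) F s2
          = ennreal a + (ennreal (a + b) + (ennreal a + (ennreal a + (ennreal a + ert power_loop (ert X F) ?s3))))" for X
          using good2 by (simp add: good_def s2 d_def)
        show ?thesis by (rule q)
      qed
      show "ert ?tail F s2 \<sqsubseteq> 11 * a + 4 * a * n + b + r'"
        unfolding eq
        by (rule bounded_by_mono, (rule bounded_by_add_right[OF a] bounded_by_add_right[OF ab] power')+) (use a in simp)
    qed
    then have dec: "ert decode (ert ?tail F) ?s1 \<sqsubseteq> 17 * a * n + 21 * a + b + r'"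
      by (rule bounded_by_mono) (simp add: algebra_simps)
    have eq: "ert search_body F s' = ennreal a + (ennreal a + (ennreal a + ert decode (ert ?tail F) ?s1))"
    proof -
      have q: "ert (nset 6 (NSub (nv 6) (NConst 1)) ;; decode ;; X) F s' = ennreal a + (ennreal a + (ennreal a + ert decode (ert X F) ?s1))" for X
        by (simp add: n6)
      show ?thesis unfolding search_body_def by (rule q)
    qed
    have Ws: "W s' = a + search_cost + real c * search_cost + r" by (simp add: W_def n6 algebra_simps)
    show "ert search_body F s' \<sqsubseteq> W s' - a"
      unfolding eq Ws
      by (rule bounded_by_mono, (rule bounded_by_add_right[OF a] dec)+) (use a in \<open>simp add: r'_def search_cost_def\<close>)
  qed
  moreover have "W ?s = a + 2 ^ n * search_cost + r" by (simp add: W_def)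
  ultimately have loop: "ert (While (NLess (NConst 0) (nv 6)) search_body) f ?s \<sqsubseteq> a + 2 ^ n * search_cost + r" by simp
  have eq: "ert search f s = ennreal a + (ennreal a + (ennreal a + (ennreal a +
      ert (While (NLess (NConst 0) (nv 6)) search_body) f ?s)))"
    unfolding search_def by (simp add: s)
  show ?thesis unfolding eq
    by (rule bounded_by_mono, (rule bounded_by_add_right[OF a] loop)+) simp
qed

lemma bounded_by_init:
  assumes s: "nats s 0 0 = n" "\<And>i. i \<in> ground \<Longrightarrow> reals s 1 i = lam i" and r: "r \<ge> 0"
    and post: "\<And>s'. frame {5, 9} {2} s s' \<Longrightarrow> nats s' 5 0 = 2 ^ n \<Longrightarrow> reals s' 2 0 = field_bound n \<Longrightarrow> f s' \<sqsubseteq> r"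
  shows "ert init f s \<sqsubseteq> 7 * a * n + 7 * a + r"
proof -
  define I where "I k s' \<longleftrightarrow> frame {5, 9} {2} s s' \<and> k \<le> n \<and> nats s' 9 0 = Suc k \<and> nats s' 5 0 = 2 ^ k \<and>
    reals s' 2 0 = field_bound k" for k s'
  define W where "W s' = a + real (Suc n - nats s' 9 0) * (7 * a) + r" for s' :: store
  let ?s = "write_nat 9 0 1 (write_nat 5 0 1 (write_real 2 0 1 s))"
  have "ert (While (BNot (NLess (nv 0) (nv 9))) init_body) f ?s \<sqsubseteq> W ?s"
  proof (rule bounded_by_While[where Inv = "\<lambda>s'. \<exists>k. I k s'"])
    have "I 0 ?s" by (simp add: I_def field_bound_def)
    then show "\<exists>k. I k ?s" by blast
    show "W s' \<ge> 0" for s' using a r by (simp add: W_def)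
    show "f s' \<sqsubseteq> W s' - a" if inv: "\<exists>k. I k s'" and ex: "\<not> bval s' (BNot (NLess (nv 0) (nv 9)))" for s'
    proof -
      obtain k where k: "I k s'" using inv by blast
      then have "nats s' 0 0 = n" using frame_nats[of "{5, 9}" "{2}" s s' 0] s by (simp add: I_def)
      then have "k = n" using ex k by (simp add: I_def)
      then have "f s' \<sqsubseteq> r" using k by (intro post) (auto simp: I_def)
      then show ?thesis by (rule bounded_by_mono) (use a in \<open>simp add: W_def\<close>)
    qed
    fix s' F
    assume inv: "\<exists>k. I k s'" "bval s' (BNot (NLess (nv 0) (nv 9)))" and F: "\<And>s''. \<exists>k. I k s'' \<Longrightarrow> F s'' \<sqsubseteq> W s''"
    obtain k where k: "I k s'" using inv(1) by blast
    then have fr: "frame {5, 9} {2} s s'" and k': "nats s' 9 0 = Suc k" "nats s' 5 0 = 2 ^ k" "reals s' 2 0 = field_bound k"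
      by (auto simp: I_def)
    have n0: "nats s' 0 0 = n" using frame_nats[OF fr, of 0] s by simp
    have kn: "Suc k \<le> n" using inv(2) n0 k' by simp
    then have lam_k: "reals s' 1 (Suc k) = lam (Suc k)" using frame_reals[OF fr, of 1] s by simp
    have Wk: "W s' = a + (7 * a + real (n - Suc k) * (7 * a) + r)"
    proof -
      have "real (Suc n - Suc k) = 1 + real (n - Suc k)" using kn by simp
      then show ?thesis by (simp add: W_def k'(1) algebra_simps)
    qed
    show "ert init_body F s' \<sqsubseteq> W s' - a"
    proof (cases "field_bound k < 1 / lam (Suc k)")
      case True
      let ?t = "write_nat 9 0 (Suc (Suc k)) (write_real 2 0 (1 / lam (Suc k)) (write_nat 5 0 (2 ^ k + 2 ^ k) s'))"
      have "I (Suc k) ?t" using True kn fr by (simp add: I_def field_bound_Suc)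
      then have Ft: "F ?t \<sqsubseteq> a + real (n - Suc k) * (7 * a) + r" using F[of ?t] by (auto simp: W_def)
      have eq: "ert init_body F s' = ennreal a + (ennreal a + (ennreal a + (ennreal a + (ennreal a + (ennreal a + F ?t)))))"
        unfolding init_body_def using True by (simp add: k' lam_k Suc_eq_plus1[symmetric])
      show ?thesis unfolding eq Wk
        by (rule bounded_by_mono, (rule bounded_by_add_right[OF a] Ft)+) (use a in simp)
    next
      case False
      let ?t = "write_nat 9 0 (Suc (Suc k)) (write_nat 5 0 (2 ^ k + 2 ^ k) s')"
      have "I (Suc k) ?t" using False kn fr k' by (simp add: I_def field_bound_Suc)
      then have Ft: "F ?t \<sqsubseteq> a + real (n - Suc k) * (7 * a) + r" using F[of ?t] by (auto simp: W_def)
      have eq: "ert init_body F s' = ennreal a + (ennreal a + (ennreal a + (ennreal a + (ennreal a + (ennreal a + F ?t)))))"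
        unfolding init_body_def using False by (simp add: k' lam_k Suc_eq_plus1[symmetric])
      show ?thesis unfolding eq Wk
        by (rule bounded_by_mono, (rule bounded_by_add_right[OF a] Ft)+) (use a in simp)
    qed
  qed
  moreover have "W ?s = a + n * (7 * a) + r" by (simp add: W_def Suc_eq_plus1)
  ultimately have loop: "ert (While (BNot (NLess (nv 0) (nv 9))) init_body) f ?s \<sqsubseteq> a + n * (7 * a) + r" by simp
  have eq: "ert init f s = ennreal a + (ennreal a + (ennreal a + (ennreal a + (ennreal a + (ennreal a +
      ert (While (BNot (NLess (nv 0) (nv 9))) init_body) f ?s)))))"
    unfolding init_def by simp
  show ?thesis unfolding eq
    by (rule bounded_by_mono, (rule bounded_by_add_right[OF a] loop)+) (simp add: algebra_simps)
qed

lemma bounded_by_count_steps: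
  assumes s: "nats s 0 0 = n" and \<epsilon>: "reals s 0 1 = \<epsilon>" "\<epsilon> > 0" and r: "r \<ge> 0"
    and post: "\<And>s'. frame {4} {3} s s' \<Longrightarrow> nats s' 4 0 = 2 * n * doublings n \<epsilon> \<Longrightarrow> f s' \<sqsubseteq> r"
  shows "ert count_steps f s \<sqsubseteq> 4 * a * doublings n \<epsilon> + 5 * a + r"
proof -
  define K where "K = doublings n \<epsilon>"
  define I where "I j s' \<longleftrightarrow> frame {4} {3} s s' \<and> j \<le> K \<and> reals s' 3 0 = \<epsilon> * 2 ^ j \<and> nats s' 4 0 = 2 * n * j" for j s'
  \<comment> \<open>Register 4 grows by \<open>2 * n\<close> per round, so the quotient recovers the
    number of rounds already made.\<close>
  define W where "W s' = a + real (K - nats s' 4 0 div (2 * n)) * (4 * a) + r" for s' :: store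
  let ?s = "write_nat 4 0 0 (write_real 3 0 \<epsilon> s)"
  let ?guard = "RLess (rv 3) (ROfNat (NAdd (nv 0) (nv 0)))"
  let ?body = "rset 3 (RAdd (rv 3) (rv 3)) ;; nset 4 (NAdd (nv 4) (NAdd (nv 0) (nv 0)))"
  have "ert (While ?guard ?body) f ?s \<sqsubseteq> W ?s"
  proof (rule bounded_by_While[where Inv = "\<lambda>s'. \<exists>j. I j s'"])
    have "I 0 ?s" by (simp add: I_def)
    then show "\<exists>j. I j ?s" by blast
    show "W s' \<ge> 0" for s' using a r by (simp add: W_def)
    show "f s' \<sqsubseteq> W s' - a" if inv: "\<exists>j. I j s'" and ex: "\<not> bval s' ?guard" for s'
    proof -
      obtain j where j: "I j s'" using inv by blast
      then have "nats s' 0 0 = n" using frame_nats[of "{4}" "{3}" s s' 0] s by (simp add: I_def)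
      then have "\<not> j < K" using ex j doublings_lower[of j n \<epsilon>] by (auto simp: I_def K_def)
      then have "f s' \<sqsubseteq> r" using j by (intro post) (auto simp: I_def K_def)
      then show ?thesis by (rule bounded_by_mono) (use a in \<open>simp add: W_def\<close>)
    qed
    fix s' F
    assume inv: "\<exists>j. I j s'" "bval s' ?guard" and F: "\<And>s''. \<exists>j. I j s'' \<Longrightarrow> F s'' \<sqsubseteq> W s''"
    obtain j where j: "I j s'" using inv(1) by blast
    then have fr: "frame {4} {3} s s'" and j': "j \<le> K" "reals s' 3 0 = \<epsilon> * 2 ^ j" "nats s' 4 0 = 2 * n * j"
      by (auto simp: I_def)
    have n0: "nats s' 0 0 = n" using frame_nats[OF fr, of 0] s by simp
    have "j \<noteq> K" using inv(2) j' n0 doublings_upper[OF \<epsilon>(2), of n] by (auto simp: K_def)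
    then have jK: "Suc j \<le> K" using j' by simp
    let ?t = "write_nat 4 0 (2 * n * Suc j) (write_real 3 0 (\<epsilon> * 2 ^ Suc j) s')"
    have "I (Suc j) ?t" using jK fr by (simp add: I_def)
    moreover have "2 * n * Suc j div (2 * n) = Suc j" using n by (intro nonzero_mult_div_cancel_left) simp
    ultimately have Ft: "F ?t \<sqsubseteq> a + real (K - Suc j) * (4 * a) + r" using F[of ?t] by (auto simp: W_def)
    have "2 * n * j + (n + n) = 2 * n * Suc j" "\<epsilon> * 2 ^ j + \<epsilon> * 2 ^ j = \<epsilon> * 2 ^ Suc j" by simp_all
    then have eq: "ert ?body F s' = ennreal a + (ennreal a + (ennreal a + F ?t))"
      by (simp only: ert.simps nval.simps rval.simps store_access fun_upd_same if_True if_False j' n0 simp_thms)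
    have "2 * n * j div (2 * n) = j" using n by (intro nonzero_mult_div_cancel_left) simp
    then have Wj: "W s' = a + (4 * a + real (K - Suc j) * (4 * a) + r)"
    proof -
      have W1: "W s' = a + real (K - j) * (4 * a) + r"
        unfolding W_def j'(3) \<open>2 * n * j div (2 * n) = j\<close> ..
      have "real (K - j) = 1 + real (K - Suc j)" using jK by simp
      then show ?thesis unfolding W1 by (simp add: algebra_simps)
    qed
    show "ert ?body F s' \<sqsubseteq> W s' - a" unfolding eq Wj
      by (rule bounded_by_mono, (rule bounded_by_add_right[OF a] Ft)+) (use a in simp)
  qed
  moreover have "W ?s = a + K * (4 * a) + r" by (simp add: W_def)
  ultimately have loop: "ert (While ?guard ?body) f ?s \<sqsubseteq> a + K * (4 * a) + r" by simp
  have eq: "ert count_steps f s = ennreal a + (ennreal a + (ennreal a + (ennreal a + ert (While ?guard ?body) f ?s)))"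
    unfolding count_steps_def by (simp add: \<epsilon>)
  show ?thesis unfolding eq
    by (rule bounded_by_mono, (rule bounded_by_add_right[OF a] loop)+) (simp add: K_def algebra_simps)
qed

end

section \<open>The start set and the mixing time\<close>

context cluster_model
begin

definition start_set :: "nat set" where
  "start_set = sub n (if 2 ^ n < field_bound n then snd (scan (2 ^ n)) else 2 ^ n - 1)"

lemma start_set_subset: "start_set \<subseteq> ground"
  unfolding start_set_def by (rule sub_subset)

lemma field_bound_ge: "field_bound n \<ge> 1" "i \<in> ground \<Longrightarrow> 1 / lam i \<le> field_bound n"
  unfolding field_bound_def by (intro Max_ge; simp)+

text \<open>After a search the start is maximal. Otherwise the start is the full set, of weight 1,
  and any other weight is a power of \<open>q\<close> times at most \<open>n\<close> factors, each
  at most \<open>2 ^ n\<close>.\<close>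

lemma wt_le_start:
  assumes "S \<subseteq> ground"
  shows "wt S \<le> 2 ^ (n * n) * wt start_set"
proof (cases "2 ^ n < field_bound n")
  case True
  then have "wt S \<le> wt start_set" using scan_maximal[OF assms] by (simp add: start_set_def)
  also have "\<dots> \<le> 2 ^ (n * n) * wt start_set"
    using wt_nonneg[of start_set] by (simp add: mult_le_cancel_right1 not_less)
  finally show ?thesis .
next
  case False
  then have "start_set = ground" by (simp add: start_set_def sub_full)
  have "wt S \<le> 1 * (\<Prod>i\<in>ground - S. field_bound n)"
    unfolding wt_def
  proof (intro mult_mono prod_mono conjI power_le_one)
    show "0 \<le> 1 / lam i" "1 / lam i \<le> field_bound n" if "i \<in> ground - S" for i
      using that lam[of i] field_bound_ge(2)[of i] by auto
    show "0 \<le> (\<Prod>i\<in>ground - S. 1 / lam i)" using lam by (intro prod_nonneg) (auto intro: less_imp_le)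
  qed (use q in auto)
  also have "\<dots> = field_bound n ^ card (ground - S)" by simp
  also have "\<dots> \<le> field_bound n ^ n"
    using field_bound_ge(1) card_mono[of ground "ground - S"] by (intro power_increasing) auto
  also have "\<dots> \<le> (2 ^ n) ^ n" using False field_bound_ge(1) by (intro power_mono) auto
  also have "\<dots> = 2 ^ (n * n) * wt start_set" by (simp add: \<open>start_set = ground\<close> wt_ground power_mult)
  finally show ?thesis .
qed

text \<open>The partition function has \<open>2 ^ n\<close> summands, each at most
  \<open>2 ^ (n * n)\<close> times the weight of the start; \<open>n + n * n \<le> 2 * n * n\<close>
  gives the second bound.\<close>

lemma gibbs_start:
  shows "gibbs start_set > 0" and "ln (1 / gibbs start_set) \<le> 2 * (real n)\<^sup>2"
proof -
  have "1 \<le> 2 ^ (n * n) * wt start_set" using wt_le_start[of ground] by (simp add: wt_ground)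
  then have w: "wt start_set > 0" using wt_nonneg[of start_set] by (cases "wt start_set = 0") auto
  then show pos: "gibbs start_set > 0" using partition_function_pos by (simp add: gibbs_def)
  have "partition_function \<le> (\<Sum>S\<in>Pow ground. 2 ^ (n * n) * wt start_set)"
    unfolding partition_function_def by (intro sum_mono wt_le_start) auto
  also have "\<dots> = 2 ^ n * (2 ^ (n * n) * wt start_set)" by (simp add: card_Pow)
  finally have "1 / gibbs start_set \<le> 2 ^ (n + n * n)"
    using w by (simp add: gibbs_def divide_le_eq power_add)
  then have "ln (1 / gibbs start_set) \<le> ln (2 ^ (n + n * n))" using pos by (subst ln_le_cancel_iff) auto
  also have "\<dots> = real (n + n * n) * ln 2" by (simp add: ln_realpow)
  also have "\<dots> \<le> real (n * n + n * n) * 1"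
    using n ln_2_less_1 by (intro mult_mono) auto
  finally show "ln (1 / gibbs start_set) \<le> 2 * (real n)\<^sup>2" by (simp add: power2_eq_square)
qed

text \<open>Every \<open>n\<close> steps at least halve the entropy. With \<open>K\<close>
  doublings, \<open>2 * n * K\<close> steps reduce \<open>2 * n\<^sup>2\<close> by the factor
  \<open>2 ^ (2 * K)\<close>, which is at least \<open>(2 * n / \<epsilon>)\<^sup>2\<close>. The 2
  in \<open>N\<close> compensates for the square root in the passage from entropy to total
  variation.\<close>

lemma mixing:
  assumes \<epsilon>: "\<epsilon> > 0"
  defines "N \<equiv> 2 * n * doublings n \<epsilon>"
  shows "tv_distance (Pow ground) ((chain_step ^^ N) (indicator {start_set})) gibbs \<le> \<epsilon>"
proof -
  define \<mu> where "\<mu> = (chain_step ^^ N) (indicator {start_set})"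
  define K where "K = doublings n \<epsilon>"
  note law = start_set_subset gibbs_start(1)
  have "(tv_distance (Pow ground) \<mu> gibbs)\<^sup>2 \<le> relative_entropy (Pow ground) \<mu> gibbs"
    unfolding \<mu>_def
    by (rule total_variation_le_entropy)
      (auto simp: chain_law_nonneg[OF law] chain_law_sum[OF law] gibbs_nonneg sum_gibbs intro: chain_law_zero[OF law])
  also have "\<dots> \<le> (1 - 1 / n) ^ N * ln (1 / gibbs start_set)"
    unfolding \<mu>_def by (rule chain_law_entropy[OF law])
  also have "\<dots> \<le> (1 / 2) ^ (2 * K) * (2 * (real n)\<^sup>2)"
  proof (rule mult_mono)
    have "(1 - 1 / real n) ^ n \<le> exp (- 1 / real n) ^ n"
      using n exp_ge_add_one_self[of "- 1 / real n"] by (intro power_mono) auto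
    also have "\<dots> = exp (- 1)" using n by (simp add: exp_of_nat_mult[symmetric])
    also have "\<dots> \<le> 1 / 2" using exp_ge_add_one_self[of 1] by (simp add: exp_minus field_simps)
    finally have "((1 - 1 / real n) ^ n) ^ (2 * K) \<le> (1 / 2) ^ (2 * K)"
      using n by (intro power_mono) auto
    then show "(1 - 1 / real n) ^ N \<le> (1 / 2) ^ (2 * K)"
      by (simp add: N_def K_def power_mult[symmetric] mult.commute mult.left_commute)
    have "gibbs start_set \<le> 1"
      using member_le_sum[of start_set "Pow ground" gibbs] start_set_subset gibbs_nonneg by (simp add: sum_gibbs)
    then show "0 \<le> ln (1 / gibbs start_set)" using gibbs_start(1) by simp
  qed (use gibbs_start(2) in auto)
  also have "\<dots> \<le> \<epsilon>\<^sup>2"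
  proof -
    have "(2 * real n)\<^sup>2 \<le> (\<epsilon> * 2 ^ K)\<^sup>2"
      using doublings_upper[OF \<epsilon>, of n] unfolding K_def by (intro power_mono) auto
    then have "4 * (real n)\<^sup>2 \<le> \<epsilon>\<^sup>2 * 2 ^ (2 * K)"
      by (simp add: power_mult_distrib power_mult[symmetric] mult.commute)
    then have "2 * (real n)\<^sup>2 \<le> \<epsilon>\<^sup>2 * 2 ^ (2 * K)"
      using zero_le_power2[of "real n"] by linarith
    then show ?thesis by (simp add: power_divide divide_le_eq)
  qed
  finally have "tv_distance (Pow ground) \<mu> gibbs \<le> \<epsilon>" by (rule power2_le_imp_le) (rule less_imp_le[OF \<epsilon>])
  then show ?thesis unfolding \<mu>_def .
qed

end

section \<open>Cost and output of the whole sampler\<close>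

context cluster_machine
begin

definition sampler_cost :: "real \<Rightarrow> real" where
  "sampler_cost \<epsilon> = 40 * a * n + 70 * a + 4 * a * doublings n \<epsilon> + b + (if 2 ^ n < B then 2 ^ n * search_cost else 0)
    + 2 * real n * doublings n \<epsilon> * (iteration_cost + 3 * a)"

lemma bounded_by_sampler:
  assumes s: "nats s 0 0 = n" "reals s 0 0 = q" "reals s 0 1 = \<epsilon>" "\<And>i. i \<in> ground \<Longrightarrow> reals s 1 i = lam i"
    and \<epsilon>: "\<epsilon> > 0" and Bf: "B = field_bound n"
    and g: "\<And>X. X \<subseteq> ground \<Longrightarrow> g X \<ge> 0"
    and post: "\<And>s' X. good X s' \<Longrightarrow> f s' \<sqsubseteq> g X"
  shows "ert sampler f s \<sqsubseteq> sampler_cost \<epsilon> + (step_mean ^^ (2 * n * doublings n \<epsilon>)) g start_set"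
proof -
  have ab: "0 \<le> a + b" using a b by simp
  define K where "K = doublings n \<epsilon>"
  define N where "N = 2 * n * K"
  define best where "best = (if 2 ^ n < B then snd (scan (2 ^ n)) else 2 ^ n - 1)"
  have start: "start_set = sub n best" by (simp add: start_set_def best_def Bf)
  have pos: "(step_mean ^^ k) g X \<ge> 0" if "X \<subseteq> ground" for k X
    using that by (induction k arbitrary: X) (auto intro: g step_mean_nonneg)
  \<comment> \<open>The value of the chain loop from the chosen start. The bounds of the preceding
    program parts are added to it from the back of the program to the front.\<close>
  define R where "R = a + real N * (iteration_cost + 3 * a) + (step_mean ^^ N) g start_set"
  have R: "R \<ge> 0"
    unfolding R_def using a iteration_cost_nonneg pos[OF start_set_subset]
    by (intro add_nonneg_nonneg mult_nonneg_nonneg) auto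
  let ?fin = "nset 6 (nv 7) ;; decode ;; chain_loop"
  have fin: "ert ?fin f t \<sqsubseteq> 13 * a * n + 13 * a + R" if t: "base t" "nats t 4 0 = N" "nats t 7 0 = best" for t
  proof -
    let ?t = "write_nat 6 0 best t"
    have "ert decode (ert chain_loop f) ?t \<sqsubseteq> 13 * a * n + 10 * a + R"
    proof (rule bounded_by_decode[OF _ R])
      show "base ?t" using t by (simp add: base_def)
      fix s' assume fr: "frame {1, 2, 3, 9, 10, 11} {4} ?t s'" and "good (sub n (nats ?t 6 0)) s'"
      then have good: "good start_set s'" by (simp add: start)
      have N': "nats s' 4 0 = N" using frame_nats[OF fr, of 4] t by simp
      show "ert chain_loop f s' \<sqsubseteq> R"
        using bounded_by_chain_loop[OF good, of g f] g post unfolding R_def N' by blast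
    qed
    then have "ennreal a + (ennreal a + (ennreal a + ert decode (ert chain_loop f) ?t))
      \<sqsubseteq> a + (a + (a + (13 * a * n + 10 * a + R)))" by (intro bounded_by_add_right a)
    then show ?thesis using t by (simp add: algebra_simps)
  qed
  define R' where "R' = 13 * a * n + 13 * a + R"
  have R': "R' \<ge> 0" using a R by (simp add: R'_def)
  define extra where "extra = (if 2 ^ n < B then 2 ^ n * search_cost else 0)"
  have choose: "ert choose_start (ert ?fin f) t \<sqsubseteq> 13 * a * n + 19 * a + b + extra + R'"
    if t: "base t" "nats t 4 0 = N" "nats t 5 0 = 2 ^ n" "nats t 6 0 = 2 ^ n - 1" "nats t 7 0 = 2 ^ n - 1" for t
  proof (cases "2 ^ n < B")
    case True
    have search: "ert (QueryRank 8 (NConst 0) 1 ;; search) (ert ?fin f) t'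
       \<sqsubseteq> a + ((a + b) + (2 ^ n * search_cost + 5 * a + R'))"
      if fr: "frame {1, 2, 3, 9, 10, 11} {4} t t'" and good: "good ground t'" for t'
    proof -
      let ?t' = "write_nat 8 0 (rk ground) t'"
      have "ert search (ert ?fin f) ?t' \<sqsubseteq> 2 ^ n * search_cost + 5 * a + R'"
      proof (rule bounded_by_search[OF _ _ _ _ _ R'])
        show "base ?t'" using good by (simp add: good_def base_def)
        show "nats ?t' 5 0 = 2 ^ n" "nats ?t' 7 0 = 2 ^ n - 1" "nats ?t' 8 0 = rk ground" "nats ?t' 4 0 = N"
          using t frame_nats[OF fr, of 5] frame_nats[OF fr, of 7] frame_nats[OF fr, of 4] by simp_all
        show "ert ?fin f u \<sqsubseteq> R'" if "base u" "nats u 4 0 = N" "nats u 7 0 = snd (scan (2 ^ n))" for u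
          unfolding R'_def using that True by (intro fin) (auto simp: best_def)
      qed
      then have "ennreal a + (ennreal (a + b) + ert search (ert ?fin f) ?t')
        \<sqsubseteq> a + ((a + b) + (2 ^ n * search_cost + 5 * a + R'))"
        by (intro bounded_by_add_right a ab)
      moreover have "ert (QueryRank 8 (NConst 0) 1 ;; search) h t' = ennreal a + (ennreal (a + b) + ert search h ?t')" for h
        using good by (simp add: good_def)
      ultimately show ?thesis by simp
    qed
    have "ert decode (ert (QueryRank 8 (NConst 0) 1 ;; search) (ert ?fin f)) t
      \<sqsubseteq> 13 * a * n + 10 * a + (a + ((a + b) + (2 ^ n * search_cost + 5 * a + R')))"
    proof (rule bounded_by_decode[OF t(1)])
      show "0 \<le> a + ((a + b) + (2 ^ n * search_cost + 5 * a + R'))"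
        using a b R' search_cost_nonneg by simp
      show "ert (QueryRank 8 (NConst 0) 1 ;; search) (ert ?fin f) t' \<sqsubseteq> a + ((a + b) + (2 ^ n * search_cost + 5 * a + R'))"
        if "frame {1, 2, 3, 9, 10, 11} {4} t t'" "good (sub n (nats t 6 0)) t'" for t'
        using search that t(4) by (simp add: sub_full del: ert.simps)
    qed
    then have "ennreal a + (ennreal a + ert decode (ert (QueryRank 8 (NConst 0) 1 ;; search) (ert ?fin f)) t)
      \<sqsubseteq> a + (a + (13 * a * n + 10 * a + (a + ((a + b) + (2 ^ n * search_cost + 5 * a + R')))))"
      by (intro bounded_by_add_right a)
    moreover have "ert choose_start h t = ennreal a + (ennreal a + ert decode (ert (QueryRank 8 (NConst 0) 1 ;; search) h) t)" for h
      unfolding choose_start_def using t True by (simp add: base_def)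
    ultimately have "ert choose_start (ert ?fin f) t
      \<sqsubseteq> a + (a + (13 * a * n + 10 * a + (a + ((a + b) + (2 ^ n * search_cost + 5 * a + R')))))"
      by (simp only:)
    then show ?thesis by (rule bounded_by_mono) (use True in \<open>simp add: extra_def\<close>)
  next
    case False
    have "ert ?fin f t \<sqsubseteq> R'" unfolding R'_def using t False by (intro fin) (auto simp: best_def)
    then have "ennreal a + (ennreal a + ert ?fin f t) \<sqsubseteq> a + (a + R')" by (intro bounded_by_add_right a)
    moreover have "ert choose_start h t = ennreal a + (ennreal a + h t)" for h
      unfolding choose_start_def using t False by (simp add: base_def)
    ultimately have "ert choose_start (ert ?fin f) t \<sqsubseteq> a + (a + R')" by (simp only:)
    then show ?thesis by (rule bounded_by_mono) (use a b False in \<open>simp add: extra_def\<close>)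
  qed
  define R2 where "R2 = 13 * a * n + 19 * a + b + extra + R'"
  have extra: "extra \<ge> 0" using search_cost_nonneg by (simp add: extra_def)
  have R2: "R2 \<ge> 0" using a b R' extra by (simp add: R2_def)
  let ?rest = "nset 6 (NSub (nv 5) (NConst 1)) ;; nset 7 (nv 6) ;; choose_start ;; ?fin"
  have rest: "ert ?rest f t \<sqsubseteq> 5 * a + R2" if t: "base t" "nats t 4 0 = N" "nats t 5 0 = 2 ^ n" for t
  proof -
    let ?t = "write_nat 7 0 (2 ^ n - 1) (write_nat 6 0 (2 ^ n - 1) t)"
    have "ert choose_start (ert ?fin f) ?t \<sqsubseteq> R2"
      unfolding R2_def using t by (intro choose) (simp_all add: base_def)
    then have "ennreal a + (ennreal a + (ennreal a + (ennreal a + (ennreal a + ert choose_start (ert ?fin f) ?t))))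
      \<sqsubseteq> a + (a + (a + (a + (a + R2))))" by (intro bounded_by_add_right a)
    moreover have "ert (nset 6 (NSub (nv 5) (NConst 1)) ;; nset 7 (nv 6) ;; choose_start ;; c) h t
      = ennreal a + (ennreal a + (ennreal a + (ennreal a + (ennreal a + ert choose_start (ert c h) ?t))))" for c h
      using t by simp
    ultimately have "ert ?rest f t \<sqsubseteq> a + (a + (a + (a + (a + R2))))" by (simp only:)
    then show ?thesis by (rule bounded_by_mono) simp
  qed
  have "ert init (ert (count_steps ;; ?rest) f) s \<sqsubseteq> 7 * a * n + 7 * a + (a + (4 * a * K + 5 * a + (5 * a + R2)))"
  proof (rule bounded_by_init)
    show "0 \<le> a + (4 * a * K + 5 * a + (5 * a + R2))" using a R2 by simp
    fix t assume fr: "frame {5, 9} {2} s t" and t: "nats t 5 0 = 2 ^ n" "reals t 2 0 = field_bound n"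
    have t0: "nats t 0 = nats s 0" "reals t 0 = reals s 0" "reals t 1 = reals s 1"
      by (rule frame_nats[OF fr] frame_reals[OF fr]; simp)+
    have base_t: "base t" unfolding base_def using t0 t s Bf by simp
    have "ert count_steps (ert ?rest f) t \<sqsubseteq> 4 * a * K + 5 * a + (5 * a + R2)"
      unfolding K_def
    proof (rule bounded_by_count_steps)
      show "nats t 0 0 = n" "reals t 0 1 = \<epsilon>" using t0 s by simp_all
      show "0 \<le> 5 * a + R2" using a R2 by simp
      fix u assume fr': "frame {4} {3} t u" and u: "nats u 4 0 = 2 * n * doublings n \<epsilon>"
      show "ert ?rest f u \<sqsubseteq> 5 * a + R2"
      proof (rule rest)
        show "base u" by (rule base_frame[OF base_t fr']) auto
        show "nats u 4 0 = N" using u by (simp add: N_def K_def)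
        show "nats u 5 0 = 2 ^ n" using frame_nats[OF fr', of 5] t by simp
      qed
    qed (rule \<epsilon>)
    then show "ert (count_steps ;; ?rest) f t \<sqsubseteq> a + (4 * a * K + 5 * a + (5 * a + R2))"
      by (intro bounded_by_Seq) simp
  qed (use s in auto)
  then have "ert sampler f s \<sqsubseteq> a + (7 * a * n + 7 * a + (a + (4 * a * K + 5 * a + (5 * a + R2))))"
    unfolding sampler_def by (intro bounded_by_Seq) simp
  then have "ert sampler f s \<sqsubseteq> sampler_cost \<epsilon> + (step_mean ^^ N) g start_set"
  proof (rule bounded_by_mono)
    have "a * real n \<ge> 0" using a by simp
    moreover have "a + (7 * a * n + 7 * a + (a + (4 * a * K + 5 * a + (5 * a + R2))))
      = 33 * (a * real n) + 52 * a + 4 * a * K + b + extra + real N * (iteration_cost + 3 * a) + (step_mean ^^ N) g start_set"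
      unfolding R2_def R'_def R_def by (simp add: algebra_simps)
    moreover have "sampler_cost \<epsilon> = 40 * (a * real n) + 70 * a + 4 * a * K + b + extra + real N * (iteration_cost + 3 * a)"
      unfolding sampler_cost_def K_def[symmetric] extra_def[symmetric] N_def by simp
    ultimately show "a + (7 * a * n + 7 * a + (a + (4 * a * K + 5 * a + (5 * a + R2))))
      \<le> sampler_cost \<epsilon> + (step_mean ^^ N) g start_set" using a by linarith
  qed
  then show ?thesis unfolding N_def K_def .
qed

end

section \<open>Output law and running time\<close>

lemma bits_le_ln:
  assumes "n \<ge> 2"
  shows "real (bits n) + 1 \<le> 5 * ln n"
proof -
  have ln2: "ln 2 \<ge> (2 / 3 :: real)" by (rule ln2_ge_two_thirds)
  have lnn: "ln 2 \<le> ln (real n)" using assms by simp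
  have "(real (bits n) - 1) * ln 2 \<le> ln n"
  proof (cases "bits n")
    case 0
    have "- ln 2 \<le> ln (real n)" using ln2 lnn by linarith
    then show ?thesis using 0 by simp
  next
    case (Suc e)
    then have "2 ^ e < n" using bits_lower[of e n] by simp
    then have "real (2 ^ e) < real n" by (rule of_nat_less_iff[THEN iffD2])
    then have "ln (2 ^ e) \<le> ln (real n)" using assms by (intro ln_mono) auto
    then show ?thesis by (simp add: Suc ln_realpow)
  qed
  moreover have "(real (bits n) - 1) * (2 / 3) \<le> (real (bits n) - 1) * ln 2 \<or> bits n = 0"
    using mult_left_mono[OF ln2, of "real (bits n) - 1"] by (cases "bits n") auto
  ultimately have "(real (bits n) - 1) * (2 / 3) \<le> ln n \<or> bits n = 0" by linarith
  then show ?thesis using ln2 lnn by auto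
qed

lemma doublings_le_ln:
  assumes "n \<ge> 2" "0 < \<epsilon>" "\<epsilon> < 1"
  shows "real (doublings n \<epsilon>) \<le> 5 * ln (n / \<epsilon>)"
proof -
  have ln2: "ln 2 \<ge> (2 / 3 :: real)" by (rule ln2_ge_two_thirds)
  have "ln (real n) \<le> ln (n / \<epsilon>)" using assms by (simp add: le_divide_eq)
  moreover have "ln 2 \<le> ln (real n)" using assms by simp
  ultimately have L: "ln 2 \<le> ln (n / \<epsilon>)" by simp
  show ?thesis
  proof (cases "doublings n \<epsilon>")
    case 0
    then show ?thesis using L ln2 by simp
  next
    case (Suc k)
    then have "\<epsilon> * 2 ^ k < 2 * real n" by (intro doublings_lower) simp
    then have "2 ^ k < 2 * (n / \<epsilon>)" using assms by (simp add: field_simps)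
    then have "ln (2 ^ k) \<le> ln (2 * (n / \<epsilon>))" using assms by (intro ln_mono) auto
    also have "ln (2 * (n / \<epsilon>)) = ln 2 + ln (n / \<epsilon>)" using assms by (intro ln_mult_pos) auto
    finally have "real k * ln 2 \<le> ln 2 + ln (n / \<epsilon>)" by (simp add: ln_realpow)
    moreover have "real k * (2 / 3) \<le> real k * ln 2" using ln2 by (intro mult_left_mono) auto
    ultimately show ?thesis using L ln2 Suc by simp
  qed
qed

text \<open>Here \<open>N\<close> is the size, \<open>L\<close> and \<open>M\<close> are the two
  logarithms, \<open>Y\<close> is the factor from the fields, \<open>b\<close> and \<open>K\<close>
  count bits and doublings, and \<open>P\<close> is the number of searched codes. The lower bound
  2/3, from \<open>ln 2\<close>, allows lower-order terms to be absorbed into the product.\<close>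

lemma sampler_cost_arithmetic:
  fixes N L M t Y P b K :: real
  assumes L: "L \<ge> 2 / 3" and M: "M \<ge> 2 / 3" and t: "t \<ge> 0" and Y: "Y \<ge> 1" and N: "N \<ge> 1"
    and b: "b \<ge> 0" "b \<le> 5 * L" and K: "K \<ge> 0" "K \<le> 5 * M" and P: "P \<ge> 0" "P \<le> Y" and B: "B \<ge> 0" "B \<le> Y"
  shows "40 * N + 70 + 4 * K + t + P * (17 * N + 26 + t)
      + 2 * N * K * (15 * b + 30 + t + 2 * B * (15 * b + 40 + t) + 3)
    \<le> 5000 * (Y * N * M * (L + t))"
proof -
  define Q where "Q = Y * N * M * (L + t)"
  have Lt: "L + t \<ge> 2 / 3" using L t by simp
  have YN: "Y * N \<ge> N" "Y * N \<ge> 1" using Y N by (simp_all add: mult_ge1_I)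
  have NM: "N * M * (L + t) \<ge> N * (2 / 3) * (L + t)" "N * M * (L + t) \<ge> 0"
    using mult_right_mono[OF mult_left_mono[OF M, of N], of "L + t"] N M Lt by auto
  have Q1: "N * M * (L + t) \<le> Q"
    using Y NM(2) mult_right_mono[of 1 Y "N * M * (L + t)"] by (simp add: Q_def mult.assoc)
  have nLt: "N * (2 / 3) * (2 / 3) \<le> N * (2 / 3) * (L + t)" using N Lt by (intro mult_left_mono) auto
  have NQ: "N \<le> 3 * Q" using NM nLt Q1 by simp
  have one: "1 \<le> 3 * Q" using NQ N by simp
  have tQ: "t \<le> 2 * Q"
  proof -
    have "1 * (2 / 3) * t \<le> N * M * (L + t)" using N M L t by (intro mult_mono) auto
    then show ?thesis using Q1 t by simp
  qed
  have KQ: "K \<le> 8 * Q"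
  proof -
    have "1 * M * (2 / 3) \<le> N * M * (L + t)" using N M Lt by (intro mult_mono) auto
    then show ?thesis using Q1 K by simp
  qed
  have PQ: "P * (17 * N + 26 + t) \<le> 120 * Q"
  proof -
    have "17 * N + 26 + t \<le> 120 * (N * M * (L + t))"
    proof -
      have "N * (4 / 9) \<le> N * M * (L + t)" using NM nLt by simp
      moreover have "1 * (2 / 3) * t \<le> N * M * (L + t)" using N M L t by (intro mult_mono) auto
      ultimately show ?thesis using N t by linarith
    qed
    then have "P * (17 * N + 26 + t) \<le> Y * (120 * (N * M * (L + t)))"
      using P N t Y by (intro mult_mono) auto
    then show ?thesis by (simp add: Q_def mult.assoc mult.left_commute)
  qed
  have "15 * b + 40 + t \<le> 135 * (L + t)" using b L t by simp
  then have "B * (15 * b + 40 + t) \<le> Y * (135 * (L + t))"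
    using B b t Y by (intro mult_mono) auto
  then have "2 * B * (15 * b + 40 + t) \<le> 270 * (Y * (L + t))"
    by (simp add: algebra_simps)
  moreover have "15 * b + 30 + t + 3 \<le> 1 * (125 * (L + t))" using b L t by simp
  moreover have "1 * (L + t) \<le> Y * (L + t)" using Y Lt by (intro mult_right_mono) auto
  ultimately have it: "15 * b + 30 + t + 2 * B * (15 * b + 40 + t) + 3 \<le> 395 * (Y * (L + t))" by linarith
  have "2 * N * K * (15 * b + 30 + t + 2 * B * (15 * b + 40 + t) + 3) \<le> 2 * N * (5 * M) * (395 * (Y * (L + t)))"
    using it K N b t B M by (intro mult_mono) auto
  also have "\<dots> = 3950 * Q" by (simp add: Q_def)
  \<comment> \<open>The coefficients of \<open>Q\<close> add up to
    \<open>120 + 210 + 32 + 2 + 120 + 3950 = 4434\<close>.\<close>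
  finally show ?thesis unfolding Q_def[symmetric] using NQ one tQ KQ PQ by linarith
qed

lemma matroid_cluster_model:
  assumes "matroid {1..n} I" "0 \<le> q" "q \<le> 1" "\<And>i. i \<in> {1..n} \<Longrightarrow> lam i > 0" "n \<ge> 1"
  shows "cluster_model n (rank_of I) q lam"
proof -
  interpret matroid "{1..n}" I by fact
  show ?thesis
    using assms rank_submodular by unfold_locales (auto intro: rank_mono rank_insert_le)
qed

context cluster_model
begin

text \<open>Up to the constant factor \<open>q ^ rk ground / (\<Prod>i\<in>ground. lam i)\<close> (with \<open>q\<close> replaced by
  \<open>1\<close> if \<open>q = 0\<close>) both weights agree.\<close>

lemma random_cluster_eq_gibbs:
  assumes "S \<subseteq> ground"
  shows "random_cluster ground rk q lam S = gibbs S"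
proof -
  define c where "c = (if q = 0 then 1 else q ^ rk ground) / (\<Prod>i\<in>ground. lam i)"
  have prod_pos: "(\<Prod>i\<in>A. lam i) > 0" if "A \<subseteq> ground" for A
    using that lam by (intro prod_pos) auto
  have c: "c > 0" using prod_pos[of ground] q by (auto simp: c_def)
  have wt: "wt X = c * rc_weight ground rk q lam X" if X: "X \<subseteq> ground" for X
  proof -
    have "(\<Prod>i\<in>ground. lam i) = (\<Prod>i\<in>ground - X. lam i) * (\<Prod>i\<in>X. lam i)"
      using X by (intro prod.subset_diff) auto
    moreover have "(\<Prod>i\<in>ground - X. 1 / lam i) = 1 / (\<Prod>i\<in>ground - X. lam i)"
      by (simp add: prod_dividef)
    ultimately have prod: "(\<Prod>i\<in>ground - X. 1 / lam i) = (\<Prod>i\<in>X. lam i) / (\<Prod>i\<in>ground. lam i)"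
      using prod_pos[OF X] by simp
    have le: "rk X \<le> rk ground" using X by (intro rk_mono) auto
    show ?thesis
    proof (cases "q = 0")
      case True
      then show ?thesis unfolding wt_def rc_weight_def c_def prod using le by simp
    next
      case False
      then have "q ^ (rk ground - rk X) = q ^ rk ground * q powi (- int (rk X))"
        using le by (simp add: power_diff power_int_minus divide_inverse)
      then show ?thesis using False by (simp add: wt_def rc_weight_def c_def prod)
    qed
  qed
  have "partition_function = c * (\<Sum>X\<in>Pow ground. rc_weight ground rk q lam X)"
    unfolding partition_function_def sum_distrib_left using wt by (intro sum.cong) auto
  then show ?thesis using c wt[OF assms] by (simp add: random_cluster_def gibbs_def)
qed

lemma sampler_output:
  assumes \<epsilon>: "0 < \<epsilon>"
  shows "\<exists>\<mu>. output_distribution n rk sampler (input_store n q lam \<epsilon>) \<mu> \<and>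
    tv_distance (Pow ground) (pmf \<mu>) (random_cluster ground rk q lam) \<le> \<epsilon>"
proof -
  let ?s = "input_store n q lam \<epsilon>"
  define N where "N = 2 * n * doublings n \<epsilon>"
  define h where "h = (chain_step ^^ N) (indicator {start_set})"
  note law = start_set_subset gibbs_start(1)
  have h0: "h X \<ge> 0" for X unfolding h_def by (rule chain_law_nonneg[OF law])
  have out: "h X = 0" if "\<not> X \<subseteq> ground" for X using chain_law_outside[OF law that] by (simp add: h_def)
  have mean: "(step_mean ^^ N) g start_set = (\<Sum>X\<in>Pow ground. h X * g X)" for g
    unfolding h_def by (rule chain_law_mean[OF law, symmetric])
  define \<mu> where "\<mu> = embed_pmf h"
  have "(\<integral>\<^sup>+ X. ennreal (h X) \<partial>count_space UNIV) = (\<Sum>X\<in>Pow ground. ennreal (h X))"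
    using out by (intro nn_integral_count_space') auto
  also have "\<dots> = ennreal (\<Sum>X\<in>Pow ground. h X)" using h0 by (simp add: sum_ennreal)
  also have "(\<Sum>X\<in>Pow ground. h X) = 1" unfolding h_def by (rule chain_law_sum[OF law])
  finally have \<mu>: "pmf \<mu> X = h X" for X unfolding \<mu>_def using h0 by (intro pmf_embed_pmf) auto
  have input: "nats ?s 0 0 = n" "reals ?s 0 0 = q" "reals ?s 0 1 = \<epsilon>" "i \<in> ground \<Longrightarrow> reals ?s 1 i = lam i" for i
    by (auto simp: input_store_def)
  have cm: "cluster_machine n rk q lam a b (field_bound n)" if "a \<ge> 0" "b \<ge> 0" for a b
    by unfold_locales (use that field_bound_ge in auto)
  have "output_distribution n rk sampler ?s \<mu>"
  proof (rule output_distributionI)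
    \<comment> \<open>Unit time for commands and none for queries: a finite bound here gives almost
      sure termination.\<close>
    interpret cluster_machine n rk q lam 1 0 "field_bound n" by (rule cm) auto
    have "ert sampler (\<lambda>_. 0) ?s \<sqsubseteq> sampler_cost \<epsilon> + (step_mean ^^ (2 * n * doublings n \<epsilon>)) (\<lambda>_. 0) start_set"
      by (rule bounded_by_sampler[OF input \<epsilon> refl]) (simp_all add: bounded_by_def)
    then have "ert sampler (\<lambda>_. 0) ?s \<le> ennreal (sampler_cost \<epsilon> + (step_mean ^^ (2 * n * doublings n \<epsilon>)) (\<lambda>_. 0) start_set)"
      by (simp add: bounded_by_def)
    also have "\<dots> < \<infinity>" by simp
    finally show "ert sampler (\<lambda>_. 0) ?s < \<infinity>" .
  next
    fix X assume X: "X \<subseteq> ground"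
    \<comment> \<open>With free commands \<open>sampler_cost\<close> is 0, and the bound for the
      indicator of \<open>X\<close> is the mass that the chain gives to \<open>X\<close> after
      \<open>N\<close> steps.\<close>
    interpret cluster_machine n rk q lam 0 0 "field_bound n" by (rule cm) auto
    have "ert sampler (\<lambda>s. indicator {X} (read_set n 1 s)) ?s
      \<sqsubseteq> sampler_cost \<epsilon> + (step_mean ^^ (2 * n * doublings n \<epsilon>)) (indicator {X}) start_set"
      by (rule bounded_by_sampler[OF input \<epsilon> refl]) (auto simp: bounded_by_def good_def indicator_def)
    moreover have "sampler_cost \<epsilon> = 0"
      by (simp add: sampler_cost_def search_cost_def iteration_cost_def accept_cost_def)
    moreover have "(step_mean ^^ N) (indicator {X}) start_set = h X"
    proof -
      have "(\<Sum>Y\<in>Pow ground. h Y * indicator {X} Y) = (\<Sum>Y\<in>Pow ground. if Y = X then h X else 0)"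
        by (intro sum.cong refl) (auto simp: indicator_def)
      then show ?thesis unfolding mean using X by simp
    qed
    ultimately show "ert sampler (\<lambda>s. indicator {X} (read_set n 1 s)) ?s \<le> ennreal (pmf \<mu> X)"
      by (simp add: bounded_by_def \<mu> N_def)
  qed (simp add: \<mu> out)
  moreover have "tv_distance (Pow ground) (pmf \<mu>) (random_cluster ground rk q lam) \<le> \<epsilon>"
  proof -
    have "tv_distance (Pow ground) (pmf \<mu>) (random_cluster ground rk q lam) = tv_distance (Pow ground) h gibbs"
      unfolding tv_distance_def by (intro arg_cong2[where f = "(*)"] sum.cong refl) (simp add: \<mu> random_cluster_eq_gibbs)
    then show ?thesis using mixing[OF \<epsilon>] by (simp add: h_def N_def)
  qed
  ultimately show ?thesis by blast
qed

text \<open>The search is affordable because its number of codes \<open>P\<close> is nonzero only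
  below \<open>field_bound n\<close>, which is at most \<open>Y\<close>. The restriction to
  \<open>n \<ge> 2\<close> is due to the factor \<open>ln n + t\<close>, which vanishes at
  \<open>n = 1\<close> and \<open>t = 0\<close>.\<close>

lemma sampler_time:
  assumes \<epsilon>: "0 < \<epsilon>" "\<epsilon> < 1" and t: "t \<ge> 0" and n2: "n \<ge> 2"
  shows "expected_time n rk t sampler (input_store n q lam \<epsilon>)
    \<le> ennreal (5000 * (1 + inverse (Min (lam ` ground))) * real n * ln (real n / \<epsilon>) * (ln (real n) + t))"
proof -
  let ?s = "input_store n q lam \<epsilon>"
  interpret cluster_machine n rk q lam 1 t "field_bound n"
    by unfold_locales (use t field_bound_ge in auto)
  have input: "nats ?s 0 0 = n" "reals ?s 0 0 = q" "reals ?s 0 1 = \<epsilon>" "i \<in> ground \<Longrightarrow> reals ?s 1 i = lam i" for i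
    by (auto simp: input_store_def)
  define Y where "Y = 1 + inverse (Min (lam ` ground))"
  have ne: "lam ` ground \<noteq> {}" "finite (lam ` ground)" using n by auto
  have "Min (lam ` ground) \<in> lam ` ground" using ne by (intro Min_in)
  then have Min_pos: "Min (lam ` ground) > 0" using lam by auto
  have Y: "Y \<ge> 1" using Min_pos by (simp add: Y_def)
  have "1 / lam i \<le> Y" if "i \<in> ground" for i
  proof -
    have "Min (lam ` ground) \<le> lam i" using that ne by (intro Min_le) auto
    then have "inverse (lam i) \<le> inverse (Min (lam ` ground))" using Min_pos by (intro le_imp_inverse_le)
    then show ?thesis by (simp add: Y_def inverse_eq_divide)
  qed
  then have BY: "field_bound n \<le> Y"
    unfolding field_bound_def using Y by (intro Max.boundedI) auto
  have ln2: "ln 2 \<ge> (2 / 3 :: real)" by (rule ln2_ge_two_thirds)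
  have "ln 2 \<le> ln (real n)" using n2 by simp
  then have L: "ln (real n) \<ge> 2 / 3" using ln2 by linarith
  have "ln (real n) \<le> ln (n / \<epsilon>)" using n2 \<epsilon> by (simp add: le_divide_eq)
  then have M: "ln (n / \<epsilon>) \<ge> 2 / 3" using L by linarith
  define P :: real where "P = (if 2 ^ n < field_bound n then 2 ^ n else 0)"
  have P: "0 \<le> P" "P \<le> Y" using BY Y by (auto simp: P_def)
  have "(step_mean ^^ k) (\<lambda>_. 0) X = 0" for k X
    by (induction k arbitrary: X) (auto simp: step_mean_def up_mean_def)
  then have bound: "ert sampler (\<lambda>_. 0) ?s \<sqsubseteq> sampler_cost \<epsilon>"
    using bounded_by_sampler[OF input \<epsilon>(1) refl, of "\<lambda>_. 0" "\<lambda>_. 0"] by (simp add: bounded_by_def)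
  have "sampler_cost \<epsilon> = 40 * real n + 70 + 4 * real (doublings n \<epsilon>) + t + P * (17 * real n + 26 + t)
      + 2 * real n * real (doublings n \<epsilon>) *
        (15 * (real (bits n) + 1) + 30 + t + 2 * field_bound n * (15 * (real (bits n) + 1) + 40 + t) + 3)"
    by (simp add: sampler_cost_def search_cost_def iteration_cost_def accept_cost_def P_def)
  also have "\<dots> \<le> 5000 * (Y * real n * ln (n / \<epsilon>) * (ln n + t))"
    by (rule sampler_cost_arithmetic)
      (use L M t Y n bits_le_ln[OF n2] doublings_le_ln[OF n2 \<epsilon>] P BY field_bound_ge(1) in auto)
  finally have "sampler_cost \<epsilon> \<le> 5000 * Y * real n * ln (n / \<epsilon>) * (ln n + t)" by (simp add: mult.assoc)
  then have "ert sampler (\<lambda>_. 0) ?s \<le> ennreal (5000 * Y * real n * ln (n / \<epsilon>) * (ln n + t))"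
    using bound unfolding bounded_by_def by (meson ennreal_leI order_trans)
  then show ?thesis
    using expected_time_le_ert[OF t, of n rk sampler ?s] unfolding Y_def by (meson order_trans)
qed

end

theorem theorem1p3:
  "\<exists>(p :: com) (C :: real). C > 0 \<and>
     (\<forall>(q :: real) (n :: nat) (I :: nat set set) (lam :: nat \<Rightarrow> real) (\<epsilon> :: real) (t :: real).
        0 \<le> q \<and> q \<le> 1 \<and> n \<ge> 1 \<and> matroid {1..n} I \<and> (\<forall>i\<in>{1..n}. lam i > 0) \<and>
        0 < \<epsilon> \<and> \<epsilon> < 1 \<and> t \<ge> 0 \<longrightarrow>
        (\<exists>\<mu> :: nat set pmf.
           output_distribution n (rank_of I) p (input_store n q lam \<epsilon>) \<mu> \<and>
           tv_distance (Pow {1..n}) (pmf \<mu>) (random_cluster {1..n} (rank_of I) q lam) \<le> \<epsilon>) \<and>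
        (n \<ge> 2 \<longrightarrow>
           expected_time n (rank_of I) t p (input_store n q lam \<epsilon>)
           \<le> ennreal (C * (1 + inverse (Min (lam ` {1..n}))) * real n * ln (real n / \<epsilon>)
                        * (ln (real n) + t))))"
proof (intro exI[of _ sampler] exI[of _ "5000 :: real"] conjI allI impI)
  fix q :: real and n :: nat and I lam \<epsilon> t
  assume "0 \<le> q \<and> q \<le> 1 \<and> n \<ge> 1 \<and> matroid {1..n} I \<and> (\<forall>i\<in>{1..n}. lam i > (0 :: real)) \<and>
    0 < \<epsilon> \<and> \<epsilon> < (1 :: real) \<and> t \<ge> (0 :: real)"
  then have asm: "0 \<le> q" "q \<le> 1" "n \<ge> 1" "matroid {1..n} I" "\<And>i. i \<in> {1..n} \<Longrightarrow> lam i > 0"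
    "0 < \<epsilon>" "\<epsilon> < 1" "t \<ge> 0" by auto
  then interpret cluster_model n "rank_of I" q lam by (intro matroid_cluster_model) auto
  show "\<exists>\<mu>. output_distribution n (rank_of I) sampler (input_store n q lam \<epsilon>) \<mu> \<and>
      tv_distance (Pow {1..n}) (pmf \<mu>) (random_cluster {1..n} (rank_of I) q lam) \<le> \<epsilon>"
    by (rule sampler_output[OF asm(6)])
  show "expected_time n (rank_of I) t sampler (input_store n q lam \<epsilon>)
      \<le> ennreal (5000 * (1 + inverse (Min (lam ` {1..n}))) * real n * ln (real n / \<epsilon>) * (ln (real n) + t))"
    if "n \<ge> 2"
    by (rule sampler_time[OF asm(6-8) that])
qed simp

end
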